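(* Assume (SMO) and (SCS) hold for the limit equilibrium $\mathrm{FPPE}(b,v,s)$. Let $L:\mathbb R\to\mathbb R$ be any symmetric quasi-convex loss. Then $$\inf_{\{\hat r_t\}}\mathrm{LAR}_{\mathrm{REV}}(\{\hat r_t\})\ \ge\ \mathbb E\big[L\big(\mathcal N(0,\sigma^2_{\mathrm{REV}})\big)\big],$$ where the infimum is over all sequences of (measurable) estimators $\hat r_t:\Theta^t\to\mathbb R$, and the expectation on the right is of $L$ applied to a normal random variable with mean $0$ and variance $\sigma^2_{\mathrm{REV}}=\mathbb E[D_{\mathrm{REV}}(\theta)^2]$.
   Context: Market. There are $n$ buyers with budgets $b=(b_1,\dots,b_n)$, $b_i>0$, and an item space $\Theta$ with integrating measure $d\theta$. $L^p$ (resp. $L^p_+$) denotes (nonnegative) $L^p$ functions on $\Theta$; functions agreeing outside a measure-zero set are identified; $\langle f,g\rangle=\int_\Theta fg\,d\theta$. Buyer $i$ has valuation $v_i\in L^1_+$, $v=(v_1,\dots,v_n)$, with $\bar v=\max_i\sup_\theta v_i(\theta)<\infty$. The supply is $s\in L^\infty_+$ with $\int_\Theta s\,d\theta=1$. Write $\mathbb E[g]=\int g(\theta)s(\theta)\,d\theta$. Limit FPPE. $\mathrm{FPPE}(b,v,s)$ is a tuple $(\beta,p,x_1,\dots,x_n)\in[0,1]^n\times L^1_+\times(L^\infty_+)^n$ such that: (i) for all $\theta$, $p(\theta)=\max_i\beta_iv_i(\theta)$, and $x_i(\theta)>0$ implies $\beta_iv_i(\theta)=\max_k\beta_kv_k(\theta)$;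 (ii) for all $i$, $\int x_i p s\,d\theta\le b_i$, and for all $\theta$, $\sum_i x_i(\theta)\le1$; (iii) for all $i$, $\int x_ips\,d\theta<b_i$ implies $\beta_i=1$, and for all $\theta$, $p(\theta)>0$ implies $\sum_ix_i(\theta)=1$. It is known that it exists and $\beta^*,p^*$ are unique; limit quantities carry a superscript $*$. Define $\mathrm{REV}^*=\int p^*s\,d\theta$, leftover budgets $\delta_i^*=b_i-\langle p^*,sx_i^*\rangle$, item utilities $\bar\mu_i^*=\langle v_i,sx_i^*\rangle$, and $\mu^*(\theta)=(x_1^*(\theta)v_1(\theta),\dots,x_n^*(\theta)v_n(\theta))$. (Under (SMO), $\mu^*$, $\bar\mu^*$, $\delta^*$ are uniquely determined.) Dual program. $H(\beta)=\mathbb E[\max_i\beta_iv_i(\theta)]-\sum_ib_i\log\beta_i$; it is known that $\beta^*$ is its unique minimizer over $B=(0,1]^n$. (SMO): the map $\beta\mapsto\mathbb E[\max_i\beta_iv_i(\theta)]$ is $C^2$ in a neighborhood of $\beta^*$. (SCS): $\beta_i^*=1$ implies $\delta_i^*>0$, for every $i$. Let $\mathcal H=\nabla^2H(\beta^* )$, $\mathcal P=\mathrm{diag}(\mathbf 1(\beta_i^*<1))$, $\mathcal H_B=\mathcal P\mathcal H\mathcal P$; $\dagger$ is the Moore–Penrose pseudo-inverse. $D_\beta(\theta)=-(\mathcal H_B)^\dagger(\mu^*(\theta)-\bar\mu^* )$, $D_{\mathrm{REV}}(\theta)=p^*(\theta)-\mathrm{REV}^*+(\bar\mu^* )^\top D_\beta(\theta)$.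 Local asymptotic risk. For $d\in\mathbb N$ let $G_d=\{g:\Theta\to\mathbb R^d:\ \mathbb E[g]=0,\ \mathbb E[\|g\|^2]<\infty\}$. For $\alpha\in\mathbb R^d$, $g\in G_d$, the perturbed supply is $s_{\alpha,g}(\theta)=C^{-1}[1+\alpha^\top g(\theta)]s(\theta)$ with $C=1+\int\alpha^\top g(\theta)s(\theta)\,d\theta$. Let $\mathrm{REV}^*_{\alpha,g}$ be the revenue of $\mathrm{FPPE}(b,v,s_{\alpha,g})$. For a sequence of estimators $\hat r_t:\Theta^t\to\mathbb R$, $$\mathrm{LAR}_{\mathrm{REV}}(\{\hat r_t\})=\sup_{d\in\mathbb N,\,g\in G_d}\ \lim_{c\to\infty}\ \liminf_{t\to\infty}\ \sup_{\|\alpha\|_2\le c/\sqrt t}\ \mathbb E_{s_{\alpha,g}^{\otimes t}}\big[L\big(\sqrt t(\hat r_t-\mathrm{REV}^*_{\alpha,g})\big)\big],$$ where the expectation is over $t$ i.i.d. items with density $s_{\alpha,g}$, and the inner supremum is over those $\alpha$ for which $s_{\alpha,g}$ is a valid supply (nonnegative and in $L^\infty$). A function is quasi-convex if its sublevel sets are convex; symmetric means $L(-x)=L(x)$. *)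

theory Defs
  imports "HOL-Probability.Probability"
begin

text \<open>
  The item space is an arbitrary measure \<open>M\<close>.  Functions on it are identified when they agree almost
  everywhere, so ``for all items'' is \<open>AE \<theta> in M\<close> throughout.  Buyers are indexed by a finite type
  \<open>'n\<close>, so budgets and multipliers live in \<open>real ^ 'n\<close>.
\<close>

definition L1_plus :: "'a measure \<Rightarrow> ('a \<Rightarrow> real) set" where
  "L1_plus M = {f. integrable M f \<and> (AE \<theta> in M. 0 \<le> f \<theta>)}"

definition Linf_plus :: "'a measure \<Rightarrow> ('a \<Rightarrow> real) set" where
  "Linf_plus M =
     {f \<in> borel_measurable M. (AE \<theta> in M. 0 \<le> f \<theta>) \<and> (\<exists>K. AE \<theta> in M. f \<theta> \<le> K)}"

definition supply_exp :: "'a measure \<Rightarrow> ('a \<Rightarrow> real) \<Rightarrow> ('a \<Rightarrow> real) \<Rightarrow> real" where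
  "supply_exp M s f = (\<integral>\<theta>. f \<theta> * s \<theta> \<partial>M)"

definition market ::
  "'a measure \<Rightarrow> real ^ 'n \<Rightarrow> ('n \<Rightarrow> 'a \<Rightarrow> real) \<Rightarrow> ('a \<Rightarrow> real) \<Rightarrow> bool" where
  "market M b v s \<longleftrightarrow>
     (\<forall>i. 0 < b $ i) \<and>
     (\<forall>i. v i \<in> L1_plus M \<and> v i \<in> Linf_plus M) \<and>
     s \<in> Linf_plus M \<and> (\<integral>\<theta>. s \<theta> \<partial>M) = 1"

definition max_bid :: "('n \<Rightarrow> 'a \<Rightarrow> real) \<Rightarrow> real ^ 'n::finite \<Rightarrow> 'a \<Rightarrow> real" where
  "max_bid v \<beta> \<theta> = Max (range (\<lambda>i. \<beta> $ i * v i \<theta>))"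

definition spend ::
  "'a measure \<Rightarrow> ('a \<Rightarrow> real) \<Rightarrow> ('a \<Rightarrow> real) \<Rightarrow> ('n \<Rightarrow> 'a \<Rightarrow> real) \<Rightarrow> 'n \<Rightarrow> real" where
  "spend M s p x i = (\<integral>\<theta>. x i \<theta> * p \<theta> * s \<theta> \<partial>M)"

definition is_FPPE ::
  "'a measure \<Rightarrow> real ^ 'n::finite \<Rightarrow> ('n \<Rightarrow> 'a \<Rightarrow> real) \<Rightarrow> ('a \<Rightarrow> real) \<Rightarrow>
   real ^ 'n \<Rightarrow> ('a \<Rightarrow> real) \<Rightarrow> ('n \<Rightarrow> 'a \<Rightarrow> real) \<Rightarrow> bool" where
  "is_FPPE M b v s \<beta> p x \<longleftrightarrow>
     (\<forall>i. \<beta> $ i \<in> {0..1}) \<and> p \<in> L1_plus M \<and> (\<forall>i. x i \<in> Linf_plus M) \<and>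
     (AE \<theta> in M. p \<theta> = max_bid v \<beta> \<theta>) \<and>
     (\<forall>i. AE \<theta> in M. 0 < x i \<theta> \<longrightarrow> \<beta> $ i * v i \<theta> = max_bid v \<beta> \<theta>) \<and>
     (\<forall>i. spend M s p x i \<le> b $ i) \<and>
     (AE \<theta> in M. (\<Sum>i\<in>UNIV. x i \<theta>) \<le> 1) \<and>
     (\<forall>i. spend M s p x i < b $ i \<longrightarrow> \<beta> $ i = 1) \<and>
     (AE \<theta> in M. 0 < p \<theta> \<longrightarrow> (\<Sum>i\<in>UNIV. x i \<theta>) = 1)"

definition revenue :: "'a measure \<Rightarrow> ('a \<Rightarrow> real) \<Rightarrow> ('a \<Rightarrow> real) \<Rightarrow> real" where
  "revenue M s p = (\<integral>\<theta>. p \<theta> * s \<theta> \<partial>M)"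

text \<open>Well defined because an equilibrium exists and its price is unique almost everywhere.\<close>

definition FPPE_revenue ::
  "'a measure \<Rightarrow> real ^ 'n::finite \<Rightarrow> ('n \<Rightarrow> 'a \<Rightarrow> real) \<Rightarrow> ('a \<Rightarrow> real) \<Rightarrow> real" where
  "FPPE_revenue M b v s = (THE r. \<exists>\<beta> p x. is_FPPE M b v s \<beta> p x \<and> r = revenue M s p)"

definition leftover ::
  "'a measure \<Rightarrow> real ^ 'n \<Rightarrow> ('a \<Rightarrow> real) \<Rightarrow> ('a \<Rightarrow> real) \<Rightarrow> ('n \<Rightarrow> 'a \<Rightarrow> real) \<Rightarrow> 'n \<Rightarrow> real" where
  "leftover M b s p x i = b $ i - (\<integral>\<theta>. p \<theta> * (s \<theta> * x i \<theta>) \<partial>M)"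

definition item_utility :: "('n \<Rightarrow> 'a \<Rightarrow> real) \<Rightarrow> ('n \<Rightarrow> 'a \<Rightarrow> real) \<Rightarrow> 'a \<Rightarrow> real ^ 'n" where
  "item_utility v x \<theta> = (\<chi> i. x i \<theta> * v i \<theta>)"

definition mean_utility ::
  "'a measure \<Rightarrow> ('n \<Rightarrow> 'a \<Rightarrow> real) \<Rightarrow> ('a \<Rightarrow> real) \<Rightarrow> ('n \<Rightarrow> 'a \<Rightarrow> real) \<Rightarrow> real ^ 'n" where
  "mean_utility M v s x = (\<chi> i. \<integral>\<theta>. v i \<theta> * (s \<theta> * x i \<theta>) \<partial>M)"

definition gradient :: "(real ^ 'n \<Rightarrow> real) \<Rightarrow> real ^ 'n \<Rightarrow> real ^ 'n::finite" where
  "gradient f x = (\<chi> i. frechet_derivative f (at x) (axis i 1))"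

definition hessian :: "(real ^ 'n \<Rightarrow> real) \<Rightarrow> real ^ 'n \<Rightarrow> real ^ 'n ^ 'n::finite" where
  "hessian f x = jacobian (gradient f) (at x)"

definition C2_near :: "(real ^ 'n::finite \<Rightarrow> real) \<Rightarrow> real ^ 'n \<Rightarrow> bool" where
  "C2_near f x0 \<longleftrightarrow>
     (\<exists>U. open U \<and> x0 \<in> U \<and>
        (\<forall>x\<in>U. f differentiable (at x)) \<and>
        (\<forall>x\<in>U. gradient f differentiable (at x)) \<and>
        continuous_on U (hessian f))"

definition mean_max_bid ::
  "'a measure \<Rightarrow> ('n \<Rightarrow> 'a \<Rightarrow> real) \<Rightarrow> ('a \<Rightarrow> real) \<Rightarrow> real ^ 'n::finite \<Rightarrow> real" where
  "mean_max_bid M v s \<beta> = supply_exp M s (max_bid v \<beta>)"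

definition dual_objective ::
  "'a measure \<Rightarrow> real ^ 'n::finite \<Rightarrow> ('n \<Rightarrow> 'a \<Rightarrow> real) \<Rightarrow> ('a \<Rightarrow> real) \<Rightarrow> real ^ 'n \<Rightarrow> real" where
  "dual_objective M b v s \<beta> = mean_max_bid M v s \<beta> - (\<Sum>i\<in>UNIV. b $ i * ln (\<beta> $ i))"

definition SMO ::
  "'a measure \<Rightarrow> ('n \<Rightarrow> 'a \<Rightarrow> real) \<Rightarrow> ('a \<Rightarrow> real) \<Rightarrow> real ^ 'n::finite \<Rightarrow> bool" where
  "SMO M v s \<beta> \<longleftrightarrow> C2_near (mean_max_bid M v s) \<beta>"

definition SCS ::
  "'a measure \<Rightarrow> real ^ 'n \<Rightarrow> ('a \<Rightarrow> real) \<Rightarrow>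
   real ^ 'n \<Rightarrow> ('a \<Rightarrow> real) \<Rightarrow> ('n \<Rightarrow> 'a \<Rightarrow> real) \<Rightarrow> bool" where
  "SCS M b s \<beta> p x \<longleftrightarrow> (\<forall>i. \<beta> $ i = 1 \<longrightarrow> 0 < leftover M b s p x i)"

definition is_moore_penrose :: "real ^ 'n ^ 'm \<Rightarrow> real ^ 'm ^ 'n \<Rightarrow> bool" where
  "is_moore_penrose A X \<longleftrightarrow>
     A ** X ** A = A \<and> X ** A ** X = X \<and>
     transpose (A ** X) = A ** X \<and> transpose (X ** A) = X ** A"

definition pinv :: "real ^ 'n ^ 'm \<Rightarrow> real ^ 'm ^ 'n" where
  "pinv A = (THE X. is_moore_penrose A X)"

definition inactive_proj :: "real ^ 'n \<Rightarrow> real ^ 'n ^ 'n" where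
  "inactive_proj \<beta> = (\<chi> i j. if i = j \<and> \<beta> $ i < 1 then 1 else 0)"

definition H_B ::
  "'a measure \<Rightarrow> real ^ 'n::finite \<Rightarrow> ('n \<Rightarrow> 'a \<Rightarrow> real) \<Rightarrow> ('a \<Rightarrow> real) \<Rightarrow> real ^ 'n \<Rightarrow> real ^ 'n ^ 'n" where
  "H_B M b v s \<beta> =
     inactive_proj \<beta> ** hessian (dual_objective M b v s) \<beta> ** inactive_proj \<beta>"

definition D_beta ::
  "'a measure \<Rightarrow> real ^ 'n::finite \<Rightarrow> ('n \<Rightarrow> 'a \<Rightarrow> real) \<Rightarrow> ('a \<Rightarrow> real) \<Rightarrow>
   real ^ 'n \<Rightarrow> ('n \<Rightarrow> 'a \<Rightarrow> real) \<Rightarrow> 'a \<Rightarrow> real ^ 'n" where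
  "D_beta M b v s \<beta> x \<theta> =
     - (pinv (H_B M b v s \<beta>) *v (item_utility v x \<theta> - mean_utility M v s x))"

definition D_REV ::
  "'a measure \<Rightarrow> real ^ 'n::finite \<Rightarrow> ('n \<Rightarrow> 'a \<Rightarrow> real) \<Rightarrow> ('a \<Rightarrow> real) \<Rightarrow>
   real ^ 'n \<Rightarrow> ('a \<Rightarrow> real) \<Rightarrow> ('n \<Rightarrow> 'a \<Rightarrow> real) \<Rightarrow> 'a \<Rightarrow> real" where
  "D_REV M b v s \<beta> p x \<theta> =
     p \<theta> - revenue M s p + mean_utility M v s x \<bullet> D_beta M b v s \<beta> x \<theta>"

definition sigma2_REV ::
  "'a measure \<Rightarrow> real ^ 'n::finite \<Rightarrow> ('n \<Rightarrow> 'a \<Rightarrow> real) \<Rightarrow> ('a \<Rightarrow> real) \<Rightarrow>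
   real ^ 'n \<Rightarrow> ('a \<Rightarrow> real) \<Rightarrow> ('n \<Rightarrow> 'a \<Rightarrow> real) \<Rightarrow> real" where
  "sigma2_REV M b v s \<beta> p x = supply_exp M s (\<lambda>\<theta>. (D_REV M b v s \<beta> p x \<theta>)\<^sup>2)"

text \<open>
  Expectation of a real function as an extended real.  A symmetric quasi-convex loss is bounded
  below by its value at \<open>0\<close>, so on a probability space its negative part has finite integral and
  the difference below is never \<open>\<infinity> - \<infinity>\<close>.
\<close>

definition ext_exp :: "'b measure \<Rightarrow> ('b \<Rightarrow> real) \<Rightarrow> ereal" where
  "ext_exp N f =
     enn2ereal (\<integral>\<^sup>+ \<omega>. ennreal (f \<omega>) \<partial>N) - enn2ereal (\<integral>\<^sup>+ \<omega>. ennreal (- f \<omega>) \<partial>N)"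

definition symmetric_loss :: "(real \<Rightarrow> real) \<Rightarrow> bool" where
  "symmetric_loss L \<longleftrightarrow> (\<forall>x. L (- x) = L x)"

definition quasi_convex :: "(real \<Rightarrow> real) \<Rightarrow> bool" where
  "quasi_convex L \<longleftrightarrow> (\<forall>c. convex {x. L x \<le> c})"

text \<open>Defined as a pushforward so that variance \<open>0\<close> gives the point mass at the mean.\<close>

definition normal_law :: "real \<Rightarrow> real \<Rightarrow> real measure" where
  "normal_law m var =
     distr (density lborel std_normal_density) borel (\<lambda>z. m + sqrt var * z)"

text \<open>
  The dimension \<open>d\<close> of the perturbation is quantified inside the risk, so a vector in
  \<open>\<real>\<^sup>d\<close> is a function on \<open>nat\<close> of which only the components \<open>i < d\<close> are used.
\<close>

definition score_dot :: "nat \<Rightarrow> (nat \<Rightarrow> real) \<Rightarrow> (nat \<Rightarrow> 'a \<Rightarrow> real) \<Rightarrow> 'a \<Rightarrow> real" where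
  "score_dot d \<alpha> g \<theta> = (\<Sum>i<d. \<alpha> i * g i \<theta>)"

definition G_dirs :: "'a measure \<Rightarrow> ('a \<Rightarrow> real) \<Rightarrow> nat \<Rightarrow> (nat \<Rightarrow> 'a \<Rightarrow> real) set" where
  "G_dirs M s d =
     {g. (\<forall>i<d. g i \<in> borel_measurable M) \<and>
         (\<forall>i<d. supply_exp M s (g i) = 0) \<and>
         integrable M (\<lambda>\<theta>. (\<Sum>i<d. (g i \<theta>)\<^sup>2) * s \<theta>)}"

definition perturbed_supply ::
  "'a measure \<Rightarrow> ('a \<Rightarrow> real) \<Rightarrow> nat \<Rightarrow> (nat \<Rightarrow> 'a \<Rightarrow> real) \<Rightarrow> (nat \<Rightarrow> real) \<Rightarrow> 'a \<Rightarrow> real" where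
  "perturbed_supply M s d g \<alpha> \<theta> =
     inverse (1 + supply_exp M s (score_dot d \<alpha> g)) * (1 + score_dot d \<alpha> g \<theta>) * s \<theta>"

definition local_params ::
  "'a measure \<Rightarrow> ('a \<Rightarrow> real) \<Rightarrow> nat \<Rightarrow> (nat \<Rightarrow> 'a \<Rightarrow> real) \<Rightarrow> real \<Rightarrow> (nat \<Rightarrow> real) set" where
  "local_params M s d g r =
     {\<alpha>. L2_set \<alpha> {..<d} \<le> r \<and> perturbed_supply M s d g \<alpha> \<in> Linf_plus M}"

definition iid_law :: "'a measure \<Rightarrow> ('a \<Rightarrow> real) \<Rightarrow> nat \<Rightarrow> (nat \<Rightarrow> 'a) measure" where
  "iid_law M s t = PiM {..<t} (\<lambda>_. density M (\<lambda>\<theta>. ennreal (s \<theta>)))"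

definition estimators :: "'a measure \<Rightarrow> (nat \<Rightarrow> (nat \<Rightarrow> 'a) \<Rightarrow> real) set" where
  "estimators M = {r. \<forall>t. r t \<in> borel_measurable (PiM {..<t} (\<lambda>_. M))}"

definition risk ::
  "'a measure \<Rightarrow> real ^ 'n::finite \<Rightarrow> ('n \<Rightarrow> 'a \<Rightarrow> real) \<Rightarrow> (real \<Rightarrow> real) \<Rightarrow>
   (nat \<Rightarrow> (nat \<Rightarrow> 'a) \<Rightarrow> real) \<Rightarrow> nat \<Rightarrow> ('a \<Rightarrow> real) \<Rightarrow> ereal" where
  "risk M b v L r t s =
     ext_exp (iid_law M s t) (\<lambda>\<omega>. L (sqrt (real t) * (r t \<omega> - FPPE_revenue M b v s)))"

definition LAR_REV ::
  "'a measure \<Rightarrow> real ^ 'n::finite \<Rightarrow> ('n \<Rightarrow> 'a \<Rightarrow> real) \<Rightarrow> ('a \<Rightarrow> real) \<Rightarrow> (real \<Rightarrow> real) \<Rightarrow>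
   (nat \<Rightarrow> (nat \<Rightarrow> 'a) \<Rightarrow> real) \<Rightarrow> ereal" where
  "LAR_REV M b v s L r =
     (SUP (d, g) \<in> (SIGMA d:UNIV. G_dirs M s d).
        Lim at_top (\<lambda>c::real.
          liminf (\<lambda>t.
            SUP \<alpha> \<in> local_params M s d g (c / sqrt (real t)).
              risk M b v L r t (perturbed_supply M s d g \<alpha>))))"

end

theory Submission
  imports Defs "HOL-Real_Asymp.Real_Asymp"
begin

text \<open>
The bound holds already along a single one-parameter family of supplies, the least favourable
one. Write \<open>D\<close> for \<open>D_REV\<close> and \<open>\<sigma>\<^sup>2\<close> for its variance. Since \<open>D\<close> is essentially bounded and has mean zero, \<open>(1 + \<alpha> * D) * s\<close> is a
supply for all small \<open>\<alpha>\<close>. The proof shows that the revenue along this family moves at speed \<open>\<sigma>\<^sup>2\<close>, and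
that no estimator can locate the local parameter \<open>h = \<alpha> * sqrt t\<close> better than a normal observation with
variance \<open>1 / \<sigma>\<^sup>2\<close>. On the scale of the revenue this is a normal error with variance \<open>\<sigma>\<^sup>2\<close>.

The speed of the revenue comes from the dual program. Equilibrium multipliers minimize the dual objective, with a quadratic gap
(\<open>FPPE_dual_gap\<close>). Hence they are unique, and they move by at most a constant times \<open>\<bar>\<alpha>\<bar>\<close> when the supply is
tilted. Every allocation to highest bidders is a subgradient of the mean maximal bid
(\<open>winning_allocation_subgradient\<close>), and convexity does the rest: it transfers differentiability
to tilted supplies (\<open>tilted_has_gradient\<close>), turns minimizers of the tilted dual into equilibria
(\<open>tilted_FPPE_exists\<close>), and makes gradients converge (\<open>subgradients_tendsto\<close>). Strict complementary slackness keeps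
active multipliers at 1. On the inactive coordinates the Hessian is positive definite, so the linearized
first-order conditions can be solved, and this produces the pseudo-inverse in \<open>D_REV\<close>
(\<open>revenue_pathwise_derivative\<close>).

The statistical part is a Bayesian computation. The likelihood ratio of \<open>h\<close> is close to \<open>exp (h * \<Delta> - h\<^sup>2 * \<sigma>\<^sup>2 / 2)\<close>, where \<open>\<Delta>\<close> is the normalized score sum.
Under a uniform prior on \<open>[- c, c]\<close> the posterior is therefore nearly normal with variance \<open>1 / \<sigma>\<^sup>2\<close>, and
among all windows of a given length the centred one has the largest normal mass (\<open>normal_window_le\<close>). What remains is
to average over samples: the mass of the likelihood on a slightly longer interval carries almost the full Gaussian mass,
and the average of this mass over samples is exactly the length of that interval
(\<open>average_window_risk\<close>).

A symmetric quasi-convex loss is a nondecreasing function of \<open>\<bar>x\<bar>\<close>. It is approximated from below by finite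
staircases, that is, by sums of indicators of complements of windows. One prior serves all windows at the same time, so the window
bound applies to staircases (\<open>local_risk_ge_staircase\<close>), and Fatou's lemma gives the bound for the loss itself.
\<close>

section \<open>Essentially bounded functions\<close>

definition ess_bounded :: "'a measure \<Rightarrow> ('a \<Rightarrow> real) \<Rightarrow> bool" where
  "ess_bounded M f \<longleftrightarrow> f \<in> borel_measurable M \<and> (\<exists>K. AE \<theta> in M. \<bar>f \<theta>\<bar> \<le> K)"

lemma ess_bounded_measurable: "ess_bounded M f \<Longrightarrow> f \<in> borel_measurable M"
  by (simp add: ess_bounded_def)

lemma ess_boundedI: "f \<in> borel_measurable M \<Longrightarrow> AE \<theta> in M. \<bar>f \<theta>\<bar> \<le> K \<Longrightarrow> ess_bounded M f"
  by (auto simp: ess_bounded_def)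

lemma ess_boundedE:
  assumes "ess_bounded M f"
  obtains K where "AE \<theta> in M. \<bar>f \<theta>\<bar> \<le> K" "0 \<le> K"
proof -
  from assms obtain K where "AE \<theta> in M. \<bar>f \<theta>\<bar> \<le> K" by (auto simp: ess_bounded_def)
  then have "AE \<theta> in M. \<bar>f \<theta>\<bar> \<le> max K 0" by eventually_elim auto
  then show ?thesis using that by (meson max.cobounded2)
qed

lemma ess_bounded_Linf_plus: "f \<in> Linf_plus M \<Longrightarrow> ess_bounded M f"
proof -
  assume f: "f \<in> Linf_plus M"
  then obtain K where "AE \<theta> in M. 0 \<le> f \<theta>" "AE \<theta> in M. f \<theta> \<le> K"
    by (auto simp: Linf_plus_def)
  then have "AE \<theta> in M. \<bar>f \<theta>\<bar> \<le> K" by eventually_elim auto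
  then show ?thesis using f by (auto simp: ess_bounded_def Linf_plus_def)
qed

lemma ess_bounded_const [intro]: "ess_bounded M (\<lambda>_. c)"
  by (rule ess_boundedI[where K="\<bar>c\<bar>"]) auto

lemma ess_bounded_add [intro]:
  assumes "ess_bounded M f" "ess_bounded M g"
  shows "ess_bounded M (\<lambda>\<theta>. f \<theta> + g \<theta>)"
proof -
  obtain A where A: "AE \<theta> in M. \<bar>f \<theta>\<bar> \<le> A" using assms(1) by (rule ess_boundedE)
  obtain B where B: "AE \<theta> in M. \<bar>g \<theta>\<bar> \<le> B" using assms(2) by (rule ess_boundedE)
  have "AE \<theta> in M. \<bar>f \<theta> + g \<theta>\<bar> \<le> A + B" using A B by eventually_elim auto
  then show ?thesis
    by (rule ess_boundedI[rotated]) (intro borel_measurable_add ess_bounded_measurable assms)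
qed

lemma ess_bounded_mult [intro]:
  assumes "ess_bounded M f" "ess_bounded M g"
  shows "ess_bounded M (\<lambda>\<theta>. f \<theta> * g \<theta>)"
proof -
  obtain A where A: "AE \<theta> in M. \<bar>f \<theta>\<bar> \<le> A" "0 \<le> A" using assms(1) by (rule ess_boundedE)
  obtain B where B: "AE \<theta> in M. \<bar>g \<theta>\<bar> \<le> B" "0 \<le> B" using assms(2) by (rule ess_boundedE)
  have "AE \<theta> in M. \<bar>f \<theta> * g \<theta>\<bar> \<le> A * B" using A(1) B(1)
    by eventually_elim (auto simp: abs_mult intro!: mult_mono A)
  then show ?thesis
    by (rule ess_boundedI[rotated]) (intro borel_measurable_times ess_bounded_measurable assms)
qed

lemma ess_bounded_diff [intro]:
  assumes "ess_bounded M f" "ess_bounded M g"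
  shows "ess_bounded M (\<lambda>\<theta>. f \<theta> - g \<theta>)"
  using ess_bounded_add[OF assms(1) ess_bounded_mult[OF ess_bounded_const[of M "-1"] assms(2)]] by simp

lemma ess_bounded_sum [intro]:
  assumes "finite I" "\<And>i. i \<in> I \<Longrightarrow> ess_bounded M (f i)"
  shows "ess_bounded M (\<lambda>\<theta>. \<Sum>i\<in>I. f i \<theta>)"
  using assms
proof (induction rule: finite_induct)
  case (insert i I)
  then show ?case by (simp add: ess_bounded_add)
qed auto

lemma ess_bounded_AE_cong:
  assumes "ess_bounded M f" "g \<in> borel_measurable M" "AE \<theta> in M. g \<theta> = f \<theta>"
  shows "ess_bounded M g"
proof -
  obtain A where A: "AE \<theta> in M. \<bar>f \<theta>\<bar> \<le> A" using assms(1) by (rule ess_boundedE)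
  have "AE \<theta> in M. \<bar>g \<theta>\<bar> \<le> A" using A assms(3) by eventually_elim auto
  then show ?thesis using assms(2) by (rule ess_boundedI[rotated])
qed

section \<open>Maximal bids and allocations to the winners\<close>

lemma max_bid_ge: "\<beta> $ i * v i \<theta> \<le> max_bid v \<beta> \<theta>"
  unfolding max_bid_def by (intro Max_ge) auto

lemma max_bid_le: "(\<And>i. \<beta> $ i * v i \<theta> \<le> c) \<Longrightarrow> max_bid v \<beta> \<theta> \<le> c"
  unfolding max_bid_def by (subst Max_le_iff) auto

lemma max_bid_attained: "\<exists>i. max_bid v \<beta> \<theta> = \<beta> $ i * v i \<theta>"
proof -
  have "max_bid v \<beta> \<theta> \<in> range (\<lambda>i. \<beta> $ i * v i \<theta>)"
    unfolding max_bid_def by (intro Max_in) auto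
  then show ?thesis by auto
qed

lemma max_bid_Lipschitz:
  fixes \<beta> \<beta>' :: "real ^ 'n::finite"
  assumes "\<And>i. \<bar>v i \<theta>\<bar> \<le> V"
  shows "\<bar>max_bid v \<beta> \<theta> - max_bid v \<beta>' \<theta>\<bar> \<le> norm (\<beta> - \<beta>') * V"
proof -
  have V: "0 \<le> V" using assms[of undefined] by linarith
  have *: "max_bid v \<beta> \<theta> \<le> max_bid v \<beta>' \<theta> + norm (\<beta> - \<beta>') * V" for \<beta> \<beta>' :: "real^'n"
  proof (rule max_bid_le)
    fix i
    have "\<bar>(\<beta> - \<beta>') $ i * v i \<theta>\<bar> \<le> norm (\<beta> - \<beta>') * V"
      unfolding abs_mult by (intro mult_mono component_le_norm_cart assms) auto
    then have "\<beta> $ i * v i \<theta> \<le> \<beta>' $ i * v i \<theta> + norm (\<beta> - \<beta>') * V"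
      by (simp add: algebra_simps)
    then show "\<beta> $ i * v i \<theta> \<le> max_bid v \<beta>' \<theta> + norm (\<beta> - \<beta>') * V"
      using max_bid_ge[of \<beta>' i v \<theta>] by linarith
  qed
  show ?thesis using *[of \<beta> \<beta>'] *[of \<beta>' \<beta>] by (simp add: norm_minus_commute abs_le_iff)
qed

lemma max_bid_zero: "max_bid v 0 \<theta> = 0"
  unfolding max_bid_def by simp

text \<open>
Items go to highest bidders only, and an item with a positive bid is sold completely. Budgets do not
enter, so such an allocation exists for every vector of multipliers.
\<close>

definition winning_allocation ::
  "'a measure \<Rightarrow> ('n \<Rightarrow> 'a \<Rightarrow> real) \<Rightarrow> real ^ 'n::finite \<Rightarrow> ('n \<Rightarrow> 'a \<Rightarrow> real) \<Rightarrow> bool" where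
  "winning_allocation M v \<beta> x \<longleftrightarrow>
     (\<forall>i. x i \<in> Linf_plus M) \<and>
     (\<forall>i. AE \<theta> in M. 0 < x i \<theta> \<longrightarrow> \<beta> $ i * v i \<theta> = max_bid v \<beta> \<theta>) \<and>
     (AE \<theta> in M. (\<Sum>i\<in>UNIV. x i \<theta>) \<le> 1) \<and>
     (AE \<theta> in M. 0 < max_bid v \<beta> \<theta> \<longrightarrow> (\<Sum>i\<in>UNIV. x i \<theta>) = 1)"

lemma is_FPPE_winning_allocation:
  assumes "is_FPPE M b v s \<beta> p x"
  shows "winning_allocation M v \<beta> x"
proof -
  have "AE \<theta> in M. 0 < p \<theta> \<longrightarrow> (\<Sum>i\<in>UNIV. x i \<theta>) = 1" "AE \<theta> in M. p \<theta> = max_bid v \<beta> \<theta>"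
    using assms by (auto simp: is_FPPE_def)
  then have "AE \<theta> in M. 0 < max_bid v \<beta> \<theta> \<longrightarrow> (\<Sum>i\<in>UNIV. x i \<theta>) = 1"
    by eventually_elim auto
  then show ?thesis using assms by (auto simp: is_FPPE_def winning_allocation_def)
qed

lemma is_FPPE_range: "is_FPPE M b v s \<beta> p x \<Longrightarrow> \<beta> $ i \<in> {0..1}"
  unfolding is_FPPE_def by blast

lemma is_FPPE_budget: "is_FPPE M b v s \<beta> p x \<Longrightarrow> spend M s p x i \<le> b $ i"
  unfolding is_FPPE_def by blast

lemma is_FPPE_slack: "is_FPPE M b v s \<beta> p x \<Longrightarrow> spend M s p x i < b $ i \<Longrightarrow> \<beta> $ i = 1"
  unfolding is_FPPE_def by blast

locale market_env =
  fixes M :: "'a measure" and b :: "real ^ 'n::finite"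
    and v :: "'n \<Rightarrow> 'a \<Rightarrow> real" and s :: "'a \<Rightarrow> real"
  assumes market: "market M b v s"
begin

abbreviation "E \<equiv> supply_exp M s"
abbreviation "F \<equiv> mean_max_bid M v s"

lemma b_pos: "0 < b $ i" using market by (auto simp: market_def)

lemma v_bounded: "ess_bounded M (v i)"
  using market by (auto simp: market_def intro: ess_bounded_Linf_plus)

lemma v_measurable [measurable]: "v i \<in> borel_measurable M"
  using v_bounded by (rule ess_bounded_measurable)

lemma v_nonneg: "AE \<theta> in M. \<forall>i. 0 \<le> v i \<theta>"
  using market by (auto simp: market_def L1_plus_def AE_all_countable)

lemma v_integrable: "integrable M (v i)"
  using market by (auto simp: market_def L1_plus_def)

lemma v_bound: obtains V where "0 \<le> V" "AE \<theta> in M. \<forall>i. \<bar>v i \<theta>\<bar> \<le> V"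
proof -
  have "\<exists>K. AE \<theta> in M. \<bar>v i \<theta>\<bar> \<le> K" for i using v_bounded[of i] by (auto simp: ess_bounded_def)
  then obtain K where K: "\<And>i. AE \<theta> in M. \<bar>v i \<theta>\<bar> \<le> K i" by metis
  have "AE \<theta> in M. \<forall>i. \<bar>v i \<theta>\<bar> \<le> K i" using K by (simp add: AE_all_countable)
  then have "AE \<theta> in M. \<forall>i. \<bar>v i \<theta>\<bar> \<le> (\<Sum>i\<in>UNIV. \<bar>K i\<bar>)"
  proof eventually_elim
    case (elim \<theta>)
    show ?case
    proof
      fix i
      have "\<bar>v i \<theta>\<bar> \<le> \<bar>K i\<bar>" using elim[rule_format, of i] by linarith
      also have "\<dots> \<le> (\<Sum>i\<in>UNIV. \<bar>K i\<bar>)" by (rule member_le_sum) auto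
      finally show "\<bar>v i \<theta>\<bar> \<le> (\<Sum>i\<in>UNIV. \<bar>K i\<bar>)" .
    qed
  qed
  then show ?thesis by (rule that[rotated]) (simp add: sum_nonneg)
qed

lemma s_nonneg: "AE \<theta> in M. 0 \<le> s \<theta>"
  using market by (auto simp: market_def Linf_plus_def)

lemma s_measurable [measurable]: "s \<in> borel_measurable M"
  using market by (auto simp: market_def Linf_plus_def)

lemma s_integrable: "integrable M s"
  using market not_integrable_integral_eq[of M s] by (auto simp: market_def)

lemma E_integrable: assumes "ess_bounded M f" shows "integrable M (\<lambda>\<theta>. f \<theta> * s \<theta>)"
proof -
  obtain K where K: "AE \<theta> in M. \<bar>f \<theta>\<bar> \<le> K" "0 \<le> K" using assms by (rule ess_boundedE)
  show ?thesis
  proof (rule Bochner_Integration.integrable_bound)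
    show "integrable M (\<lambda>\<theta>. K * s \<theta>)" using s_integrable by simp
    show "(\<lambda>\<theta>. f \<theta> * s \<theta>) \<in> borel_measurable M" using ess_bounded_measurable[OF assms] by measurable
    show "AE \<theta> in M. norm (f \<theta> * s \<theta>) \<le> norm (K * s \<theta>)"
      using K(1) by eventually_elim (use K(2) in \<open>auto simp: abs_mult intro!: mult_right_mono\<close>)
  qed
qed

lemma E_const: "E (\<lambda>_. c) = c"
  using market by (simp add: supply_exp_def market_def)

lemma E_add: "ess_bounded M f \<Longrightarrow> ess_bounded M g \<Longrightarrow> E (\<lambda>\<theta>. f \<theta> + g \<theta>) = E f + E g"
  unfolding supply_exp_def by (simp add: distrib_right Bochner_Integration.integral_add E_integrable)

lemma E_diff: "ess_bounded M f \<Longrightarrow> ess_bounded M g \<Longrightarrow> E (\<lambda>\<theta>. f \<theta> - g \<theta>) = E f - E g"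
  unfolding supply_exp_def by (simp add: left_diff_distrib Bochner_Integration.integral_diff E_integrable)

lemma E_cmult: "E (\<lambda>\<theta>. c * f \<theta>) = c * E f"
  unfolding supply_exp_def by (simp add: mult.assoc)

lemma E_sum:
  assumes "finite I" "\<And>i. i \<in> I \<Longrightarrow> ess_bounded M (f i)"
  shows "E (\<lambda>\<theta>. \<Sum>i\<in>I. f i \<theta>) = (\<Sum>i\<in>I. E (f i))"
  unfolding supply_exp_def sum_distrib_right
  by (rule Bochner_Integration.integral_sum) (use assms in \<open>auto intro: E_integrable\<close>)

lemma E_cong:
  assumes "AE \<theta> in M. f \<theta> = g \<theta>" "f \<in> borel_measurable M" "g \<in> borel_measurable M"
  shows "E f = E g"
  unfolding supply_exp_def using assms by (intro integral_cong_AE) auto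

lemma E_mono:
  assumes "AE \<theta> in M. f \<theta> \<le> g \<theta>" "ess_bounded M f" "ess_bounded M g"
  shows "E f \<le> E g"
  unfolding supply_exp_def
proof (rule integral_mono_AE)
  show "AE \<theta> in M. f \<theta> * s \<theta> \<le> g \<theta> * s \<theta>"
    using assms(1) s_nonneg by eventually_elim (rule mult_right_mono)
qed (use assms in \<open>auto intro: E_integrable\<close>)

lemma E_abs_le:
  assumes "AE \<theta> in M. \<bar>f \<theta>\<bar> \<le> c" "f \<in> borel_measurable M"
  shows "\<bar>E f\<bar> \<le> c"
proof -
  have f: "ess_bounded M f" using assms by (rule ess_boundedI[rotated])
  have "E f \<le> E (\<lambda>_. c)" by (rule E_mono) (use assms f in auto)
  moreover have "E (\<lambda>_. -c) \<le> E f"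
  proof (rule E_mono)
    show "AE \<theta> in M. - c \<le> f \<theta>" using assms(1) by eventually_elim auto
  qed (use f in auto)
  ultimately show ?thesis by (simp add: E_const abs_le_iff)
qed

lemma max_bid_measurable [measurable]: "max_bid v \<beta> \<in> borel_measurable M"
proof -
  have "(\<lambda>\<theta>. Max ((\<lambda>i. \<beta> $ i * v i \<theta>) ` UNIV)) \<in> borel_measurable M"
    by (rule borel_measurable_Max) auto
  then show ?thesis by (simp add: max_bid_def[abs_def])
qed

lemma max_bid_Lipschitz_AE:
  obtains V where "0 \<le> V" "\<And>\<beta> \<beta>'. AE \<theta> in M. \<bar>max_bid v \<beta> \<theta> - max_bid v \<beta>' \<theta>\<bar> \<le> norm (\<beta> - \<beta>') * V"
proof -
  obtain V where V: "0 \<le> V" "AE \<theta> in M. \<forall>i. \<bar>v i \<theta>\<bar> \<le> V" by (rule v_bound)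
  have "AE \<theta> in M. \<bar>max_bid v \<beta> \<theta> - max_bid v \<beta>' \<theta>\<bar> \<le> norm (\<beta> - \<beta>') * V" for \<beta> \<beta>'
    using V(2) by eventually_elim (auto intro: max_bid_Lipschitz)
  then show ?thesis using V(1) that by blast
qed

lemma max_bid_bounded: "ess_bounded M (max_bid v \<beta>)"
proof -
  obtain V where "\<And>\<beta> \<beta>'. AE \<theta> in M. \<bar>max_bid v \<beta> \<theta> - max_bid v \<beta>' \<theta>\<bar> \<le> norm (\<beta> - \<beta>') * V"
    using max_bid_Lipschitz_AE by blast
  from this[of \<beta> 0] have "AE \<theta> in M. \<bar>max_bid v \<beta> \<theta>\<bar> \<le> norm \<beta> * V" by (simp add: max_bid_zero)
  then show ?thesis by (rule ess_boundedI[rotated]) simp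
qed

lemma max_bid_nonneg:
  assumes "\<And>i. 0 \<le> \<beta> $ i"
  shows "AE \<theta> in M. 0 \<le> max_bid v \<beta> \<theta>"
  using v_nonneg
proof eventually_elim
  case (elim \<theta>)
  have "0 \<le> \<beta> $ undefined * v undefined \<theta>" using elim assms by (intro mult_nonneg_nonneg) auto
  then show ?case using max_bid_ge[of \<beta> undefined v \<theta>] by linarith
qed

lemma winning_allocation_nonneg:
  assumes "winning_allocation M v \<beta> x"
  shows "AE \<theta> in M. \<forall>i. 0 \<le> x i \<theta>"
  using assms by (auto simp: winning_allocation_def Linf_plus_def AE_all_countable)

lemma winning_allocation_bounded:
  assumes "winning_allocation M v \<beta> x"
  shows "ess_bounded M (x i)"
  using assms by (auto simp: winning_allocation_def intro: ess_bounded_Linf_plus)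

lemma winning_allocation_bid:
  assumes "winning_allocation M v \<beta> x"
  shows "AE \<theta> in M. \<forall>i. x i \<theta> * max_bid v \<beta> \<theta> = x i \<theta> * (\<beta> $ i * v i \<theta>)"
proof -
  have "AE \<theta> in M. \<forall>i. 0 < x i \<theta> \<longrightarrow> \<beta> $ i * v i \<theta> = max_bid v \<beta> \<theta>"
    using assms by (auto simp: winning_allocation_def AE_all_countable)
  then show ?thesis using winning_allocation_nonneg[OF assms]
  proof eventually_elim
    case (elim \<theta>)
    then show ?case by (metis less_eq_real_def mult_zero_left)
  qed
qed

lemma mean_utility_nth: "mean_utility M v s x $ i = E (\<lambda>\<theta>. x i \<theta> * v i \<theta>)"
  by (simp add: mean_utility_def supply_exp_def mult_ac)

lemma inner_mean_utility:
  assumes "winning_allocation M v \<beta> x"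
  shows "mean_utility M v s x \<bullet> \<beta>' = E (\<lambda>\<theta>. \<Sum>i\<in>UNIV. x i \<theta> * (\<beta>' $ i * v i \<theta>))"
proof -
  have "E (\<lambda>\<theta>. \<Sum>i\<in>UNIV. x i \<theta> * (\<beta>' $ i * v i \<theta>)) = (\<Sum>i\<in>UNIV. E (\<lambda>\<theta>. x i \<theta> * (\<beta>' $ i * v i \<theta>)))"
    by (intro E_sum finite ess_bounded_mult ess_bounded_const winning_allocation_bounded[OF assms] v_bounded)
  also have "\<dots> = (\<Sum>i\<in>UNIV. \<beta>' $ i * E (\<lambda>\<theta>. x i \<theta> * v i \<theta>))"
    by (intro sum.cong refl) (simp only: E_cmult[symmetric] mult.left_commute)
  also have "\<dots> = mean_utility M v s x \<bullet> \<beta>'"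
    unfolding inner_vec_def inner_real_def mean_utility_nth by (rule sum.cong[OF refl]) (rule mult.commute)
  finally show ?thesis by (rule sym)
qed

lemma winning_allocation_value:
  assumes x: "winning_allocation M v \<beta> x" and \<beta>: "\<And>i. 0 \<le> \<beta> $ i"
  shows "F \<beta> = mean_utility M v s x \<bullet> \<beta>"
  unfolding inner_mean_utility[OF x] mean_max_bid_def
proof (rule E_cong)
  have "AE \<theta> in M. 0 < max_bid v \<beta> \<theta> \<longrightarrow> (\<Sum>i\<in>UNIV. x i \<theta>) = 1"
    using x by (auto simp: winning_allocation_def)
  then show "AE \<theta> in M. max_bid v \<beta> \<theta> = (\<Sum>i\<in>UNIV. x i \<theta> * (\<beta> $ i * v i \<theta>))"
    using winning_allocation_bid[OF x] max_bid_nonneg[OF \<beta>]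
  proof eventually_elim
    case (elim \<theta>)
    have "(\<Sum>i\<in>UNIV. x i \<theta> * (\<beta> $ i * v i \<theta>)) = (\<Sum>i\<in>UNIV. x i \<theta>) * max_bid v \<beta> \<theta>"
      unfolding sum_distrib_right by (rule sum.cong) (use elim(2) in auto)
    then show ?case using elim(1,3) by (cases "max_bid v \<beta> \<theta> = 0") simp_all
  qed
next
  have [measurable]: "x i \<in> borel_measurable M" for i
    using winning_allocation_bounded[OF x] by (rule ess_bounded_measurable)
  show "(\<lambda>\<theta>. \<Sum>i\<in>UNIV. x i \<theta> * (\<beta> $ i * v i \<theta>)) \<in> borel_measurable M" by measurable
qed (rule max_bid_measurable)

text \<open>
Envelope argument: at other multipliers the winners of \<open>\<beta>\<close> still bid at most the maximum, so the
mean utilities of any winning allocation form a subgradient of the mean maximal bid, with equality at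
\<open>\<beta>\<close> itself by the previous lemma.
\<close>

lemma winning_allocation_subgradient:
  assumes x: "winning_allocation M v \<beta> x" and \<beta>': "\<And>i. 0 \<le> \<beta>' $ i"
  shows "mean_utility M v s x \<bullet> \<beta>' \<le> F \<beta>'"
  unfolding inner_mean_utility[OF x] mean_max_bid_def
proof (rule E_mono)
  have "AE \<theta> in M. (\<Sum>i\<in>UNIV. x i \<theta>) \<le> 1" using x by (auto simp: winning_allocation_def)
  then show "AE \<theta> in M. (\<Sum>i\<in>UNIV. x i \<theta> * (\<beta>' $ i * v i \<theta>)) \<le> max_bid v \<beta>' \<theta>"
    using winning_allocation_nonneg[OF x] max_bid_nonneg[OF \<beta>']
  proof eventually_elim
    case (elim \<theta>)
    have "(\<Sum>i\<in>UNIV. x i \<theta> * (\<beta>' $ i * v i \<theta>)) \<le> (\<Sum>i\<in>UNIV. x i \<theta>) * max_bid v \<beta>' \<theta>"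
      unfolding sum_distrib_right
      by (intro sum_mono mult_left_mono max_bid_ge) (use elim in auto)
    also have "\<dots> \<le> 1 * max_bid v \<beta>' \<theta>" by (rule mult_right_mono) (use elim in auto)
    finally show ?case by simp
  qed
qed (intro ess_bounded_sum finite ess_bounded_mult ess_bounded_const winning_allocation_bounded[OF x]
       v_bounded max_bid_bounded)+

text \<open>
Each item is split equally among its highest bidders, which is symmetric in the buyers and measurable.
\<close>

lemma winning_allocation_exists: "\<exists>x. winning_allocation M v \<beta> x"
proof -
  define A where "A i = {\<theta> \<in> space M. \<beta> $ i * v i \<theta> = max_bid v \<beta> \<theta>}" for i
  have [measurable]: "A i \<in> sets M" for i unfolding A_def by measurable
  define n where "n \<theta> = (\<Sum>i\<in>UNIV. indicator (A i) \<theta> :: real)" for \<theta>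
  define x where "x i \<theta> = indicator (A i) \<theta> / n \<theta>" for i \<theta>
  have [measurable]: "n \<in> borel_measurable M" unfolding n_def by measurable
  have x_meas: "x i \<in> borel_measurable M" for i unfolding x_def by measurable
  have n1: "1 \<le> n \<theta>" if "\<theta> \<in> space M" for \<theta>
  proof -
    obtain i where "max_bid v \<beta> \<theta> = \<beta> $ i * v i \<theta>" using max_bid_attained[of v \<beta> \<theta>] by blast
    then have "\<theta> \<in> A i" using that by (simp add: A_def)
    then have "1 = (indicator (A i) \<theta> :: real)" by simp
    also have "\<dots> \<le> n \<theta>" unfolding n_def by (rule member_le_sum) auto
    finally show ?thesis .
  qed
  have n0: "0 \<le> n \<theta>" for \<theta> unfolding n_def by (intro sum_nonneg) auto
  have x0: "0 \<le> x i \<theta>" for i \<theta> unfolding x_def using n0 by (intro divide_nonneg_nonneg) auto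
  have sum1: "(\<Sum>i\<in>UNIV. x i \<theta>) = 1" if "\<theta> \<in> space M" for \<theta>
  proof -
    have "(\<Sum>i\<in>UNIV. x i \<theta>) = n \<theta> / n \<theta>" unfolding x_def by (simp only: n_def sum_divide_distrib)
    then show ?thesis using n1[OF that] by simp
  qed
  have le1: "x i \<theta> \<le> 1" if "\<theta> \<in> space M" for i \<theta>
  proof -
    have "x i \<theta> \<le> (\<Sum>i\<in>UNIV. x i \<theta>)" by (rule member_le_sum) (use x0 in auto)
    then show ?thesis using sum1[OF that] by simp
  qed
  have "winning_allocation M v \<beta> x"
    unfolding winning_allocation_def
  proof (intro conjI allI)
    fix i
    show "x i \<in> Linf_plus M"
      unfolding Linf_plus_def using x_meas x0 le1 by (auto intro!: exI[of _ 1])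
    show "AE \<theta> in M. 0 < x i \<theta> \<longrightarrow> \<beta> $ i * v i \<theta> = max_bid v \<beta> \<theta>"
      by (auto simp: x_def A_def indicator_def)
  qed (use sum1 in auto)
  then show ?thesis by blast
qed

text \<open>
A differentiable function has only one subgradient. So wherever the mean maximal bid is differentiable,
every way of breaking ties gives the same mean utilities.
\<close>

lemma winning_allocation_gradient:
  assumes x: "winning_allocation M v \<beta> x" and \<beta>: "\<And>i. 0 < \<beta> $ i"
    and D: "(F has_derivative D) (at \<beta>)"
  shows "D = (\<lambda>u. mean_utility M v s x \<bullet> u)"
proof -
  let ?m = "mean_utility M v s x"
  define S where "S = {y :: real^'n. \<forall>i. 0 < y $ i}"
  have "open S" unfolding S_def Collect_all_eq
    by (intro open_INT ballI open_Collect_less continuous_intros) auto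
  have "((\<lambda>y. F y - ?m \<bullet> y) has_derivative (\<lambda>u. D u - ?m \<bullet> u)) (at \<beta>)"
    using D by (auto intro!: derivative_eq_intros)
  moreover have "\<beta> \<in> S" using \<beta> by (simp add: S_def)
  moreover have "(\<forall>y\<in>S. F y - ?m \<bullet> y \<le> F \<beta> - ?m \<bullet> \<beta>) \<or> (\<forall>y\<in>S. F \<beta> - ?m \<bullet> \<beta> \<le> F y - ?m \<bullet> y)"
      using winning_allocation_value[OF x] winning_allocation_subgradient[OF x] \<beta>
      by (auto simp: S_def less_imp_le)
  ultimately have "(\<lambda>u. D u - ?m \<bullet> u) = (\<lambda>u. 0)"
    using \<open>open S\<close> by (intro differential_zero_maxmin) auto
  then show ?thesis by (auto simp: fun_eq_iff)
qed

lemma spend_eq: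
  assumes "is_FPPE M b v s \<beta> p x"
  shows "spend M s p x i = \<beta> $ i * mean_utility M v s x $ i"
proof -
  have x: "winning_allocation M v \<beta> x" using assms by (rule is_FPPE_winning_allocation)
  have [measurable]: "p \<in> borel_measurable M" "x i \<in> borel_measurable M"
    using assms by (auto simp: is_FPPE_def L1_plus_def Linf_plus_def)
  have p: "AE \<theta> in M. p \<theta> = max_bid v \<beta> \<theta>" using assms by (auto simp: is_FPPE_def)
  have "spend M s p x i = E (\<lambda>\<theta>. x i \<theta> * p \<theta>)" by (simp add: spend_def supply_exp_def)
  also have "\<dots> = E (\<lambda>\<theta>. \<beta> $ i * (x i \<theta> * v i \<theta>))"
  proof (rule E_cong)
    show "AE \<theta> in M. x i \<theta> * p \<theta> = \<beta> $ i * (x i \<theta> * v i \<theta>)"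
      using winning_allocation_bid[OF x] p by eventually_elim (simp add: mult_ac)
  qed auto
  finally show ?thesis by (simp add: E_cmult mean_utility_nth)
qed

text \<open>
A buyer with multiplier 0 spends nothing, hence less than its budget, which forces multiplier 1.
\<close>

lemma is_FPPE_pos:
  assumes "is_FPPE M b v s \<beta> p x"
  shows "0 < \<beta> $ i"
proof (rule ccontr)
  assume "\<not> 0 < \<beta> $ i"
  then have "\<beta> $ i = 0" using is_FPPE_range[OF assms, of i] by simp
  then have "spend M s p x i < b $ i" using spend_eq[OF assms, of i] b_pos by simp
  then show False using is_FPPE_slack[OF assms] \<open>\<beta> $ i = 0\<close> by fastforce
qed

lemma is_FPPE_le_one: "is_FPPE M b v s \<beta> p x \<Longrightarrow> \<beta> $ i \<le> 1"
  using is_FPPE_range[of M b v s \<beta> p x i] by simp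

end

section \<open>Equilibrium multipliers as strong minimizers of the dual\<close>

text \<open>
On the unit interval the second derivative of the logarithm is at most -1, which is where
the quadratic term comes from.
\<close>

lemma ln_strongly_concave:
  fixes y z :: real
  assumes "0 < y" "y \<le> 1" "0 < z" "z \<le> 1"
  shows "ln z - ln y \<le> (z - y) / y - (z - y)\<^sup>2 / 2"
proof -
  define f where "f t = (t - y) / y - (t - y)\<^sup>2 / 2 - ln t" for t :: real
  have d: "(f has_real_derivative (t - y) * (1 / (y * t) - 1)) (at t)" if "0 < t" for t
    unfolding f_def using that assms
    by (auto intro!: derivative_eq_intros simp: field_simps)
  have pos: "0 \<le> 1 / (y * t) - 1" if "0 < t" "t \<le> 1" for t
    using that assms by (simp add: mult_le_one)
  have "f y \<le> f z"
  proof (cases "y \<le> z")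
    case True
    show ?thesis
    proof (rule DERIV_nonneg_imp_nondecreasing[OF True])
      fix t assume "y \<le> t" "t \<le> z"
      then show "\<exists>D. (f has_real_derivative D) (at t) \<and> 0 \<le> D"
        using d[of t] pos[of t] assms by (intro exI[of _ "(t - y) * (1 / (y * t) - 1)"]) auto
    qed
  next
    case False
    then have "z \<le> y" by simp
    then show ?thesis
    proof (rule DERIV_nonpos_imp_nonincreasing)
      fix t assume "z \<le> t" "t \<le> y"
      then show "\<exists>D. (f has_real_derivative D) (at t) \<and> D \<le> 0"
        using d[of t] pos[of t] assms
        by (intro exI[of _ "(t - y) * (1 / (y * t) - 1)"]) (auto intro: mult_nonpos_nonneg)
    qed
  qed
  then show ?thesis by (simp add: f_def)
qed

context market_env
begin

text \<open>
The subgradient inequality makes the first-order part of the dual objective separate over buyers. For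
each buyer the first-order term has the right sign, by complementary slackness between budget and
multiplier, and the logarithm contributes the quadratic term. This one inequality gives uniqueness, and
later the Lipschitz dependence of the multipliers on the supply.
\<close>

lemma FPPE_dual_gap:
  assumes eq: "is_FPPE M b v s \<beta> p x" and \<beta>': "\<And>i. 0 < \<beta>' $ i" "\<And>i. \<beta>' $ i \<le> 1"
  shows "dual_objective M b v s \<beta>' - dual_objective M b v s \<beta> \<ge> (\<Sum>i\<in>UNIV. b $ i / 2 * (\<beta>' $ i - \<beta> $ i)\<^sup>2)"
proof -
  let ?m = "mean_utility M v s x"
  have x: "winning_allocation M v \<beta> x" using eq by (rule is_FPPE_winning_allocation)
  note pos = is_FPPE_pos[OF eq] and le = is_FPPE_le_one[OF eq]
  have "F \<beta> = ?m \<bullet> \<beta>" using winning_allocation_value[OF x] pos by (simp add: less_imp_le)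
  moreover have "?m \<bullet> \<beta>' \<le> F \<beta>'" using winning_allocation_subgradient[OF x] \<beta>' by (simp add: less_imp_le)
  ultimately have "F \<beta>' - F \<beta> \<ge> (\<Sum>i\<in>UNIV. ?m $ i * (\<beta>' $ i - \<beta> $ i))"
    by (simp add: inner_vec_def right_diff_distrib sum_subtractf)
  moreover have "?m $ i * (\<beta>' $ i - \<beta> $ i) - b $ i * (ln (\<beta>' $ i) - ln (\<beta> $ i))
      \<ge> b $ i / 2 * (\<beta>' $ i - \<beta> $ i)\<^sup>2" for i
  proof -
    have "b $ i * (ln (\<beta>' $ i) - ln (\<beta> $ i))
        \<le> b $ i * ((\<beta>' $ i - \<beta> $ i) / \<beta> $ i - (\<beta>' $ i - \<beta> $ i)\<^sup>2 / 2)"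
      using b_pos[of i] by (intro mult_left_mono ln_strongly_concave pos le \<beta>') auto
    moreover have "0 \<le> (?m $ i - b $ i / \<beta> $ i) * (\<beta>' $ i - \<beta> $ i)"
    proof (cases "\<beta> $ i * ?m $ i < b $ i")
      case True
      then have "\<beta> $ i = 1" using is_FPPE_slack[OF eq, of i] spend_eq[OF eq, of i] by simp
      then show ?thesis using True \<beta>'(2)[of i] by (intro mult_nonpos_nonpos) auto
    next
      case False
      then have "\<beta> $ i * ?m $ i = b $ i"
        using spend_eq[OF eq, of i] is_FPPE_budget[OF eq, of i] by simp
      then show ?thesis using pos[of i] by (simp add: field_simps)
    qed
    ultimately show ?thesis by (simp add: algebra_simps)
  qed
  then have "(\<Sum>i\<in>UNIV. b $ i / 2 * (\<beta>' $ i - \<beta> $ i)\<^sup>2)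
      \<le> (\<Sum>i\<in>UNIV. ?m $ i * (\<beta>' $ i - \<beta> $ i) - b $ i * (ln (\<beta>' $ i) - ln (\<beta> $ i)))"
    by (intro sum_mono) auto
  ultimately show ?thesis
    unfolding dual_objective_def
    by (simp add: sum_subtractf right_diff_distrib)
qed

lemma FPPE_unique:
  assumes eq: "is_FPPE M b v s \<beta> p x" "is_FPPE M b v s \<beta>' p' x'"
  shows "\<beta>' = \<beta>"
proof -
  have g1: "dual_objective M b v s \<beta>' - dual_objective M b v s \<beta> \<ge> (\<Sum>i\<in>UNIV. b $ i / 2 * (\<beta>' $ i - \<beta> $ i)\<^sup>2)"
    by (intro FPPE_dual_gap[OF eq(1)] is_FPPE_pos[OF eq(2)] is_FPPE_le_one[OF eq(2)])
  have g2: "dual_objective M b v s \<beta> - dual_objective M b v s \<beta>' \<ge> (\<Sum>i\<in>UNIV. b $ i / 2 * (\<beta> $ i - \<beta>' $ i)\<^sup>2)"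
    by (intro FPPE_dual_gap[OF eq(2)] is_FPPE_pos[OF eq(1)] is_FPPE_le_one[OF eq(1)])
  have nn: "0 \<le> b $ i / 2 * (\<beta>' $ i - \<beta> $ i)\<^sup>2" for i using b_pos[of i] by simp
  have "(\<Sum>i\<in>UNIV. b $ i / 2 * (\<beta>' $ i - \<beta> $ i)\<^sup>2) + (\<Sum>i\<in>UNIV. b $ i / 2 * (\<beta> $ i - \<beta>' $ i)\<^sup>2) \<le> 0"
    using g1 g2 by linarith
  then have "(\<Sum>i\<in>UNIV. b $ i / 2 * (\<beta>' $ i - \<beta> $ i)\<^sup>2) \<le> 0"
    by (simp add: power2_commute)
  then have "(\<Sum>i\<in>UNIV. b $ i / 2 * (\<beta>' $ i - \<beta> $ i)\<^sup>2) = 0"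
    by (intro antisym sum_nonneg nn)
  then have "\<forall>i\<in>UNIV. b $ i / 2 * (\<beta>' $ i - \<beta> $ i)\<^sup>2 = 0"
    using sum_nonneg_eq_0_iff[of UNIV "\<lambda>i. b $ i / 2 * (\<beta>' $ i - \<beta> $ i)\<^sup>2"] nn by simp
  then have "b $ i / 2 * (\<beta>' $ i - \<beta> $ i)\<^sup>2 = 0" for i by blast
  moreover have "b $ i \<noteq> 0" for i using b_pos[of i] by simp
  ultimately show ?thesis by (simp add: vec_eq_iff)
qed

text \<open>
Prices are maximal bids, and the multipliers are unique, so the revenue is the mean maximal bid.
\<close>

lemma FPPE_revenue_eq:
  assumes eq: "is_FPPE M b v s \<beta> p x"
  shows "FPPE_revenue M b v s = F \<beta>" "revenue M s p = F \<beta>"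
proof -
  have rev: "revenue M s p' = F \<beta>'" if "is_FPPE M b v s \<beta>' p' x'" for \<beta>' p' x'
  proof -
    have "revenue M s p' = E p'" by (simp add: revenue_def supply_exp_def)
    also have "\<dots> = E (max_bid v \<beta>')"
      using that by (intro E_cong) (auto simp: is_FPPE_def L1_plus_def)
    finally show ?thesis by (simp add: mean_max_bid_def)
  qed
  show "revenue M s p = F \<beta>" using rev[OF eq] .
  show "FPPE_revenue M b v s = F \<beta>"
    unfolding FPPE_revenue_def
  proof (rule the_equality)
    show "\<exists>\<beta>' p x. is_FPPE M b v s \<beta>' p x \<and> F \<beta> = revenue M s p"
      using eq rev[OF eq] by metis
  qed (use rev FPPE_unique[OF eq] in metis)
qed

lemma is_FPPE_I:
  assumes x: "winning_allocation M v \<beta> x"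
    and \<beta>: "\<And>i. 0 < \<beta> $ i" "\<And>i. \<beta> $ i \<le> 1"
    and budget: "\<And>i. \<beta> $ i * mean_utility M v s x $ i \<le> b $ i"
    and exhaust: "\<And>i. \<beta> $ i < 1 \<Longrightarrow> \<beta> $ i * mean_utility M v s x $ i = b $ i"
  shows "is_FPPE M b v s \<beta> (max_bid v \<beta>) x"
proof -
  have sp: "spend M s (max_bid v \<beta>) x i = \<beta> $ i * mean_utility M v s x $ i" for i
  proof -
    have [measurable]: "x i \<in> borel_measurable M"
      using winning_allocation_bounded[OF x] by (rule ess_bounded_measurable)
    have "spend M s (max_bid v \<beta>) x i = E (\<lambda>\<theta>. x i \<theta> * max_bid v \<beta> \<theta>)" by (simp add: spend_def supply_exp_def)
    also have "\<dots> = E (\<lambda>\<theta>. \<beta> $ i * (x i \<theta> * v i \<theta>))"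
    proof (rule E_cong)
      show "AE \<theta> in M. x i \<theta> * max_bid v \<beta> \<theta> = \<beta> $ i * (x i \<theta> * v i \<theta>)"
        using winning_allocation_bid[OF x] by eventually_elim (simp add: mult_ac)
    qed auto
    finally show ?thesis by (simp add: E_cmult mean_utility_nth)
  qed
  have "integrable M (max_bid v \<beta>)"
  proof (rule Bochner_Integration.integrable_bound)
    show "integrable M (\<lambda>\<theta>. \<Sum>i\<in>UNIV. \<bar>\<beta> $ i * v i \<theta>\<bar>)"
      using v_integrable by (intro Bochner_Integration.integrable_sum integrable_abs integrable_mult_right) auto
    show "AE \<theta> in M. norm (max_bid v \<beta> \<theta>) \<le> norm (\<Sum>i\<in>UNIV. \<bar>\<beta> $ i * v i \<theta>\<bar>)"
    proof (rule AE_I2)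
      fix \<theta>
      obtain i where "max_bid v \<beta> \<theta> = \<beta> $ i * v i \<theta>" using max_bid_attained by metis
      then have "\<bar>max_bid v \<beta> \<theta>\<bar> \<le> (\<Sum>i\<in>UNIV. \<bar>\<beta> $ i * v i \<theta>\<bar>)"
        using member_le_sum[of i UNIV "\<lambda>i. \<bar>\<beta> $ i * v i \<theta>\<bar>"] by simp
      then show "norm (max_bid v \<beta> \<theta>) \<le> norm (\<Sum>i\<in>UNIV. \<bar>\<beta> $ i * v i \<theta>\<bar>)"
        by (simp add: sum_nonneg)
    qed
  qed auto
  then have "max_bid v \<beta> \<in> L1_plus M"
    using max_bid_nonneg[of \<beta>] \<beta> by (simp add: L1_plus_def less_imp_le)
  then show ?thesis
    unfolding is_FPPE_def sp
  proof (intro conjI allI impI)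
    fix i
    show "\<beta> $ i \<in> {0..1}" using \<beta>[of i] by simp
    show "\<beta> $ i = 1" if "\<beta> $ i * mean_utility M v s x $ i < b $ i"
      using that \<beta>(2)[of i] exhaust[of i] by linarith
  qed (use x budget in \<open>auto simp: winning_allocation_def\<close>)
qed

end

section \<open>The pseudo-inverse of a compressed matrix\<close>

lemma moore_penrose_unique:
  assumes "is_moore_penrose A X" "is_moore_penrose A Y"
  shows "X = Y"
proof -
  note X = assms(1)[unfolded is_moore_penrose_def] and Y = assms(2)[unfolded is_moore_penrose_def]
  have "A ** X = transpose (A ** Y ** A ** X)" using X Y by simp
  also have "\<dots> = transpose (A ** X) ** transpose (A ** Y)"
    by (simp only: matrix_transpose_mul[symmetric] matrix_mul_assoc)
  also have "\<dots> = A ** X ** (A ** Y)" using X Y by simp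
  also have "\<dots> = A ** Y" using X by (simp add: matrix_mul_assoc)
  finally have AX: "A ** X = A ** Y" .
  have "X ** A = transpose (X ** (A ** Y ** A))" using X Y by simp
  also have "\<dots> = transpose (Y ** A) ** transpose (X ** A)"
    by (simp only: matrix_transpose_mul[symmetric] matrix_mul_assoc)
  also have "\<dots> = Y ** A ** (X ** A)" using X Y by simp
  also have "\<dots> = Y ** (A ** X ** A)" by (simp only: matrix_mul_assoc)
  also have "\<dots> = Y ** A" using X by simp
  finally have XA: "X ** A = Y ** A" .
  have "X = X ** A ** X" using X by simp
  also have "\<dots> = Y ** (A ** X)" unfolding XA by (simp only: matrix_mul_assoc)
  also have "\<dots> = Y ** A ** Y" unfolding AX by (simp only: matrix_mul_assoc)
  also have "\<dots> = Y" using Y by simp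
  finally show ?thesis .
qed

lemma pinv_eqI: "is_moore_penrose A X \<Longrightarrow> pinv A = X"
  unfolding pinv_def using moore_penrose_unique by blast

text \<open>
With respect to the range of the orthogonal projection \<open>P\<close> and its complement, \<open>A\<close> is block diagonal with one
invertible block and one zero block. Adding the identity on the complement gives an invertible matrix,
and compressing its inverse gives the pseudo-inverse. Both products of \<open>A\<close> with
its pseudo-inverse are then equal to \<open>P\<close>, which is symmetric.
\<close>

lemma pinv_compression:
  fixes H P :: "real ^ 'n::finite ^ 'n"
  assumes sym: "transpose P = P" and idem: "P ** P = P"
    and pos: "\<And>u. u \<noteq> 0 \<Longrightarrow> 0 < u \<bullet> (H *v u)"
  defines "A \<equiv> P ** H ** P"
  shows "pinv A ** A = P" "pinv A ** P = pinv A"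
proof -
  define B where "B = A + (mat 1 - P)"
  have PA: "P ** A = A" and AP: "A ** P = A"
    unfolding A_def by (simp add: matrix_mul_assoc idem) (simp add: matrix_mul_assoc[symmetric] idem)
  have PB: "P ** B = A" and BP: "B ** P = A"
    unfolding B_def matrix_eq
    by (simp_all add: matrix_vector_mul_assoc[symmetric] matrix_vector_right_distrib
        matrix_vector_mult_diff_distrib matrix_vector_mult_add_rdistrib matrix_vector_mult_diff_rdistrib)
      (simp_all add: matrix_vector_mul_assoc PA AP idem)
  \<comment> \<open>On the range of P, the form of B is that of H; on the complement, B is the identity.\<close>
  have inj: "u = 0" if "B *v u = 0" for u
  proof -
    have Pdot: "(P *v y) \<bullet> z = y \<bullet> (P *v z)" for y z
      using sym by (metis dot_lmul_matrix transpose_matrix_vector)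
    have PP: "P *v (P *v y) = P *v y" for y by (simp add: matrix_vector_mul_assoc idem)
    have "A *v u = P *v (B *v u)" by (simp add: matrix_vector_mul_assoc PB)
    then have Au: "A *v u = 0" using that by simp
    have "(P *v u) \<bullet> (H *v (P *v u)) = u \<bullet> (A *v u)"
      unfolding A_def Pdot by (simp add: matrix_vector_mul_assoc matrix_mul_assoc)
    then have "P *v u = 0" using Au pos[of "P *v u"] by force
    then show ?thesis using that Au
      by (simp add: B_def matrix_vector_mult_add_rdistrib matrix_vector_mult_diff_rdistrib)
  qed
  obtain Y where YB: "Y ** B = mat 1"
    using matrix_left_invertible_ker[of B] inj by blast
  then have BY: "B ** Y = mat 1" by (simp add: matrix_left_right_inverse)
  have YA: "Y ** A = P" unfolding BP[symmetric] by (simp add: matrix_mul_assoc YB)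
  have AY: "A ** Y = P" unfolding PB[symmetric] by (simp add: matrix_mul_assoc[symmetric] BY)
  define X where "X = P ** Y"
  have XA: "X ** A = P" unfolding X_def by (simp add: matrix_mul_assoc[symmetric] YA idem)
  have AX: "A ** X = P" unfolding X_def by (simp add: matrix_mul_assoc AP AY)
  have XP: "X ** P = X"
  proof -
    have "X ** P = P ** Y ** (A ** Y)" by (simp add: X_def AY)
    also have "\<dots> = P ** (Y ** A) ** Y" by (simp only: matrix_mul_assoc)
    also have "\<dots> = X" by (simp add: YA idem X_def)
    finally show ?thesis .
  qed
  have "is_moore_penrose A X"
    unfolding is_moore_penrose_def
    using XA AX PA sym by (simp add: X_def matrix_mul_assoc idem)
  then have "pinv A = X" by (rule pinv_eqI)
  then show "pinv A ** A = P" "pinv A ** P = pinv A" using XA XP by simp_all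
qed

lemma inactive_proj_nth: "(inactive_proj \<beta> *v y) $ i = (if \<beta> $ i < 1 then y $ i else 0)"
proof -
  have "(inactive_proj \<beta> *v y) $ i = (\<Sum>j\<in>UNIV. if i = j then (if \<beta> $ i < 1 then y $ j else 0) else 0)"
    unfolding inactive_proj_def matrix_vector_mult_def by (simp only: vec_lambda_beta) (rule sum.cong, auto)
  then show ?thesis by simp
qed

lemma transpose_inactive_proj: "transpose (inactive_proj \<beta>) = inactive_proj \<beta>"
  by (auto simp: transpose_def inactive_proj_def vec_eq_iff)

lemma inactive_proj_idem: "inactive_proj \<beta> ** inactive_proj \<beta> = inactive_proj \<beta>"
proof -
  have "(inactive_proj \<beta> ** inactive_proj \<beta>) *v y = inactive_proj \<beta> *v y" for y
    by (simp add: vec_eq_iff inactive_proj_nth flip: matrix_vector_mul_assoc)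
  then show ?thesis by (simp add: matrix_eq)
qed

section \<open>First-order calculus\<close>

lemma directional_minimum:
  fixes f :: "'b::real_normed_vector \<Rightarrow> real"
  assumes D: "(f has_derivative D) (at x)" and "0 < d"
    and le: "\<And>t. 0 < t \<Longrightarrow> t < d \<Longrightarrow> f x \<le> f (x + t *\<^sub>R u)"
  shows "0 \<le> D u"
proof (rule ccontr)
  assume "\<not> 0 \<le> D u"
  have "((\<lambda>t. f (x + t *\<^sub>R u)) has_derivative (\<lambda>t. D (t *\<^sub>R u))) (at 0)"
  proof (rule has_derivative_compose[where f="\<lambda>t. x + t *\<^sub>R u" and g=f])
    show "((\<lambda>t. x + t *\<^sub>R u) has_derivative (\<lambda>t. t *\<^sub>R u)) (at 0)"
      by (auto intro!: derivative_eq_intros)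
    show "(f has_derivative D) (at (x + 0 *\<^sub>R u))" using D by simp
  qed
  moreover have "D (t *\<^sub>R u) = D u * t" for t
    using has_derivative_linear[OF D] by (simp add: linear_cmul)
  ultimately have "((\<lambda>t. f (x + t *\<^sub>R u)) has_real_derivative D u) (at 0)"
    by (simp add: has_field_derivative_def)
  from DERIV_neg_dec_right[OF this] \<open>\<not> 0 \<le> D u\<close> obtain e where
    e: "0 < e" "\<And>t. 0 < t \<Longrightarrow> t < e \<Longrightarrow> f (x + t *\<^sub>R u) < f x" by auto
  define t where "t = min d e / 2"
  have "0 < t" "t < d" "t < e" using \<open>0 < d\<close> e by (auto simp: t_def)
  then show False using le e by fastforce
qed

text \<open>
Subgradients of a convex function converge to the gradient at a point of differentiability: the
subgradient inequality at a distance \<open>\<rho>\<close> from \<open>y c\<close>, in the direction in which \<open>m c\<close> and \<open>m0\<close> differ,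
compares their difference with the linearization error at scale \<open>\<rho>\<close>.
\<close>

lemma subgradients_tendsto:
  fixes f :: "'b::real_inner \<Rightarrow> real"
  assumes D: "(f has_derivative (\<lambda>u. m0 \<bullet> u)) (at y0)"
    and S: "open S" "y0 \<in> S"
    and y: "(y \<longlongrightarrow> y0) G"
    and sub: "\<forall>\<^sub>F c in G. \<forall>z\<in>S. f (y c) + m c \<bullet> (z - y c) \<le> f z"
  shows "(m \<longlongrightarrow> m0) G"
proof (rule tendstoI)
  fix e :: real assume "0 < e"
  then have "0 < e / 4" by simp
  then obtain d where d: "0 < d"
    "\<And>z. norm (z - y0) < d \<Longrightarrow> norm (f z - f y0 - m0 \<bullet> (z - y0)) \<le> e / 4 * norm (z - y0)"
    using D unfolding has_derivative_at_alt by meson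
  obtain r where r: "0 < r" "ball y0 r \<subseteq> S" using S by (meson open_contains_ball)
  define \<rho> where "\<rho> = min d r / 3"
  have \<rho>: "0 < \<rho>" "2 * \<rho> < d" "2 * \<rho> < r" using d r by (auto simp: \<rho>_def)
  have "\<forall>\<^sub>F c in G. dist (y c) y0 < \<rho>" using y \<rho>(1) by (rule tendstoD)
  with sub show "\<forall>\<^sub>F c in G. dist (m c) m0 < e"
  proof eventually_elim
    case (elim c)
    define w where "w = m c - m0"
    show ?case
    proof (cases "w = 0")
      case False
      \<comment> \<open>The worst direction, in which the two linear forms differ by norm w.\<close>
      define u where "u = (1 / norm w) *\<^sub>R w"
      have u: "norm u = 1" "w \<bullet> u = norm w"
        using False by (auto simp: u_def dot_square_norm power2_eq_square)
      define z where "z = y c + \<rho> *\<^sub>R u"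
      have yc: "norm (y c - y0) < \<rho>" using elim by (simp add: dist_norm)
      have "norm (z - y0) \<le> norm (y c - y0) + norm (\<rho> *\<^sub>R u)"
        unfolding z_def by (metis add_diff_eq diff_add_eq norm_triangle_ineq)
      then have z: "norm (z - y0) < 2 * \<rho>" using yc u \<rho> by simp
      then have "z \<in> S" using r \<rho> by (auto simp: dist_norm norm_minus_commute subset_iff)
      then have "f (y c) + m c \<bullet> (z - y c) \<le> f z" using elim by blast
      moreover have "f z \<le> f y0 + m0 \<bullet> (z - y0) + e / 4 * (2 * \<rho>)"
      proof -
        have "norm (f z - f y0 - m0 \<bullet> (z - y0)) \<le> e / 4 * norm (z - y0)"
          using d(2)[of z] z \<rho> by simp
        also have "\<dots> \<le> e / 4 * (2 * \<rho>)" using z \<open>0 < e\<close> by (intro mult_left_mono) auto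
        finally show ?thesis by (simp only: real_norm_def abs_le_iff) linarith
      qed
      moreover have "f (y c) \<ge> f y0 + m0 \<bullet> (y c - y0) - e / 4 * \<rho>"
      proof -
        have "norm (f (y c) - f y0 - m0 \<bullet> (y c - y0)) \<le> e / 4 * norm (y c - y0)"
          using d(2)[of "y c"] yc \<rho> by simp
        also have "\<dots> \<le> e / 4 * \<rho>" using yc \<open>0 < e\<close> by (intro mult_left_mono) auto
        finally show ?thesis by (simp only: real_norm_def abs_le_iff) linarith
      qed
      moreover have "m0 \<bullet> (z - y0) - m0 \<bullet> (y c - y0) = \<rho> * (m0 \<bullet> u)"
        by (simp add: z_def algebra_simps)
      moreover have "m c \<bullet> (z - y c) = \<rho> * (m c \<bullet> u)" by (simp add: z_def)
      ultimately have "\<rho> * (m c \<bullet> u) - \<rho> * (m0 \<bullet> u) \<le> e * \<rho> * (3 / 4)" by (simp add: algebra_simps)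
      then have "\<rho> * (w \<bullet> u) \<le> \<rho> * (e * (3 / 4))"
        unfolding w_def by (simp add: inner_diff_left algebra_simps)
      then have "norm w \<le> e * (3 / 4)" using \<rho>(1) u(2) by simp
      then show ?thesis using \<open>0 < e\<close> by (simp add: w_def dist_norm)
    qed (use \<open>0 < e\<close> in \<open>simp add: w_def\<close>)
  qed
qed

text \<open>
The linearization error along a curve that approaches the base point at linear speed.
\<close>

lemma has_derivative_little_o:
  fixes f :: "'b::real_normed_vector \<Rightarrow> 'c::real_normed_vector"
  assumes D: "(f has_derivative D) (at y0)"
    and B: "\<forall>\<^sub>F a in at 0. norm (B a - y0) \<le> C * \<bar>a :: real\<bar>"
  shows "((\<lambda>a. (1 / a) *\<^sub>R (f (B a) - f y0 - D (B a - y0))) \<longlongrightarrow> 0) (at 0)"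
proof (rule tendstoI)
  fix e :: real assume "0 < e"
  define e' where "e' = e / (2 * (\<bar>C\<bar> + 1))"
  have "0 < e'" using \<open>0 < e\<close> by (simp add: e'_def)
  then obtain d where d: "0 < d"
    "\<And>z. norm (z - y0) < d \<Longrightarrow> norm (f z - f y0 - D (z - y0)) \<le> e' * norm (z - y0)"
    using D unfolding has_derivative_at_alt by meson
  have "((\<lambda>a. C * \<bar>a\<bar>) \<longlongrightarrow> C * \<bar>0 :: real\<bar>) (at 0)" by (intro tendsto_intros)
  then have "\<forall>\<^sub>F a in at 0. C * \<bar>a\<bar> < d" using d(1) by (intro order_tendstoD) auto
  moreover have "\<forall>\<^sub>F a in at (0::real). a \<noteq> 0" by (simp add: eventually_at_filter)
  ultimately show "\<forall>\<^sub>F a in at 0. dist ((1 / a) *\<^sub>R (f (B a) - f y0 - D (B a - y0))) 0 < e"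
    using B
  proof eventually_elim
    case (elim a)
    have "norm (f (B a) - f y0 - D (B a - y0)) \<le> e' * norm (B a - y0)"
      by (rule d(2)) (use elim in linarith)
    also have "\<dots> \<le> e' * (\<bar>C\<bar> * \<bar>a\<bar>)"
    proof (rule mult_left_mono)
      have "C * \<bar>a\<bar> \<le> \<bar>C\<bar> * \<bar>a\<bar>" by (intro mult_right_mono) auto
      then show "norm (B a - y0) \<le> \<bar>C\<bar> * \<bar>a\<bar>" using elim by linarith
    qed (use \<open>0 < e'\<close> in auto)
    finally have "norm (f (B a) - f y0 - D (B a - y0)) / \<bar>a\<bar> \<le> e' * \<bar>C\<bar>"
      using elim by (simp add: field_simps)
    also have "\<dots> < e" using \<open>0 < e\<close> by (simp add: e'_def field_simps) (smt (verit) mult_nonneg_nonneg)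
    finally show ?case by (simp only: dist_0_norm norm_scaleR dist_norm diff_zero) (simp add: divide_inverse mult.commute)
  qed
qed

section \<open>Tilting the supply along a bounded score\<close>

text \<open>
The perturbed supply along a scalar direction of mean zero, for which the normalizing constant is 1.
\<close>

definition tilted_supply :: "('a \<Rightarrow> real) \<Rightarrow> ('a \<Rightarrow> real) \<Rightarrow> real \<Rightarrow> 'a \<Rightarrow> real" where
  "tilted_supply s g \<alpha> \<theta> = (1 + \<alpha> * g \<theta>) * s \<theta>"

lemma tilted_supply_0: "tilted_supply s g 0 = s"
  by (simp add: tilted_supply_def fun_eq_iff)

locale tilted_market = market_env M b v s
  for M :: "'a measure" and b :: "real ^ 'n::finite" and v s +
  fixes g :: "'a \<Rightarrow> real" and K :: real
  assumes g_measurable [measurable]: "g \<in> borel_measurable M"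
    and g_le: "\<And>\<theta>. \<bar>g \<theta>\<bar> \<le> K" and K_pos: "0 < K" and g_mean: "supply_exp M s g = 0"
begin

abbreviation "T \<equiv> tilted_supply s g"

lemma g_bounded: "ess_bounded M g"
  by (rule ess_boundedI[where K=K]) (use g_le in auto)

lemma tilt_weight:
  assumes "\<bar>\<alpha>\<bar> \<le> 1 / (2 * K)"
  shows "1 / 2 \<le> 1 + \<alpha> * g \<theta>" "1 + \<alpha> * g \<theta> \<le> 3 / 2"
proof -
  have "\<bar>\<alpha> * g \<theta>\<bar> \<le> 1 / (2 * K) * K"
    unfolding abs_mult by (intro mult_mono assms g_le) (use K_pos in auto)
  then have "\<bar>\<alpha> * g \<theta>\<bar> \<le> 1 / 2" using K_pos by simp
  then show "1 / 2 \<le> 1 + \<alpha> * g \<theta>" "1 + \<alpha> * g \<theta> \<le> 3 / 2" by linarith+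
qed

lemma supply_exp_tilted:
  assumes "ess_bounded M f"
  shows "supply_exp M (T \<alpha>) f = E f + \<alpha> * E (\<lambda>\<theta>. g \<theta> * f \<theta>)"
proof -
  have "supply_exp M (T \<alpha>) f = E (\<lambda>\<theta>. f \<theta> + \<alpha> * (g \<theta> * f \<theta>))"
    unfolding supply_exp_def tilted_supply_def by (simp add: algebra_simps)
  also have "\<dots> = E f + E (\<lambda>\<theta>. \<alpha> * (g \<theta> * f \<theta>))"
    by (intro E_add ess_bounded_mult ess_bounded_const g_bounded assms)
  finally show ?thesis by (simp only: E_cmult)
qed

lemma tilted_supply_Linf:
  assumes "\<bar>\<alpha>\<bar> \<le> 1 / (2 * K)" shows "T \<alpha> \<in> Linf_plus M"
proof -
  have "AE \<theta> in M. 0 \<le> T \<alpha> \<theta>"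
    using s_nonneg by eventually_elim (simp add: tilted_supply_def, meson tilt_weight(1)[OF assms]
        mult_nonneg_nonneg order_trans zero_le_divide_1_iff zero_le_numeral)
  moreover have "T \<alpha> \<in> borel_measurable M" unfolding tilted_supply_def by measurable
  moreover obtain S where S: "AE \<theta> in M. s \<theta> \<le> S"
    using market by (auto simp: market_def Linf_plus_def)
  have "AE \<theta> in M. T \<alpha> \<theta> \<le> 3 / 2 * S"
    using S s_nonneg
  proof eventually_elim
    case (elim \<theta>)
    show ?case unfolding tilted_supply_def
      by (rule mult_mono[OF tilt_weight(2)[OF assms] elim(1)]) (use elim in auto)
  qed
  ultimately show ?thesis unfolding Linf_plus_def by blast
qed

lemma market_tilted:
  assumes "\<bar>\<alpha>\<bar> \<le> 1 / (2 * K)" shows "market M b v (T \<alpha>)"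
proof -
  have "supply_exp M (T \<alpha>) (\<lambda>_. 1) = 1"
    by (subst supply_exp_tilted) (auto simp: E_const g_mean)
  then show ?thesis
    using market tilted_supply_Linf[OF assms] by (simp add: market_def supply_exp_def)
qed

text \<open>
Since tilting is linear in the tilt parameter, the mean maximal bid and the mean utilities change
at constant rates: the score-weighted integrals below.
\<close>

definition score_bid :: "real ^ 'n \<Rightarrow> real" where "score_bid \<beta> = E (\<lambda>\<theta>. g \<theta> * max_bid v \<beta> \<theta>)"

definition score_utility :: "('n \<Rightarrow> 'a \<Rightarrow> real) \<Rightarrow> real ^ 'n" where "score_utility x = (\<chi> i. E (\<lambda>\<theta>. g \<theta> * (x i \<theta> * v i \<theta>)))"

lemma mean_max_bid_tilted: "mean_max_bid M v (T \<alpha>) \<beta> = F \<beta> + \<alpha> * score_bid \<beta>"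
  by (simp add: mean_max_bid_def supply_exp_tilted max_bid_bounded score_bid_def)

lemma mean_utility_tilted:
  assumes "winning_allocation M v \<beta> x"
  shows "mean_utility M v (T \<alpha>) x = mean_utility M v s x + \<alpha> *\<^sub>R score_utility x"
proof -
  have "mean_utility M v (T \<alpha>) x $ i = supply_exp M (T \<alpha>) (\<lambda>\<theta>. x i \<theta> * v i \<theta>)" for i
    by (simp add: mean_utility_def supply_exp_def mult_ac)
  then show ?thesis
    using winning_allocation_bounded[OF assms] v_bounded
    by (simp add: vec_eq_iff supply_exp_tilted ess_bounded_mult mean_utility_nth score_utility_def)
qed

lemma score_bid_Lipschitz: obtains C where "0 < C" "\<And>\<beta> \<beta>'. \<bar>score_bid \<beta> - score_bid \<beta>'\<bar> \<le> C * norm (\<beta> - \<beta>')"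
proof -
  obtain V where V: "0 \<le> V"
    "\<And>\<beta> \<beta>'. AE \<theta> in M. \<bar>max_bid v \<beta> \<theta> - max_bid v \<beta>' \<theta>\<bar> \<le> norm (\<beta> - \<beta>') * V"
    using max_bid_Lipschitz_AE by blast
  have "\<bar>score_bid \<beta> - score_bid \<beta>'\<bar> \<le> (K * (V + 1)) * norm (\<beta> - \<beta>')" for \<beta> \<beta>'
  proof -
    have "score_bid \<beta> - score_bid \<beta>' = E (\<lambda>\<theta>. g \<theta> * max_bid v \<beta> \<theta> - g \<theta> * max_bid v \<beta>' \<theta>)"
      unfolding score_bid_def by (intro E_diff[symmetric] ess_bounded_mult g_bounded max_bid_bounded)
    also have "\<bar>\<dots>\<bar> \<le> K * (norm (\<beta> - \<beta>') * V)"
    proof (rule E_abs_le)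
      show "AE \<theta> in M. \<bar>g \<theta> * max_bid v \<beta> \<theta> - g \<theta> * max_bid v \<beta>' \<theta>\<bar> \<le> K * (norm (\<beta> - \<beta>') * V)"
        using V(2)[of \<beta> \<beta>']
      proof eventually_elim
        case (elim \<theta>)
        have "\<bar>g \<theta> * max_bid v \<beta> \<theta> - g \<theta> * max_bid v \<beta>' \<theta>\<bar> = \<bar>g \<theta>\<bar> * \<bar>max_bid v \<beta> \<theta> - max_bid v \<beta>' \<theta>\<bar>"
          by (simp add: right_diff_distrib[symmetric] abs_mult)
        also have "\<dots> \<le> K * (norm (\<beta> - \<beta>') * V)"
          by (intro mult_mono g_le elim) (use K_pos in auto)
        finally show ?case .
      qed
    qed measurable
    also have "\<dots> \<le> (K * (V + 1)) * norm (\<beta> - \<beta>')" using K_pos by (simp add: algebra_simps)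
    finally show ?thesis .
  qed
  then show ?thesis using that[of "K * (V + 1)"] K_pos V(1) by simp
qed

text \<open>
The mean maximal bids for the two opposite tilts are convex and sum to twice the untilted one. Both
linearization errors are nonnegative by convexity, and their sum is the error of a differentiable
function. Hence each of them is differentiable wherever the untilted mean maximal bid is.
\<close>

lemma tilted_has_gradient:
  assumes \<alpha>: "\<bar>\<alpha>\<bar> \<le> 1 / (2 * K)" and \<beta>: "\<And>i. 0 < \<beta> $ i"
    and diff: "F differentiable (at \<beta>)" and x: "winning_allocation M v \<beta> x"
  shows "(mean_max_bid M v (T \<alpha>) has_derivative (\<lambda>u. mean_utility M v (T \<alpha>) x \<bullet> u)) (at \<beta>)"
proof -
  let ?f = "\<lambda>a. mean_max_bid M v (T a)" and ?mu = "\<lambda>a. mean_utility M v (T a) x"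
    and ?m0 = "mean_utility M v s x"
  obtain D where D: "(F has_derivative D) (at \<beta>)" using diff by (auto simp: differentiable_def)
  then have FD: "(F has_derivative (\<lambda>u. ?m0 \<bullet> u)) (at \<beta>)"
    using winning_allocation_gradient[OF x \<beta> D] by simp
  define S where "S = {y :: real^'n. \<forall>i. 0 < y $ i}"
  have "open S" unfolding S_def Collect_all_eq
    by (intro open_INT ballI open_Collect_less continuous_intros) auto
  have sub: "0 \<le> ?f a y - ?f a \<beta> - ?mu a \<bullet> (y - \<beta>)" if a: "\<bar>a\<bar> \<le> 1 / (2 * K)" and y: "y \<in> S" for a y
  proof -
    interpret t: market_env M b v "T a" by unfold_locales (rule market_tilted[OF a])
    show ?thesis
      using t.winning_allocation_value[OF x] t.winning_allocation_subgradient[OF x, of y] \<beta> y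
      by (simp add: S_def less_imp_le inner_diff_right)
  qed
  show ?thesis unfolding has_derivative_at_alt
  proof (intro conjI allI impI)
    show "bounded_linear (\<lambda>u. ?mu \<alpha> \<bullet> u)" by (rule bounded_linear_inner_right)
    fix e :: real assume "0 < e"
    obtain d where d: "0 < d"
      "\<And>y. norm (y - \<beta>) < d \<Longrightarrow> norm (F y - F \<beta> - ?m0 \<bullet> (y - \<beta>)) \<le> e / 2 * norm (y - \<beta>)"
      using FD \<open>0 < e\<close> unfolding has_derivative_at_alt by (meson half_gt_zero)
    obtain r where r: "0 < r" "ball \<beta> r \<subseteq> S"
      using \<open>open S\<close> \<beta> unfolding open_contains_ball S_def by blast
    show "\<exists>d>0. \<forall>y. norm (y - \<beta>) < d \<longrightarrow> norm (?f \<alpha> y - ?f \<alpha> \<beta> - ?mu \<alpha> \<bullet> (y - \<beta>)) \<le> e * norm (y - \<beta>)"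
    proof (intro exI[of _ "min d r"] conjI allI impI)
      fix y assume y: "norm (y - \<beta>) < min d r"
      then have "y \<in> S" using r by (auto simp: dist_norm norm_minus_commute subset_iff)
      then have 1: "0 \<le> ?f \<alpha> y - ?f \<alpha> \<beta> - ?mu \<alpha> \<bullet> (y - \<beta>)"
        and 2: "0 \<le> ?f (-\<alpha>) y - ?f (-\<alpha>) \<beta> - ?mu (-\<alpha>) \<bullet> (y - \<beta>)"
        using sub \<alpha> by auto
      have "(?f \<alpha> y - ?f \<alpha> \<beta> - ?mu \<alpha> \<bullet> (y - \<beta>)) + (?f (-\<alpha>) y - ?f (-\<alpha>) \<beta> - ?mu (-\<alpha>) \<bullet> (y - \<beta>))
          = 2 * (F y - F \<beta> - ?m0 \<bullet> (y - \<beta>))"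
        unfolding mean_max_bid_tilted mean_utility_tilted[OF x] by (simp add: inner_add_left inner_diff_left)
      moreover have "norm (F y - F \<beta> - ?m0 \<bullet> (y - \<beta>)) \<le> e / 2 * norm (y - \<beta>)"
        using d(2) y by simp
      ultimately show "norm (?f \<alpha> y - ?f \<alpha> \<beta> - ?mu \<alpha> \<bullet> (y - \<beta>)) \<le> e * norm (y - \<beta>)"
        using 1 2 by (simp add: field_simps)
    qed (use d r in auto)
  qed
qed

end

section \<open>Equilibria of slightly tilted markets\<close>

lemma open_positive_orthant: "open {y :: real ^ 'n::finite. \<forall>i. 0 < y $ i}"
  unfolding Collect_all_eq by (intro open_INT ballI open_Collect_less continuous_intros) auto

context market_env
begin

lemma dual_objective_has_derivative:
  assumes y: "\<And>i. 0 < y $ i" and F: "(F has_derivative D) (at y)"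
  shows "(dual_objective M b v s has_derivative (\<lambda>u. D u - (\<Sum>i\<in>UNIV. b $ i * (u $ i / y $ i)))) (at y)"
proof -
  have "((\<lambda>y. ln (y $ i)) has_derivative (\<lambda>u. u $ i / y $ i)) (at y)" for i
  proof -
    have "((\<lambda>y. y $ i) has_derivative (\<lambda>u. u $ i)) (at y)"
      by (rule bounded_linear_imp_has_derivative[OF bounded_linear_vec_nth])
    from has_derivative_ln[OF _ this] show ?thesis using y[of i] by (simp add: divide_inverse)
  qed
  then show ?thesis
    unfolding dual_objective_def[abs_def] using F
    by (intro has_derivative_diff has_derivative_sum has_derivative_mult_right) auto
qed

lemma FPPE_strong_minimizer:
  assumes eq: "is_FPPE M b v s \<beta> p x"
  obtains m where "0 < m"
    "\<And>y. (\<And>i. 0 < y $ i) \<Longrightarrow> (\<And>i. y $ i \<le> 1) \<Longrightarrow>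
       m * (norm (y - \<beta>))\<^sup>2 \<le> dual_objective M b v s y - dual_objective M b v s \<beta>"
proof -
  define m where "m = Min (range (\<lambda>i. b $ i)) / 2"
  have bm: "m \<le> b $ i / 2" for i unfolding m_def by (intro divide_right_mono Min_le) auto
  have "0 < m" unfolding m_def using b_pos by (simp add: Min_gr_iff)
  moreover have "m * (norm (y - \<beta>))\<^sup>2 \<le> dual_objective M b v s y - dual_objective M b v s \<beta>"
    if y: "\<And>i. 0 < y $ i" "\<And>i. y $ i \<le> 1" for y
  proof -
    have "m * (norm (y - \<beta>))\<^sup>2 = (\<Sum>i\<in>UNIV. m * (y $ i - \<beta> $ i)\<^sup>2)"
      by (simp add: norm_vec_def L2_set_def sum_nonneg sum_distrib_left)
    also have "\<dots> \<le> (\<Sum>i\<in>UNIV. b $ i / 2 * (y $ i - \<beta> $ i)\<^sup>2)"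
      by (intro sum_mono mult_right_mono bm) auto
    also have "\<dots> \<le> dual_objective M b v s y - dual_objective M b v s \<beta>"
      by (rule FPPE_dual_gap[OF eq y])
    finally show ?thesis .
  qed
  ultimately show ?thesis by (rule that)
qed

text \<open>
Lowering one coordinate is always feasible, and raising it is feasible when the coordinate is below 1. The
resulting one-sided conditions say that no budget is exceeded and that buyers with multiplier
below 1 exhaust theirs.
\<close>

lemma is_FPPE_of_local_minimum:
  assumes y: "\<And>i. 0 < y $ i" "\<And>i. y $ i \<le> 1"
    and x: "winning_allocation M v y x"
    and D: "(F has_derivative (\<lambda>u. mean_utility M v s x \<bullet> u)) (at y)"
    and r: "0 < r"
    and min: "\<And>z. norm (z - y) < r \<Longrightarrow> (\<And>i. z $ i \<le> 1) \<Longrightarrow> dual_objective M b v s y \<le> dual_objective M b v s z"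
  shows "is_FPPE M b v s y (max_bid v y) x"
proof -
  let ?m = "mean_utility M v s x"
  let ?D = "\<lambda>u. ?m \<bullet> u - (\<Sum>i\<in>UNIV. b $ i * (u $ i / y $ i))"
  note HD = dual_objective_has_derivative[OF y(1) D]
  have D_axis: "?D (c *\<^sub>R axis i 1) = c * (?m $ i - b $ i / y $ i)" for c i
  proof -
    have "(\<Sum>j\<in>UNIV. b $ j * ((c *\<^sub>R axis i 1 :: real^'n) $ j / y $ j)) = (\<Sum>j\<in>UNIV. if j = i then c * (b $ j / y $ j) else 0)"
      by (intro sum.cong) (auto simp: axis_def)
    then show ?thesis by (simp add: inner_axis algebra_simps)
  qed
  have down: "0 \<le> ?D ((-1) *\<^sub>R axis i 1)" for i
  proof (rule directional_minimum[OF HD r])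
    fix t :: real assume t: "0 < t" "t < r"
    show "dual_objective M b v s y \<le> dual_objective M b v s (y + t *\<^sub>R ((-1) *\<^sub>R axis i 1))"
    proof (rule min)
      show "norm (y + t *\<^sub>R ((-1) *\<^sub>R axis i 1) - y) < r" using t by simp
      fix j show "(y + t *\<^sub>R ((-1) *\<^sub>R axis i 1)) $ j \<le> 1"
        using y(2)[of j] t by (auto simp: axis_def)
    qed
  qed
  have up: "0 \<le> ?D (1 *\<^sub>R axis i 1)" if i: "y $ i < 1" for i
  proof (rule directional_minimum[OF HD])
    show "0 < min r (1 - y $ i)" using r i by simp
    fix t :: real assume t: "0 < t" "t < min r (1 - y $ i)"
    show "dual_objective M b v s y \<le> dual_objective M b v s (y + t *\<^sub>R (1 *\<^sub>R axis i 1))"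
    proof (rule min)
      show "norm (y + t *\<^sub>R (1 *\<^sub>R axis i 1) - y) < r" using t by simp
      fix j show "(y + t *\<^sub>R (1 *\<^sub>R axis i 1)) $ j \<le> 1"
        using y(2)[of j] t by (auto simp: axis_def)
    qed
  qed
  have le: "?m $ i \<le> b $ i / y $ i" for i using down[of i] unfolding D_axis by simp
  have ge: "?m $ i \<ge> b $ i / y $ i" if "y $ i < 1" for i using up[OF that] unfolding D_axis by simp
  show ?thesis
  proof (rule is_FPPE_I[OF x y])
    show "y $ i * ?m $ i \<le> b $ i" for i using le[of i] y(1)[of i] by (simp add: field_simps)
    show "y $ i * ?m $ i = b $ i" if "y $ i < 1" for i
    proof -
      have "?m $ i = b $ i / y $ i" using le[of i] ge[OF that] by (rule antisym)
      then show ?thesis using y(1)[of i] by simp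
    qed
  qed
qed

end

context tilted_market
begin

text \<open>
Minimize the tilted dual objective over a small compact neighbourhood of the equilibrium multipliers,
intersected with the constraint set. The strong minimum of the untilted objective keeps the minimizer
within distance \<open>C * \<bar>\<alpha>\<bar>\<close>, hence in the interior of the neighbourhood, where it is an equilibrium.
\<close>

lemma tilted_FPPE_exists:
  assumes eq: "is_FPPE M b v s \<beta> p x"
    and U: "open U" "\<beta> \<in> U" "\<And>y. y \<in> U \<Longrightarrow> F differentiable (at y)"
  obtains \<alpha>0 C where "0 < \<alpha>0" "0 < C" "\<alpha>0 \<le> 1 / (2 * K)"
    "\<And>\<alpha>. \<bar>\<alpha>\<bar> \<le> \<alpha>0 \<Longrightarrow> \<exists>y z. is_FPPE M b v (T \<alpha>) y (max_bid v y) z \<and> norm (y - \<beta>) \<le> C * \<bar>\<alpha>\<bar>"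
proof -
  let ?S = "{y :: real ^ 'n. \<forall>i. 0 < y $ i}"
  have "open (U \<inter> ?S)" "\<beta> \<in> U \<inter> ?S"
    using U open_positive_orthant is_FPPE_pos[OF eq] by auto
  then obtain \<rho> where \<rho>: "0 < \<rho>" "cball \<beta> \<rho> \<subseteq> U \<inter> ?S" by (meson open_contains_cball)
  define B where "B = cball \<beta> \<rho> \<inter> {y. \<forall>i. y $ i \<le> 1}"
  have "closed {y :: real ^ 'n. \<forall>i. y $ i \<le> 1}"
    unfolding Collect_all_eq by (intro closed_INT ballI closed_Collect_le continuous_intros)
  then have "compact B" unfolding B_def by (intro compact_Int_closed compact_cball)
  have "\<beta> \<in> B" using \<rho>(1) is_FPPE_le_one[OF eq] by (simp add: B_def)
  have BS: "0 < y $ i" "y $ i \<le> 1" "y \<in> U" if "y \<in> B" for y i using that \<rho>(2) by (auto simp: B_def)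
  obtain m where m: "0 < m"
    "\<And>y. (\<And>i. 0 < y $ i) \<Longrightarrow> (\<And>i. y $ i \<le> 1) \<Longrightarrow>
       m * (norm (y - \<beta>))\<^sup>2 \<le> dual_objective M b v s y - dual_objective M b v s \<beta>"
    using FPPE_strong_minimizer[OF eq] by blast
  obtain C where C: "0 < C" "\<And>y z. \<bar>score_bid y - score_bid z\<bar> \<le> C * norm (y - z)" using score_bid_Lipschitz by blast
  \<comment> \<open>The second bound keeps the displacement C / m * \<alpha>0 below the radius \<rho>.\<close>
  define \<alpha>0 where "\<alpha>0 = min (1 / (2 * K)) (\<rho> * m / (2 * C))"
  show ?thesis
  proof (rule that[of \<alpha>0 "C / m"])
    show "0 < \<alpha>0" "0 < C / m" "\<alpha>0 \<le> 1 / (2 * K)" using C m \<rho> K_pos by (auto simp: \<alpha>0_def)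
    fix \<alpha> assume \<alpha>: "\<bar>\<alpha>\<bar> \<le> \<alpha>0"
    then have \<alpha>K: "\<bar>\<alpha>\<bar> \<le> 1 / (2 * K)" by (simp add: \<alpha>0_def)
    interpret t: market_env M b v "T \<alpha>" by unfold_locales (rule market_tilted[OF \<alpha>K])
    let ?H = "dual_objective M b v (T \<alpha>)"
    have HH: "?H y = dual_objective M b v s y + \<alpha> * score_bid y" for y
      by (simp add: dual_objective_def mean_max_bid_tilted)
    have grad: "(mean_max_bid M v (T \<alpha>) has_derivative (\<lambda>u. mean_utility M v (T \<alpha>) z \<bullet> u)) (at y)"
      if "y \<in> B" "winning_allocation M v y z" for y z
      using that BS by (intro tilted_has_gradient \<alpha>K U(3)) auto
    have "continuous_on B ?H"
    proof (rule continuous_at_imp_continuous_on, rule ballI)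
      fix y assume y: "y \<in> B"
      obtain z where "winning_allocation M v y z" using winning_allocation_exists by blast
      from t.dual_objective_has_derivative[OF BS(1)[OF y] grad[OF y this]]
      show "isCont ?H y" by (rule has_derivative_continuous)
    qed
    then obtain y where y: "y \<in> B" "\<And>z. z \<in> B \<Longrightarrow> ?H y \<le> ?H z"
      using continuous_attains_inf[OF \<open>compact B\<close>, of ?H] \<open>\<beta> \<in> B\<close> by blast
    \<comment> \<open>Minimality of y for the tilted objective against strong minimality of the equilibrium for the untilted one.\<close>
    have "m * (norm (y - \<beta>))\<^sup>2 \<le> \<alpha> * (score_bid \<beta> - score_bid y)"
      using m(2)[of y] BS[OF y(1)] y(2)[OF \<open>\<beta> \<in> B\<close>] unfolding HH by (simp add: algebra_simps)
    also have "\<dots> \<le> \<bar>\<alpha>\<bar> * \<bar>score_bid \<beta> - score_bid y\<bar>" by (metis abs_ge_self abs_mult)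
    also have "\<dots> \<le> \<bar>\<alpha>\<bar> * (C * norm (y - \<beta>))"
      using C(2)[of \<beta> y] by (intro mult_left_mono) (auto simp: norm_minus_commute)
    finally have "norm (y - \<beta>) * (m * norm (y - \<beta>)) \<le> norm (y - \<beta>) * (C * \<bar>\<alpha>\<bar>)"
      by (simp add: power2_eq_square algebra_simps)
    then have "m * norm (y - \<beta>) \<le> C * \<bar>\<alpha>\<bar>"
      using C(1) by (cases "norm (y - \<beta>) = 0") auto
    then have dist: "norm (y - \<beta>) \<le> C / m * \<bar>\<alpha>\<bar>" using m(1) by (simp add: field_simps)
    also have "\<dots> \<le> C / m * (\<rho> * m / (2 * C))"
      using \<alpha> C m by (intro mult_left_mono) (auto simp: \<alpha>0_def)
    also have "\<dots> < \<rho>" using C m \<rho> by simp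
    finally have int: "norm (y - \<beta>) < \<rho>" .
    obtain z where z: "winning_allocation M v y z" using winning_allocation_exists by blast
    have "is_FPPE M b v (T \<alpha>) y (max_bid v y) z"
    proof (rule t.is_FPPE_of_local_minimum[OF BS(1,2)[OF y(1)] z grad[OF y(1) z]])
      show "0 < \<rho> - norm (y - \<beta>)" using int by simp
      fix w assume w: "norm (w - y) < \<rho> - norm (y - \<beta>)" "\<And>i. w $ i \<le> 1"
      have "norm (w - \<beta>) \<le> norm (w - y) + norm (y - \<beta>)" by (metis diff_add_cancel add_diff_eq norm_triangle_ineq)
      then have "w \<in> B" using w by (simp add: B_def dist_norm norm_minus_commute)
      then show "?H y \<le> ?H w" by (rule y(2))
    qed
    then show "\<exists>y z. is_FPPE M b v (T \<alpha>) y (max_bid v y) z \<and> norm (y - \<beta>) \<le> C / m * \<bar>\<alpha>\<bar>"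
      using dist by blast
  qed
qed

end

context market_env
begin

text \<open>
The gradient of the dual objective in closed form; equality with the gradient holds near an equilibrium.
\<close>

definition dual_gradient :: "real ^ 'n \<Rightarrow> real ^ 'n" where
  "dual_gradient y = gradient F y - (\<chi> i. b $ i / y $ i)"

lemma gradient_eqI:
  assumes "(f has_derivative (\<lambda>u. c \<bullet> u)) (at y)"
  shows "gradient f y = c"
  using frechet_derivative_at[OF assms, symmetric] by (simp add: gradient_def vec_eq_iff inner_axis)

lemma gradient_mean_max_bid:
  assumes y: "\<And>i. 0 < y $ i" and diff: "F differentiable (at y)" and x: "winning_allocation M v y x"
  shows "gradient F y = mean_utility M v s x"
proof -
  obtain D where D: "(F has_derivative D) (at y)" using diff by (auto simp: differentiable_def)
  show ?thesis using D winning_allocation_gradient[OF x y D] by (intro gradient_eqI) simp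
qed

lemma dual_gradient_has_derivative:
  assumes \<beta>: "\<And>i. 0 < \<beta> $ i" and U: "open U" "\<beta> \<in> U" "\<And>y. y \<in> U \<Longrightarrow> F differentiable (at y)"
    and diff: "gradient F differentiable (at \<beta>)"
  shows "(dual_gradient has_derivative (\<lambda>u. hessian (dual_objective M b v s) \<beta> *v u)) (at \<beta>)"
proof -
  let ?H = "dual_objective M b v s" and ?S = "U \<inter> {y :: real ^ 'n. \<forall>i. 0 < y $ i}"
  have S: "open ?S" "\<beta> \<in> ?S" using U \<beta> open_positive_orthant by auto
  have eq: "gradient ?H y = dual_gradient y" if y: "y \<in> ?S" for y
  proof -
    obtain x where x: "winning_allocation M v y x" using winning_allocation_exists by blast
    obtain D where D: "(F has_derivative D) (at y)" using U(3) y by (auto simp: differentiable_def)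
    then have "(F has_derivative (\<lambda>u. mean_utility M v s x \<bullet> u)) (at y)"
      using winning_allocation_gradient[OF x _ D] y by simp
    then have "(?H has_derivative (\<lambda>u. mean_utility M v s x \<bullet> u - (\<Sum>i\<in>UNIV. b $ i * (u $ i / y $ i)))) (at y)"
      using y by (intro dual_objective_has_derivative) auto
    moreover have "mean_utility M v s x \<bullet> u - (\<Sum>i\<in>UNIV. b $ i * (u $ i / y $ i))
        = (mean_utility M v s x - (\<chi> i. b $ i / y $ i)) \<bullet> u" for u
      by (simp add: inner_diff_left) (simp add: inner_vec_def)
    ultimately have "gradient ?H y = mean_utility M v s x - (\<chi> i. b $ i / y $ i)"
      by (intro gradient_eqI) simp
    then show ?thesis
      using gradient_mean_max_bid[OF _ U(3) x] y by (simp add: dual_gradient_def)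
  qed
  have "(\<lambda>y :: real ^ 'n. \<chi> i. b $ i / y $ i) differentiable (at \<beta>)"
  proof -
    have "(\<lambda>y :: real ^ 'n. (\<chi> i. b $ i / y $ i) \<bullet> axis j 1) differentiable (at \<beta>)" for j
    proof -
      have nz: "\<beta> $ j \<noteq> 0" using \<beta>[of j] by simp
      have "(\<lambda>y :: real ^ 'n. y $ j) differentiable (at \<beta>)"
        by (intro bounded_linear_imp_differentiable bounded_linear_vec_nth)
      then have "(\<lambda>y :: real ^ 'n. b $ j / y $ j) differentiable (at \<beta>)"
        using nz by (intro differentiable_divide differentiable_const)
      then show ?thesis by (simp add: inner_axis)
    qed
    then show ?thesis
      by (subst differentiable_componentwise_within) (auto simp: Basis_vec_def)
  qed
  then have "dual_gradient differentiable (at \<beta>)"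
    unfolding dual_gradient_def[abs_def] using diff by (intro differentiable_diff)
  then obtain D where D: "(dual_gradient has_derivative D) (at \<beta>)" by (auto simp: differentiable_def)
  have "(gradient ?H has_derivative D) (at \<beta>)"
    by (rule has_derivative_transform_within_open[OF D S]) (simp add: eq)
  then have "gradient ?H differentiable (at \<beta>)" by (auto simp: differentiable_def)
  then have "(gradient ?H has_derivative (\<lambda>u. hessian ?H \<beta> *v u)) (at \<beta>)"
    unfolding hessian_def by (simp only: jacobian_works)
  then show ?thesis
    by (rule has_derivative_transform_within_open[OF _ S]) (simp add: eq)
qed

text \<open>
The mean maximal bid is convex, so its gradient is monotone, and the logarithms contribute at least
\<open>b $ i / 2\<close> to the growth of the gradient of the dual objective along each coordinate, since
\<open>\<beta> $ i * y $ i \<le> 2\<close> at points \<open>y\<close> near the equilibrium.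
\<close>

lemma hessian_pos:
  assumes eq: "is_FPPE M b v s \<beta> p x"
    and U: "open U" "\<beta> \<in> U" "\<And>y. y \<in> U \<Longrightarrow> F differentiable (at y)"
    and diff: "gradient F differentiable (at \<beta>)" and "u \<noteq> 0"
  shows "0 < u \<bullet> (hessian (dual_objective M b v s) \<beta> *v u)"
proof -
  note pos = is_FPPE_pos[OF eq] and le1 = is_FPPE_le_one[OF eq]
  let ?A = "hessian (dual_objective M b v s) \<beta>"
  define q where "q = (\<Sum>i\<in>UNIV. b $ i * (u $ i)\<^sup>2) / 2"
  have "0 < q"
  proof -
    obtain j where "u $ j \<noteq> 0" using \<open>u \<noteq> 0\<close> by (auto simp: vec_eq_iff)
    then have "0 < b $ j * (u $ j)\<^sup>2" using b_pos[of j] by simp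
    also have "\<dots> \<le> (\<Sum>i\<in>UNIV. b $ i * (u $ i)\<^sup>2)"
      by (rule member_le_sum) (use b_pos in \<open>auto simp: less_imp_le\<close>)
    finally show ?thesis by (simp add: q_def)
  qed
  have uu: "u \<bullet> u \<noteq> 0" using \<open>u \<noteq> 0\<close> by simp
  \<comment> \<open>Along u the second term grows at rate q, the guaranteed growth rate of the first.\<close>
  define f where "f y = u \<bullet> dual_gradient y - q / (u \<bullet> u) * (u \<bullet> y)" for y
  have fD: "(f has_derivative (\<lambda>w. u \<bullet> (?A *v w) - q / (u \<bullet> u) * (u \<bullet> w))) (at \<beta>)"
    unfolding f_def by (intro has_derivative_diff has_derivative_mult_right has_derivative_inner_right
        dual_gradient_has_derivative[OF pos U diff] has_derivative_ident)
  let ?S = "U \<inter> {y :: real ^ 'n. \<forall>i. 0 < y $ i}"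
  have "open ?S" "\<beta> \<in> ?S" using U pos open_positive_orthant by auto
  then obtain r where r: "0 < r" "ball \<beta> r \<subseteq> ?S" by (meson open_contains_ball)
  define d where "d = min r 1 / norm u"
  have "0 \<le> u \<bullet> (?A *v u) - q / (u \<bullet> u) * (u \<bullet> u)"
  proof (rule directional_minimum[OF fD])
    show "0 < d" using r \<open>u \<noteq> 0\<close> by (simp add: d_def)
    fix t assume t: "0 < t" "t < d"
    define y where "y = \<beta> + t *\<^sub>R u"
    have tu: "t * norm u < min r 1" using t \<open>u \<noteq> 0\<close> by (simp add: d_def field_simps)
    then have "norm (y - \<beta>) < r" using t by (simp add: y_def)
    then have yS: "y \<in> ?S" using r(2) by (auto simp: dist_norm norm_minus_commute subset_iff)
    obtain z where z: "winning_allocation M v y z" using winning_allocation_exists by blast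
    have x: "winning_allocation M v \<beta> x" using eq by (rule is_FPPE_winning_allocation)
    have "0 \<le> (gradient F y - gradient F \<beta>) \<bullet> (y - \<beta>)"
    proof -
      have "gradient F y = mean_utility M v s z" using yS by (intro gradient_mean_max_bid U(3) z) auto
      moreover have "gradient F \<beta> = mean_utility M v s x" using U by (intro gradient_mean_max_bid pos x) auto
      moreover have "mean_utility M v s z \<bullet> y = F y" "mean_utility M v s z \<bullet> \<beta> \<le> F \<beta>"
          "mean_utility M v s x \<bullet> \<beta> = F \<beta>" "mean_utility M v s x \<bullet> y \<le> F y"
        using winning_allocation_value[OF z] winning_allocation_value[OF x]
          winning_allocation_subgradient[OF z, of \<beta>] winning_allocation_subgradient[OF x, of y] pos yS
        by (auto simp: less_imp_le)
      ultimately show ?thesis by (simp add: inner_diff_left inner_diff_right)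
    qed
    then have 1: "0 \<le> u \<bullet> (gradient F y - gradient F \<beta>)"
      using t(1) by (simp add: y_def inner_commute zero_le_mult_iff)
    have 2: "u \<bullet> ((\<chi> i. b $ i / \<beta> $ i) - (\<chi> i. b $ i / y $ i)) \<ge> t * q"
    proof -
      have "t * q = (\<Sum>i\<in>UNIV. t * (b $ i * (u $ i)\<^sup>2 / 2))"
        by (simp add: q_def sum_distrib_left sum_divide_distrib)
      also have "\<dots> \<le> (\<Sum>i\<in>UNIV. u $ i * (b $ i / \<beta> $ i - b $ i / y $ i))"
      proof (rule sum_mono)
        fix i
        have y0: "0 < y $ i" using yS by auto
        have "\<bar>t * u $ i\<bar> \<le> t * norm u" using component_le_norm_cart[of u i] t by (simp add: abs_mult)
        then have "\<bar>t * u $ i\<bar> \<le> 1" using tu by linarith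
        then have "y $ i \<le> 2" using le1[of i] by (simp add: y_def)
        then have "\<beta> $ i * y $ i \<le> 1 * 2" using pos[of i] y0 le1[of i] by (intro mult_mono) auto
        then have "t * (b $ i * (u $ i)\<^sup>2 / 2) \<le> t * (b $ i * (u $ i)\<^sup>2 / (\<beta> $ i * y $ i))"
          using pos[of i] y0 t b_pos[of i] by (intro mult_left_mono divide_left_mono mult_pos_pos) auto
        also have "\<dots> = u $ i * (b $ i / \<beta> $ i - b $ i / y $ i)"
        proof -
          have "b $ i / \<beta> $ i - b $ i / y $ i = b $ i * (y $ i - \<beta> $ i) / (\<beta> $ i * y $ i)"
            using pos[of i] y0 by (simp add: field_simps)
          then show ?thesis by (simp add: y_def power2_eq_square)
        qed
        finally show "t * (b $ i * (u $ i)\<^sup>2 / 2) \<le> u $ i * (b $ i / \<beta> $ i - b $ i / y $ i)" .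
      qed
      finally show ?thesis by (simp add: inner_vec_def)
    qed
    have "q / (u \<bullet> u) * (u \<bullet> y) = q / (u \<bullet> u) * (u \<bullet> \<beta>) + t * q"
      using uu by (simp add: y_def inner_add_right field_simps)
    then have "f \<beta> \<le> f y"
      using 1 2 by (simp add: f_def dual_gradient_def inner_diff_right)
    then show "f \<beta> \<le> f (\<beta> + t *\<^sub>R u)" by (simp add: y_def)
  qed
  then show ?thesis using \<open>0 < q\<close> uu by simp
qed

section \<open>The pathwise derivative of the revenue\<close>

text \<open>
Pairing \<open>D_REV\<close> with a bounded function moves the pseudo-inverse onto score-weighted utilities. With the
constant 1 this gives the mean of \<open>D_REV\<close>, with a score it gives the derivative of the revenue along
that score.
\<close>

lemma D_REV_bounded_and_pairing:
  assumes eq: "is_FPPE M b v s \<beta> p x" and f: "ess_bounded M f"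
  shows "ess_bounded M (D_REV M b v s \<beta> p x)"
    and "E (\<lambda>\<theta>. f \<theta> * D_REV M b v s \<beta> p x \<theta>) =
      E (\<lambda>\<theta>. f \<theta> * max_bid v \<beta> \<theta>) - F \<beta> * E f
      - mean_utility M v s x \<bullet> (pinv (H_B M b v s \<beta>) *v
          ((\<chi> i. E (\<lambda>\<theta>. f \<theta> * (x i \<theta> * v i \<theta>))) - E f *\<^sub>R mean_utility M v s x))"
proof -
  let ?m = "mean_utility M v s x" and ?X = "pinv (H_B M b v s \<beta>)"
  let ?c = "?m v* ?X"
  have x: "winning_allocation M v \<beta> x" using eq by (rule is_FPPE_winning_allocation)
  have p: "AE \<theta> in M. p \<theta> = max_bid v \<beta> \<theta>" and [measurable]: "p \<in> borel_measurable M"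
    using eq by (auto simp: is_FPPE_def L1_plus_def)
  have pb: "ess_bounded M p"
    using max_bid_bounded \<open>p \<in> borel_measurable M\<close> p by (rule ess_bounded_AE_cong)
  have D: "D_REV M b v s \<beta> p x = (\<lambda>\<theta>. p \<theta> - F \<beta> - (\<Sum>i\<in>UNIV. ?c $ i * (x i \<theta> * v i \<theta> - ?m $ i)))"
  proof
    fix \<theta>
    have "?m \<bullet> (?X *v (item_utility v x \<theta> - ?m)) = ?c \<bullet> (item_utility v x \<theta> - ?m)"
      by (rule dot_lmul_matrix[symmetric])
    also have "\<dots> = (\<Sum>i\<in>UNIV. ?c $ i * (x i \<theta> * v i \<theta> - ?m $ i))"
      by (simp add: inner_vec_def item_utility_def)
    finally show "D_REV M b v s \<beta> p x \<theta> = p \<theta> - F \<beta> - (\<Sum>i\<in>UNIV. ?c $ i * (x i \<theta> * v i \<theta> - ?m $ i))"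
      by (simp add: D_REV_def D_beta_def FPPE_revenue_eq(2)[OF eq])
  qed
  note bd = ess_bounded_diff ess_bounded_sum ess_bounded_mult ess_bounded_const finite
    winning_allocation_bounded[OF x] v_bounded f
  show "ess_bounded M (D_REV M b v s \<beta> p x)"
    unfolding D by (intro bd pb)
  have "E (\<lambda>\<theta>. f \<theta> * D_REV M b v s \<beta> p x \<theta>) =
     E (\<lambda>\<theta>. f \<theta> * p \<theta> - F \<beta> * f \<theta> - (\<Sum>i\<in>UNIV. ?c $ i * (f \<theta> * (x i \<theta> * v i \<theta>) - ?m $ i * f \<theta>)))"
    unfolding D by (rule arg_cong[where f=E]) (simp add: fun_eq_iff algebra_simps sum_distrib_left)
  also have "\<dots> = E (\<lambda>\<theta>. f \<theta> * p \<theta> - F \<beta> * f \<theta>)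
      - E (\<lambda>\<theta>. \<Sum>i\<in>UNIV. ?c $ i * (f \<theta> * (x i \<theta> * v i \<theta>) - ?m $ i * f \<theta>))"
    by (intro E_diff bd pb)
  also have "E (\<lambda>\<theta>. f \<theta> * p \<theta> - F \<beta> * f \<theta>) = E (\<lambda>\<theta>. f \<theta> * p \<theta>) - E (\<lambda>\<theta>. F \<beta> * f \<theta>)"
    by (intro E_diff bd pb)
  also have "E (\<lambda>\<theta>. \<Sum>i\<in>UNIV. ?c $ i * (f \<theta> * (x i \<theta> * v i \<theta>) - ?m $ i * f \<theta>))
      = (\<Sum>i\<in>UNIV. E (\<lambda>\<theta>. ?c $ i * (f \<theta> * (x i \<theta> * v i \<theta>) - ?m $ i * f \<theta>)))"
    by (intro E_sum bd)
  also have "\<dots> = (\<Sum>i\<in>UNIV. ?c $ i * (E (\<lambda>\<theta>. f \<theta> * (x i \<theta> * v i \<theta>)) - ?m $ i * E f))"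
  proof (rule sum.cong[OF refl])
    fix i
    have "E (\<lambda>\<theta>. f \<theta> * (x i \<theta> * v i \<theta>) - ?m $ i * f \<theta>)
        = E (\<lambda>\<theta>. f \<theta> * (x i \<theta> * v i \<theta>)) - E (\<lambda>\<theta>. ?m $ i * f \<theta>)"
      by (intro E_diff bd)
    then show "E (\<lambda>\<theta>. ?c $ i * (f \<theta> * (x i \<theta> * v i \<theta>) - ?m $ i * f \<theta>))
        = ?c $ i * (E (\<lambda>\<theta>. f \<theta> * (x i \<theta> * v i \<theta>)) - ?m $ i * E f)"
      by (simp only: E_cmult)
  qed
  also have "\<dots> = ?c \<bullet> ((\<chi> i. E (\<lambda>\<theta>. f \<theta> * (x i \<theta> * v i \<theta>))) - E f *\<^sub>R ?m)"
    unfolding inner_vec_def by (rule sum.cong[OF refl]) (simp add: mult.commute)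
  also have "\<dots> = ?m \<bullet> (?X *v ((\<chi> i. E (\<lambda>\<theta>. f \<theta> * (x i \<theta> * v i \<theta>))) - E f *\<^sub>R ?m))"
    by (rule dot_lmul_matrix)
  also have "E (\<lambda>\<theta>. f \<theta> * p \<theta>) = E (\<lambda>\<theta>. f \<theta> * max_bid v \<beta> \<theta>)"
  proof (rule E_cong)
    show "AE \<theta> in M. f \<theta> * p \<theta> = f \<theta> * max_bid v \<beta> \<theta>" using p by eventually_elim simp
  qed (use f in \<open>auto dest: ess_bounded_measurable\<close>)
  finally show "E (\<lambda>\<theta>. f \<theta> * D_REV M b v s \<beta> p x \<theta>) =
      E (\<lambda>\<theta>. f \<theta> * max_bid v \<beta> \<theta>) - F \<beta> * E f
      - ?m \<bullet> (?X *v ((\<chi> i. E (\<lambda>\<theta>. f \<theta> * (x i \<theta> * v i \<theta>))) - E f *\<^sub>R ?m))"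
    by (simp only: E_cmult)
qed

lemma D_REV_mean_zero:
  assumes eq: "is_FPPE M b v s \<beta> p x"
  shows "E (D_REV M b v s \<beta> p x) = 0"
proof -
  have "(\<chi> i. E (\<lambda>\<theta>. 1 * (x i \<theta> * v i \<theta>))) = mean_utility M v s x"
    by (simp add: vec_eq_iff mean_utility_nth)
  moreover have "E (\<lambda>\<theta>. 1 * max_bid v \<beta> \<theta>) = F \<beta>" by (simp add: mean_max_bid_def)
  ultimately show ?thesis
    using D_REV_bounded_and_pairing(2)[OF eq ess_bounded_const[of M 1]] by (simp add: E_const)
qed

lemma leftover_pacing_one:
  assumes eq: "is_FPPE M b v s \<beta> p x" and one: "\<beta> $ i = 1"
  shows "leftover M b s p x i = b $ i - mean_utility M v s x $ i"
  using spend_eq[OF eq, of i] one by (simp add: leftover_def spend_def mult_ac)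

end

text \<open>
Let \<open>B \<alpha>\<close> be the equilibrium multipliers under the tilt \<open>\<alpha>\<close>. By strict complementary slackness,
multipliers equal to 1 stay equal to 1 for small tilts, so only inactive coordinates move, and for these the
budget equations hold: the dual gradient at \<open>B \<alpha>\<close> equals minus \<open>\<alpha>\<close> times the score-weighted utilities. Linearizing
the dual gradient and inverting the compressed Hessian gives the velocity of \<open>B\<close> at 0. The revenue is
the tilted mean maximal bid at \<open>B \<alpha>\<close>, so its derivative consists of this velocity paired with the mean
utilities and of the score-weighted maximal bid.
\<close>

theorem (in tilted_market) revenue_pathwise_derivative:
  assumes eq: "is_FPPE M b v s \<beta> p x" and smo: "SMO M v s \<beta>" and scs: "SCS M b s \<beta> p x"
  shows "((\<lambda>\<alpha>. FPPE_revenue M b v (T \<alpha>)) has_real_derivative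
      E (\<lambda>\<theta>. g \<theta> * D_REV M b v s \<beta> p x \<theta>)) (at 0)"
proof -
  obtain U where U: "open U" "\<beta> \<in> U" "\<And>y. y \<in> U \<Longrightarrow> F differentiable (at y)"
      "gradient F differentiable (at \<beta>)"
    using smo by (auto simp: SMO_def C2_near_def)
  let ?m0 = "mean_utility M v s x" and ?u0 = "score_utility x"
  let ?Hs = "hessian (dual_objective M b v s) \<beta>" and ?P = "inactive_proj \<beta>"
  let ?A = "H_B M b v s \<beta>"
  note pos = is_FPPE_pos[OF eq] and le1 = is_FPPE_le_one[OF eq]
  have x: "winning_allocation M v \<beta> x" using eq by (rule is_FPPE_winning_allocation)
  obtain \<alpha>0 C where \<alpha>0: "0 < \<alpha>0" "0 < C" "\<alpha>0 \<le> 1 / (2 * K)"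
    and ex: "\<And>\<alpha>. \<bar>\<alpha>\<bar> \<le> \<alpha>0 \<Longrightarrow> \<exists>y z. is_FPPE M b v (T \<alpha>) y (max_bid v y) z \<and> norm (y - \<beta>) \<le> C * \<bar>\<alpha>\<bar>"
    using tilted_FPPE_exists[OF eq U(1-3)] by blast
  from ex obtain B X where BX: "\<And>\<alpha>. \<bar>\<alpha>\<bar> \<le> \<alpha>0 \<Longrightarrow> is_FPPE M b v (T \<alpha>) (B \<alpha>) (max_bid v (B \<alpha>)) (X \<alpha>)"
    and BC: "\<And>\<alpha>. \<bar>\<alpha>\<bar> \<le> \<alpha>0 \<Longrightarrow> norm (B \<alpha> - \<beta>) \<le> C * \<bar>\<alpha>\<bar>" by metis
  have ev: "\<forall>\<^sub>F \<alpha> in at 0. \<bar>\<alpha>\<bar> \<le> \<alpha>0"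
    unfolding eventually_at by (rule exI[of _ \<alpha>0]) (use \<alpha>0 in \<open>auto simp: dist_norm\<close>)
  have ev0: "\<forall>\<^sub>F \<alpha> in at (0::real). \<alpha> \<noteq> 0" by (simp add: eventually_at_filter)
  have evC: "\<forall>\<^sub>F \<alpha> in at 0. norm (B \<alpha> - \<beta>) \<le> C * \<bar>\<alpha>\<bar>" using ev by eventually_elim (rule BC)
  have Blim: "(B \<longlongrightarrow> \<beta>) (at 0)"
  proof (rule Lim_transform_bound[THEN LIM_zero_cancel])
    show "\<forall>\<^sub>F \<alpha> in at 0. norm (B \<alpha> - \<beta>) \<le> norm (C * \<alpha>)"
      using evC by eventually_elim (use \<alpha>0 in \<open>simp add: abs_mult\<close>)
    show "((\<lambda>\<alpha>. C * \<alpha>) \<longlongrightarrow> 0) (at 0)" by (auto intro!: tendsto_eq_intros)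
  qed
  let ?S = "{y :: real ^ 'n. \<forall>i. 0 < y $ i}"
  have S: "open ?S" "\<beta> \<in> ?S" using open_positive_orthant pos by auto
  have mkt: "market_env M b v (T \<alpha>)" if "\<bar>\<alpha>\<bar> \<le> \<alpha>0" for \<alpha>
    using that \<alpha>0 by unfold_locales (auto intro!: market_tilted)
  have wa: "winning_allocation M v (B \<alpha>) (X \<alpha>)" if "\<bar>\<alpha>\<bar> \<le> \<alpha>0" for \<alpha>
    using BX[OF that] by (rule is_FPPE_winning_allocation)
  have Bpos: "0 < B \<alpha> $ i" and Ble: "B \<alpha> $ i \<le> 1" if "\<bar>\<alpha>\<bar> \<le> \<alpha>0" for \<alpha> i
    using market_env.is_FPPE_pos[OF mkt BX] market_env.is_FPPE_le_one[OF mkt BX] that by auto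

  have mlim_gen: "((\<lambda>\<alpha>. mean_utility M v (T a) (X \<alpha>)) \<longlongrightarrow> mean_utility M v (T a) x) (at 0)"
    if a: "\<bar>a\<bar> \<le> \<alpha>0" for a
  proof (rule subgradients_tendsto[OF _ S Blim])
    interpret t: market_env M b v "T a" using a by (rule mkt)
    show "(mean_max_bid M v (T a) has_derivative (\<lambda>u. mean_utility M v (T a) x \<bullet> u)) (at \<beta>)"
      using a \<alpha>0 U by (intro tilted_has_gradient pos x) auto
    show "\<forall>\<^sub>F \<alpha> in at 0. \<forall>z\<in>?S. mean_max_bid M v (T a) (B \<alpha>) + mean_utility M v (T a) (X \<alpha>) \<bullet> (z - B \<alpha>)
        \<le> mean_max_bid M v (T a) z"
      using ev
    proof eventually_elim
      case (elim \<alpha>)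
      show ?case
        using t.winning_allocation_value[OF wa[OF elim]] t.winning_allocation_subgradient[OF wa[OF elim]]
          Bpos[OF elim] by (auto simp: inner_diff_right less_imp_le)
    qed
  qed
  have mlim: "((\<lambda>\<alpha>. mean_utility M v s (X \<alpha>)) \<longlongrightarrow> ?m0) (at 0)"
    using mlim_gen[of 0] \<alpha>0 by (simp add: tilted_supply_0)
  \<comment> \<open>The score-weighted utilities are a difference quotient in the tilt parameter between two tilts that are kept fixed.\<close>
  have utility_lim: "((\<lambda>\<alpha>. score_utility (X \<alpha>)) \<longlongrightarrow> ?u0) (at 0)"
  proof -
    have "((\<lambda>\<alpha>. (1 / \<alpha>0) *\<^sub>R (mean_utility M v (T \<alpha>0) (X \<alpha>) - mean_utility M v s (X \<alpha>)))
        \<longlongrightarrow> (1 / \<alpha>0) *\<^sub>R (mean_utility M v (T \<alpha>0) x - ?m0)) (at 0)"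
      using \<alpha>0 by (intro tendsto_intros mlim mlim_gen) auto
    moreover have "(1 / \<alpha>0) *\<^sub>R (mean_utility M v (T \<alpha>0) x - ?m0) = ?u0"
      using \<alpha>0 by (simp add: mean_utility_tilted[OF x])
    moreover have "\<forall>\<^sub>F \<alpha> in at 0. (1 / \<alpha>0) *\<^sub>R (mean_utility M v (T \<alpha>0) (X \<alpha>) - mean_utility M v s (X \<alpha>)) = score_utility (X \<alpha>)"
      using ev by eventually_elim (use \<alpha>0 in \<open>simp add: mean_utility_tilted[OF wa]\<close>)
    ultimately show ?thesis by (auto intro: Lim_transform_eventually)
  qed
  define m' where "m' \<alpha> = mean_utility M v (T \<alpha>) (X \<alpha>)" for \<alpha>
  have m': "m' \<alpha> = mean_utility M v s (X \<alpha>) + \<alpha> *\<^sub>R score_utility (X \<alpha>)" if "\<bar>\<alpha>\<bar> \<le> \<alpha>0" for \<alpha>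
    unfolding m'_def by (rule mean_utility_tilted[OF wa[OF that]])
  have m'lim: "(m' \<longlongrightarrow> ?m0) (at 0)"
  proof -
    have "((\<lambda>\<alpha>. mean_utility M v s (X \<alpha>) + \<alpha> *\<^sub>R score_utility (X \<alpha>)) \<longlongrightarrow> ?m0 + 0 *\<^sub>R ?u0) (at 0)"
      by (intro tendsto_intros mlim utility_lim)
    moreover have "\<forall>\<^sub>F \<alpha> in at 0. mean_utility M v s (X \<alpha>) + \<alpha> *\<^sub>R score_utility (X \<alpha>) = m' \<alpha>"
      using ev by eventually_elim (simp add: m')
    ultimately show ?thesis by (auto intro: Lim_transform_eventually)
  qed
  have spendB: "B \<alpha> $ i * m' \<alpha> $ i \<le> b $ i" "B \<alpha> $ i * m' \<alpha> $ i < b $ i \<Longrightarrow> B \<alpha> $ i = 1"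
    if "\<bar>\<alpha>\<bar> \<le> \<alpha>0" for \<alpha> i
    using is_FPPE_budget[OF BX[OF that], of i] is_FPPE_slack[OF BX[OF that], of i]
    unfolding market_env.spend_eq[OF mkt[OF that] BX[OF that]] m'_def by auto

  \<comment> \<open>Strict complementary slackness leaves a margin in the budget, which persists by continuity.\<close>
  have active: "\<forall>\<^sub>F \<alpha> in at 0. \<forall>i. \<beta> $ i = 1 \<longrightarrow> B \<alpha> $ i = 1"
  proof (rule eventually_all_finite, cases)
    fix i assume one: "\<beta> $ i = 1"
    have "0 < leftover M b s p x i" using scs one by (auto simp: SCS_def)
    then have "\<beta> $ i * ?m0 $ i < b $ i" using leftover_pacing_one[OF eq one] one by simp
    moreover have "((\<lambda>\<alpha>. B \<alpha> $ i * m' \<alpha> $ i) \<longlongrightarrow> \<beta> $ i * ?m0 $ i) (at 0)"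
      by (intro tendsto_intros Blim m'lim)
    ultimately have "\<forall>\<^sub>F \<alpha> in at 0. B \<alpha> $ i * m' \<alpha> $ i < b $ i" by (rule order_tendstoD(2)[rotated])
    with ev show "\<forall>\<^sub>F \<alpha> in at 0. \<beta> $ i = 1 \<longrightarrow> B \<alpha> $ i = 1"
      by eventually_elim (simp add: spendB)
  qed simp
  have inactive: "\<forall>\<^sub>F \<alpha> in at 0. \<forall>i. \<beta> $ i < 1 \<longrightarrow> B \<alpha> $ i * m' \<alpha> $ i = b $ i"
  proof (rule eventually_all_finite, cases)
    fix i assume lt: "\<beta> $ i < 1"
    have "((\<lambda>\<alpha>. B \<alpha> $ i) \<longlongrightarrow> \<beta> $ i) (at 0)" by (intro tendsto_intros Blim)
    then have "\<forall>\<^sub>F \<alpha> in at 0. B \<alpha> $ i < 1" using lt by (rule order_tendstoD(2))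
    with ev show "\<forall>\<^sub>F \<alpha> in at 0. \<beta> $ i < 1 \<longrightarrow> B \<alpha> $ i * m' \<alpha> $ i = b $ i"
    proof eventually_elim
      case (elim \<alpha>)
      then show ?case using spendB[OF elim(1), of i] by fastforce
    qed
  qed simp
  define d where "d \<alpha> = B \<alpha> - \<beta>" for \<alpha>
  have Pd: "\<forall>\<^sub>F \<alpha> in at 0. ?P *v d \<alpha> = d \<alpha>"
    using active by eventually_elim
      (auto simp: vec_eq_iff inactive_proj_nth d_def le1 dest: antisym[OF le1] simp flip: not_le)
  have inactive0: "\<beta> $ i * ?m0 $ i = b $ i" if "\<beta> $ i < 1" for i
    using is_FPPE_budget[OF eq, of i] is_FPPE_slack[OF eq, of i] that spend_eq[OF eq, of i] by fastforce
  have grad: "gradient F (B \<alpha>) = mean_utility M v s (X \<alpha>)" if "\<bar>\<alpha>\<bar> \<le> \<alpha>0" "B \<alpha> \<in> U" for \<alpha>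
    using that by (intro gradient_mean_max_bid U wa Bpos) auto
  have grad0: "gradient F \<beta> = ?m0" using U by (intro gradient_mean_max_bid pos x) auto
  have evU: "\<forall>\<^sub>F \<alpha> in at 0. B \<alpha> \<in> U" using Blim U(1,2) by (rule topological_tendstoD)
  \<comment> \<open>First-order conditions on inactive coordinates; the projection removes the others.\<close>
  have foc: "\<forall>\<^sub>F \<alpha> in at 0. ?P *v (dual_gradient (B \<alpha>) - dual_gradient \<beta>) = - \<alpha> *\<^sub>R (?P *v score_utility (X \<alpha>))"
    using ev evU inactive
  proof eventually_elim
    case (elim \<alpha>)
    show ?case unfolding vec_eq_iff
    proof
      fix i
      show "(?P *v (dual_gradient (B \<alpha>) - dual_gradient \<beta>)) $ i = (- \<alpha> *\<^sub>R (?P *v score_utility (X \<alpha>))) $ i"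
      proof (cases "\<beta> $ i < 1")
        case True
        have "m' \<alpha> $ i = b $ i / B \<alpha> $ i" "?m0 $ i = b $ i / \<beta> $ i"
          using elim(3) True inactive0[OF True] Bpos[OF elim(1), of i] pos[of i] by (auto simp: field_simps)
        then show ?thesis
          using True m'[OF elim(1)]
          by (simp add: inactive_proj_nth dual_gradient_def grad[OF elim(1,2)] grad0)
      qed (simp add: inactive_proj_nth)
    qed
  qed
  define rem where "rem \<alpha> = (1 / \<alpha>) *\<^sub>R (dual_gradient (B \<alpha>) - dual_gradient \<beta> - ?Hs *v (B \<alpha> - \<beta>))" for \<alpha>
  have rem: "(rem \<longlongrightarrow> 0) (at 0)"
    unfolding rem_def by (rule has_derivative_little_o[OF dual_gradient_has_derivative[OF pos U] evC])
  note comp = pinv_compression[OF transpose_inactive_proj inactive_proj_idem hessian_pos[OF eq U]]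
  have XA: "pinv ?A ** ?A = ?P" unfolding H_B_def by (rule comp(1))
  have XP: "pinv ?A ** ?P = pinv ?A" unfolding H_B_def by (rule comp(2))
  have "\<forall>\<^sub>F \<alpha> in at 0. - (pinv ?A *v (score_utility (X \<alpha>) + rem \<alpha>)) = (1 / \<alpha>) *\<^sub>R d \<alpha>"
    using ev0 Pd foc
  proof eventually_elim
    case (elim \<alpha>)
    have XPv: "pinv ?A *v (?P *v y) = pinv ?A *v y" for y by (simp add: matrix_vector_mul_assoc XP)
    have "?Hs *v d \<alpha> = (dual_gradient (B \<alpha>) - dual_gradient \<beta>) - \<alpha> *\<^sub>R rem \<alpha>"
      using elim(1) by (simp add: rem_def d_def)
    then have "?P *v (?Hs *v d \<alpha>) = - \<alpha> *\<^sub>R (?P *v score_utility (X \<alpha>)) - \<alpha> *\<^sub>R (?P *v rem \<alpha>)"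
      using elim(3) by (simp add: matrix_vector_mult_diff_distrib matrix_vector_mult_scaleR)
    moreover have "?A *v d \<alpha> = ?P *v (?Hs *v d \<alpha>)"
      unfolding H_B_def by (simp add: elim(2) flip: matrix_vector_mul_assoc)
    moreover have "pinv ?A *v (- y) = - (pinv ?A *v y)" for y by (rule linear_neg[OF matrix_vector_mul_linear])
    ultimately have "pinv ?A *v (?A *v d \<alpha>)
        = - \<alpha> *\<^sub>R (pinv ?A *v score_utility (X \<alpha>)) - \<alpha> *\<^sub>R (pinv ?A *v rem \<alpha>)"
      by (simp add: matrix_vector_mult_diff_distrib matrix_vector_mult_scaleR XPv)
    moreover have "pinv ?A *v (?A *v d \<alpha>) = d \<alpha>"
      by (simp add: matrix_vector_mul_assoc XA elim(2))
    ultimately have "d \<alpha> = - (\<alpha> *\<^sub>R (pinv ?A *v (score_utility (X \<alpha>) + rem \<alpha>)))"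
      by (simp add: matrix_vector_right_distrib scaleR_add_right)
    then show ?case using elim(1) by simp
  qed
  moreover have "((\<lambda>\<alpha>. - (pinv ?A *v (score_utility (X \<alpha>) + rem \<alpha>))) \<longlongrightarrow> - (pinv ?A *v (?u0 + 0))) (at 0)"
    by (intro tendsto_minus bounded_linear.tendsto[OF matrix_vector_mul_bounded_linear] tendsto_add utility_lim rem)
  ultimately have elim: "((\<lambda>\<alpha>. (1 / \<alpha>) *\<^sub>R d \<alpha>) \<longlongrightarrow> - (pinv ?A *v ?u0)) (at 0)"
    by (auto intro: Lim_transform_eventually)

  \<comment> \<open>The revenue is the tilted mean maximal bid at B \<alpha>: a part from moving B and a part from the tilt itself.\<close>
  have FD: "(F has_derivative (\<lambda>u. ?m0 \<bullet> u)) (at \<beta>)"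
    using tilted_has_gradient[of 0, OF _ pos U(3)[OF U(2)] x] K_pos by (simp add: tilted_supply_0)
  have Frem: "((\<lambda>\<alpha>. (1 / \<alpha>) *\<^sub>R (F (B \<alpha>) - F \<beta> - ?m0 \<bullet> (B \<alpha> - \<beta>))) \<longlongrightarrow> 0) (at 0)"
    by (rule has_derivative_little_o[OF FD evC])
  obtain Ck where Ck: "0 < Ck" "\<And>y z. \<bar>score_bid y - score_bid z\<bar> \<le> Ck * norm (y - z)" using score_bid_Lipschitz by blast
  have bid_lim: "((\<lambda>\<alpha>. score_bid (B \<alpha>)) \<longlongrightarrow> score_bid \<beta>) (at 0)"
  proof (rule Lim_transform_bound[THEN LIM_zero_cancel])
    show "\<forall>\<^sub>F \<alpha> in at 0. norm (score_bid (B \<alpha>) - score_bid \<beta>) \<le> norm (Ck * norm (B \<alpha> - \<beta>))"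
      using Ck by (simp add: abs_mult)
    have "((\<lambda>\<alpha>. Ck * norm (B \<alpha> - \<beta>)) \<longlongrightarrow> Ck * norm (\<beta> - \<beta>)) (at 0)"
      by (intro tendsto_intros Blim)
    then show "((\<lambda>\<alpha>. Ck * norm (B \<alpha> - \<beta>)) \<longlongrightarrow> 0) (at 0)" by simp
  qed
  have lim: "((\<lambda>\<alpha>. (1 / \<alpha>) *\<^sub>R (F (B \<alpha>) - F \<beta> - ?m0 \<bullet> (B \<alpha> - \<beta>)) + ?m0 \<bullet> ((1 / \<alpha>) *\<^sub>R d \<alpha>) + score_bid (B \<alpha>))
      \<longlongrightarrow> 0 + ?m0 \<bullet> (- (pinv ?A *v ?u0)) + score_bid \<beta>) (at 0)"
    by (intro tendsto_add tendsto_inner tendsto_const Frem elim bid_lim)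
  have quot: "\<forall>\<^sub>F \<alpha> in at 0. (1 / \<alpha>) *\<^sub>R (F (B \<alpha>) - F \<beta> - ?m0 \<bullet> (B \<alpha> - \<beta>)) + ?m0 \<bullet> ((1 / \<alpha>) *\<^sub>R d \<alpha>) + score_bid (B \<alpha>)
      = (FPPE_revenue M b v (T \<alpha>) - FPPE_revenue M b v (T 0)) / (\<alpha> - 0)"
    using ev ev0
  proof eventually_elim
    case (elim \<alpha>)
    have "FPPE_revenue M b v (T \<alpha>) = F (B \<alpha>) + \<alpha> * score_bid (B \<alpha>)"
      using market_env.FPPE_revenue_eq(1)[OF mkt BX] elim by (simp add: mean_max_bid_tilted)
    moreover have "FPPE_revenue M b v (T 0) = F \<beta>"
      using FPPE_revenue_eq(1)[OF eq] by (simp add: tilted_supply_0)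
    ultimately show ?case using elim(2) by (simp add: d_def field_simps inner_diff_right)
  qed
  have "E (\<lambda>\<theta>. g \<theta> * D_REV M b v s \<beta> p x \<theta>) = 0 + ?m0 \<bullet> (- (pinv ?A *v ?u0)) + score_bid \<beta>"
    using D_REV_bounded_and_pairing(2)[OF eq g_bounded] g_mean by (simp add: score_bid_def score_utility_def)
  with Lim_transform_eventually[OF lim quot] show ?thesis
    by (simp add: has_field_derivative_iff)
qed

section \<open>Windows of normal laws\<close>

text \<open>
Third-order Taylor bound: the derivative of the difference is \<open>t\<^sup>2 / (1 + t)\<close>, which lies between 0 and \<open>3 * t\<^sup>2\<close> for \<open>t \<ge> - 1 / 2\<close>.
\<close>

lemma ln_cubic_bound:
  fixes x :: real
  assumes "\<bar>x\<bar> \<le> 1 / 2"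
  shows "\<bar>ln (1 + x) - (x - x\<^sup>2 / 2)\<bar> \<le> \<bar>x\<bar> ^ 3"
proof -
  define f where "f t = ln (1 + t) - (t - t\<^sup>2 / 2)" for t :: real
  have d: "(f has_real_derivative t\<^sup>2 / (1 + t)) (at t)" if "- 1 / 2 \<le> t" for t
    unfolding f_def using that
    by (auto intro!: derivative_eq_intros simp: field_simps power2_eq_square)
  have inc: "f a \<le> f c" if "- 1 / 2 \<le> a" "a \<le> c" for a c
  proof (rule DERIV_nonneg_imp_nondecreasing[OF that(2)])
    fix t assume "a \<le> t" "t \<le> c"
    then show "\<exists>D. (f has_real_derivative D) (at t) \<and> 0 \<le> D"
      using d[of t] that by (intro exI[of _ "t\<^sup>2 / (1 + t)"]) auto
  qed
  have dec: "f c - c ^ 3 \<le> f a - a ^ 3" if "- 1 / 2 \<le> a" "a \<le> c" for a c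
  proof (rule DERIV_nonpos_imp_nonincreasing[OF that(2)])
    fix t assume "a \<le> t" "t \<le> c"
    then have t: "- 1 / 2 \<le> t" using that by simp
    have "t\<^sup>2 / (1 + t) \<le> t\<^sup>2 / (1 / 2)" using t by (intro divide_left_mono) auto
    also have "\<dots> \<le> 3 * t\<^sup>2" by simp
    finally have "t\<^sup>2 / (1 + t) - 3 * t\<^sup>2 \<le> 0" by simp
    moreover have "((\<lambda>t. f t - t ^ 3) has_real_derivative t\<^sup>2 / (1 + t) - 3 * t\<^sup>2) (at t)"
      by (auto intro!: derivative_eq_intros d[OF t])
    ultimately show "\<exists>D. ((\<lambda>t. f t - t ^ 3) has_real_derivative D) (at t) \<and> D \<le> 0" by blast
  qed
  have f0: "f 0 = 0" by (simp add: f_def)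
  have "\<bar>f x\<bar> \<le> \<bar>x\<bar> ^ 3"
  proof (cases "0 \<le> x")
    case True
    then show ?thesis using inc[of 0 x] dec[of 0 x] f0 by simp
  next
    case False
    then have "\<bar>x\<bar> ^ 3 = - (x ^ 3)" by simp
    then show ?thesis using inc[of x 0] dec[of x 0] f0 False assms by simp
  qed
  then show ?thesis by (simp add: f_def)
qed

text \<open>
Real-valued, so that quotients and limits of such masses can be formed.
\<close>

definition central_mass :: "real \<Rightarrow> real" where
  "central_mass z = measure (density lborel std_normal_density) {- z..z}"

lemma emeasure_central: "emeasure (density lborel std_normal_density) {- z..z} = ennreal (central_mass z)"
proof -
  interpret prob_space "density lborel std_normal_density" by (rule prob_space_normal_density) simp
  show ?thesis by (simp add: central_mass_def emeasure_eq_measure)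
qed

lemma central_mass_nonneg: "0 \<le> central_mass z"
  by (simp add: central_mass_def)

lemma central_mass_tendsto_1:
  assumes "0 < \<sigma>"
  shows "(\<lambda>n. central_mass (real n * \<sigma>)) \<longlonglongrightarrow> 1"
proof -
  interpret prob_space "density lborel std_normal_density" by (rule prob_space_normal_density) simp
  have "(\<lambda>n. prob {- (real n * \<sigma>)..real n * \<sigma>}) \<longlonglongrightarrow> prob (\<Union>n. {- (real n * \<sigma>)..real n * \<sigma>})"
  proof (rule finite_Lim_measure_incseq)
    show "incseq (\<lambda>n. {- (real n * \<sigma>)..real n * \<sigma>})"
    proof (rule incseq_SucI, rule subsetI)
      fix n z assume "z \<in> {- (real n * \<sigma>)..real n * \<sigma>}"
      moreover have "real n * \<sigma> \<le> real (Suc n) * \<sigma>" using assms by (intro mult_right_mono) auto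
      ultimately show "z \<in> {- (real (Suc n) * \<sigma>)..real (Suc n) * \<sigma>}" by auto
    qed
  qed auto
  moreover have "(\<Union>n. {- (real n * \<sigma>)..real n * \<sigma>}) = UNIV"
  proof -
    have "\<exists>n. z \<in> {- (real n * \<sigma>)..real n * \<sigma>}" for z
    proof -
      obtain n where "\<bar>z\<bar> / \<sigma> \<le> real n" using real_arch_simple by blast
      then have "\<bar>z\<bar> \<le> real n * \<sigma>" using assms by (simp add: field_simps)
      then show ?thesis by (intro exI[of _ n]) auto
    qed
    then show ?thesis by blast
  qed
  moreover have "prob UNIV = 1" using prob_space by simp
  ultimately show ?thesis by (simp add: central_mass_def)
qed

lemma central_mass_pos: assumes "0 < z" shows "0 < central_mass z"
proof -
  have "emeasure (density lborel std_normal_density) {- z..z} \<noteq> 0"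
  proof
    assume "emeasure (density lborel std_normal_density) {- z..z} = 0"
    then have "{- z..z} \<in> null_sets (density lborel std_normal_density)" by auto
    then have "AE x in lborel. x \<in> {- z..z} \<longrightarrow> ennreal (std_normal_density x) = 0"
      by (simp add: null_sets_density_iff)
    then have "AE x in lborel. x \<notin> {- z..z}"
    proof eventually_elim
      case (elim x)
      have "0 < std_normal_density x" by (rule normal_density_pos) simp
      then show ?case using elim by (metis ennreal_eq_0_iff not_le)
    qed
    then have "{- z..z} \<in> null_sets lborel" by (subst AE_iff_null_sets) auto
    then have "emeasure lborel {- z..z} = 0" by auto
    then show False using assms by simp
  qed
  then show ?thesis using central_mass_nonneg[of z] by (auto simp: emeasure_central)
qed

lemma normal_centered_window:
  assumes "0 < \<tau>"
  shows "emeasure (density lborel (normal_density m \<tau>)) {m - A..m + A} = ennreal (central_mass (A / \<tau>))"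
proof -
  have "emeasure (density lborel (normal_density m \<tau>)) {m - A..m + A}
      = (\<integral>\<^sup>+ h. ennreal (normal_density m \<tau> h) * indicator {m - A..m + A} h \<partial>lborel)"
    by (simp add: emeasure_density)
  also have "\<dots> = ennreal \<bar>\<tau>\<bar> * (\<integral>\<^sup>+ z. ennreal (normal_density m \<tau> (m + \<tau> * z)) * indicator {m - A..m + A} (m + \<tau> * z) \<partial>lborel)"
    using assms by (intro nn_integral_real_affine) auto
  also have "\<dots> = (\<integral>\<^sup>+ z. ennreal \<tau> * (ennreal (normal_density m \<tau> (m + \<tau> * z)) * indicator {m - A..m + A} (m + \<tau> * z)) \<partial>lborel)"
    using assms by (subst nn_integral_cmult) auto
  also have "\<dots> = (\<integral>\<^sup>+ z. ennreal (std_normal_density z) * indicator {- (A / \<tau>)..A / \<tau>} z \<partial>lborel)"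
  proof (rule nn_integral_cong)
    fix z
    have "\<tau> * normal_density m \<tau> (m + \<tau> * z) = std_normal_density z"
      using assms by (simp add: normal_density_def real_sqrt_mult power_mult_distrib)
    then have "ennreal \<tau> * ennreal (normal_density m \<tau> (m + \<tau> * z)) = ennreal (std_normal_density z)"
      using assms by (simp add: ennreal_mult[symmetric])
    moreover have "m + \<tau> * z \<in> {m - A..m + A} \<longleftrightarrow> z \<in> {- (A / \<tau>)..A / \<tau>}"
      using assms by (auto simp: field_simps)
    ultimately show "ennreal \<tau> * (ennreal (normal_density m \<tau> (m + \<tau> * z)) * indicator {m - A..m + A} (m + \<tau> * z))
        = ennreal (std_normal_density z) * indicator {- (A / \<tau>)..A / \<tau>} z"
      by (auto simp: indicator_def)
  qed
  also have "\<dots> = emeasure (density lborel std_normal_density) {- (A / \<tau>)..A / \<tau>}"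
    by (simp add: emeasure_density)
  finally show ?thesis by (simp add: emeasure_central)
qed

lemma normal_density_antimono:
  assumes "0 < \<tau>" "\<bar>x - m\<bar> \<le> \<bar>y - m\<bar>"
  shows "normal_density m \<tau> y \<le> normal_density m \<tau> x"
proof -
  have "(x - m)\<^sup>2 \<le> (y - m)\<^sup>2" using assms(2) by (simp add: abs_le_square_iff)
  then show ?thesis using assms(1) unfolding normal_density_def
    by (intro mult_left_mono) (auto simp: divide_right_mono)
qed

text \<open>
The centred window \<open>?S\<close> and the window \<open>?W\<close> have the same length, so their differences do too. The
density is at least its value \<open>n0\<close> at the edge on \<open>?S - ?W\<close>, and at most \<open>n0\<close> on \<open>?W - ?S\<close>.
\<close>

lemma normal_window_le:
  assumes \<tau>: "0 < \<tau>" and A: "0 \<le> A"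
  shows "emeasure (density lborel (normal_density m \<tau>)) {c - A..c + A} \<le> ennreal (central_mass (A / \<tau>))"
proof -
  let ?N = "density lborel (normal_density m \<tau>)"
  let ?W = "{c - A..c + A}" and ?S = "{m - A..m + A}"
  define n0 where "n0 = normal_density m \<tau> (m + A)"
  have split: "emeasure ?N X = emeasure ?N (X \<inter> Y) + emeasure ?N (X - Y)"
    if "X \<in> sets borel" "Y \<in> sets borel" for X Y :: "real set"
    using that by (subst plus_emeasure) (auto intro!: arg_cong[where f="emeasure ?N"])
  have "emeasure ?N (?W - ?S) = (\<integral>\<^sup>+ h. ennreal (normal_density m \<tau> h) * indicator (?W - ?S) h \<partial>lborel)"
    by (simp add: emeasure_density)
  also have "\<dots> \<le> (\<integral>\<^sup>+ h. ennreal n0 * indicator (?W - ?S) h \<partial>lborel)"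
    unfolding n0_def using \<tau> A
    by (intro nn_integral_mono) (auto simp: indicator_def intro!: ennreal_leI normal_density_antimono)
  also have "\<dots> = ennreal n0 * emeasure lborel (?W - ?S)" by (simp add: nn_integral_cmult_indicator)
  also have "emeasure lborel (?W - ?S) = emeasure lborel (?S - ?W)"
  proof -
    have "?W - ?S = ?W - (?W \<inter> ?S)" "?S - ?W = ?S - (?W \<inter> ?S)" by auto
    moreover have "emeasure lborel (?W - (?W \<inter> ?S)) = emeasure lborel ?W - emeasure lborel (?W \<inter> ?S)"
      by (rule emeasure_Diff) (auto simp: Int_atLeastAtMost emeasure_lborel_Icc_eq)
    moreover have "emeasure lborel (?S - (?W \<inter> ?S)) = emeasure lborel ?S - emeasure lborel (?W \<inter> ?S)"
      by (rule emeasure_Diff) (auto simp: Int_atLeastAtMost emeasure_lborel_Icc_eq)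
    moreover have "emeasure lborel ?W = emeasure lborel ?S" using A by simp
    ultimately show ?thesis by metis
  qed
  also have "ennreal n0 * emeasure lborel (?S - ?W) = (\<integral>\<^sup>+ h. ennreal n0 * indicator (?S - ?W) h \<partial>lborel)"
    by (simp add: nn_integral_cmult_indicator)
  also have "\<dots> \<le> (\<integral>\<^sup>+ h. ennreal (normal_density m \<tau> h) * indicator (?S - ?W) h \<partial>lborel)"
    unfolding n0_def using \<tau> A
    by (intro nn_integral_mono) (auto simp: indicator_def intro!: ennreal_leI normal_density_antimono)
  also have "\<dots> = emeasure ?N (?S - ?W)" by (simp add: emeasure_density)
  finally have "emeasure ?N (?W - ?S) \<le> emeasure ?N (?S - ?W)" .
  then have "emeasure ?N ?W \<le> emeasure ?N ?S"
    using split[of ?W ?S] split[of ?S ?W] by (simp add: Int_commute add_left_mono)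
  then show ?thesis using normal_centered_window[OF \<tau>] by simp
qed

section \<open>Samples from a product law\<close>

lemma iid_Hoeffding:
  fixes f :: "'a \<Rightarrow> real"
  assumes Q: "prob_space Q" and f[measurable]: "f \<in> borel_measurable Q"
    and bd: "\<And>\<theta>. \<bar>f \<theta>\<bar> \<le> B" and B: "0 < B" and t: "0 < t" and \<epsilon>: "0 \<le> \<epsilon>"
  shows "measure (PiM {..<t::nat} (\<lambda>_. Q))
      {\<omega> \<in> space (PiM {..<t} (\<lambda>_. Q)). \<epsilon> \<le> \<bar>(\<Sum>i<t. f (\<omega> i)) - real t * (\<integral>\<theta>. f \<theta> \<partial>Q)\<bar>}
    \<le> 2 * exp (- (\<epsilon>\<^sup>2 / (2 * real t * B\<^sup>2)))"
proof -
  let ?P = "PiM {..<t} (\<lambda>_. Q)"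
  interpret P: prob_space ?P by (rule prob_space_PiM) (rule Q)
  have comp: "distr ?P Q (\<lambda>\<omega>. \<omega> i) = Q" if "i < t" for i
    using distr_PiM_component[of "{..<t}" "\<lambda>_. Q" i] Q that by simp
  have "P.indep_vars (\<lambda>_. Q) (\<lambda>i \<omega>. \<omega> i) {..<t}"
  proof (subst P.indep_vars_iff_distr_eq_PiM')
    show "distr ?P ?P (\<lambda>x. \<lambda>i\<in>{..<t}. x i) = (\<Pi>\<^sub>M i\<in>{..<t}. distr ?P Q (\<lambda>\<omega>. \<omega> i))"
    proof -
      have "distr ?P ?P (\<lambda>x. \<lambda>i\<in>{..<t}. x i) = distr ?P ?P (\<lambda>x. x)"
        by (intro distr_cong refl) (auto simp: space_PiM PiE_def extensional_restrict)
      also have "\<dots> = ?P" by (rule distr_id2) simp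
      also have "\<dots> = (\<Pi>\<^sub>M i\<in>{..<t}. distr ?P Q (\<lambda>\<omega>. \<omega> i))"
        by (rule PiM_cong) (auto simp: comp)
      finally show ?thesis .
    qed
  qed (use t in auto)
  then have "P.indep_vars (\<lambda>_. borel) (\<lambda>i \<omega>. f (\<omega> i)) {..<t}"
    by (rule P.indep_vars_compose2) simp
  moreover have "f \<theta> \<in> {-B..B}" for \<theta> using bd[of \<theta>] by (simp add: abs_le_iff)
  ultimately interpret H: Hoeffding_ineq ?P "{..<t}" "\<lambda>i \<omega>. f (\<omega> i)" "\<lambda>_. - B" "\<lambda>_. B"
      "\<Sum>i<t. P.expectation (\<lambda>\<omega>. f (\<omega> i))"
    by unfold_locales auto
  have "P.expectation (\<lambda>\<omega>. f (\<omega> i)) = (\<integral>\<theta>. f \<theta> \<partial>Q)" if "i < t" for i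
  proof -
    have "(\<integral>\<theta>. f \<theta> \<partial>Q) = (\<integral>\<theta>. f \<theta> \<partial>distr ?P Q (\<lambda>\<omega>. \<omega> i))" using comp[OF that] by simp
    also have "\<dots> = P.expectation (\<lambda>\<omega>. f (\<omega> i))"
      using that by (intro integral_distr measurable_component_singleton) auto
    finally show ?thesis by simp
  qed
  then have mean: "(\<Sum>i<t. P.expectation (\<lambda>\<omega>. f (\<omega> i))) = real t * (\<integral>\<theta>. f \<theta> \<partial>Q)" by simp
  have "0 < (\<Sum>i<t. (B - - B)\<^sup>2)" using B t by simp
  from H.Hoeffding_ineq_abs_ge[OF \<epsilon> this] show ?thesis
    using B t by (simp add: mean field_simps power2_eq_square)
qed

text \<open>
Both sides agree on boxes, where the integral of the product factors.
\<close>

lemma PiM_density_prod: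
  fixes f :: "'a \<Rightarrow> ennreal"
  assumes P: "prob_space P" and f[measurable]: "f \<in> borel_measurable P"
    and Q: "prob_space (density P f)" and I: "finite I"
  shows "PiM I (\<lambda>_. density P f) = density (PiM I (\<lambda>_. P)) (\<lambda>\<omega>. \<Prod>i\<in>I. f (\<omega> i))"
proof -
  interpret P: product_prob_space "\<lambda>_. P" I using P by (simp add: product_prob_spaceI)
  interpret Q: product_prob_space "\<lambda>_. density P f" I using Q by (simp add: product_prob_spaceI)
  have [measurable]: "(\<lambda>\<omega>. \<Prod>i\<in>I. f (\<omega> i)) \<in> borel_measurable (PiM I (\<lambda>_. P))"
    by (intro borel_measurable_prod_ennreal measurable_compose[OF _ f] measurable_component_singleton)
  show ?thesis
  proof (rule Q.PiM_eqI[symmetric])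
    show "sets (density (PiM I (\<lambda>_. P)) (\<lambda>\<omega>. \<Prod>i\<in>I. f (\<omega> i))) = sets (PiM I (\<lambda>_. density P f))"
      by (simp cong: sets_PiM_cong)
    fix A assume "\<And>i. i \<in> I \<Longrightarrow> A i \<in> sets (density P f)"
    then have A: "A i \<in> sets P" if "i \<in> I" for i using that by simp
    then have "Pi\<^sub>E I A \<in> sets (PiM I (\<lambda>_. P))" using I by (intro sets_PiM_I_finite) auto
    then have "emeasure (density (PiM I (\<lambda>_. P)) (\<lambda>\<omega>. \<Prod>i\<in>I. f (\<omega> i))) (Pi\<^sub>E I A)
        = (\<integral>\<^sup>+ \<omega>. (\<Prod>i\<in>I. f (\<omega> i)) * indicator (Pi\<^sub>E I A) \<omega> \<partial>PiM I (\<lambda>_. P))"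
      by (simp add: emeasure_density)
    also have "\<dots> = (\<integral>\<^sup>+ \<omega>. (\<Prod>i\<in>I. f (\<omega> i) * indicator (A i) (\<omega> i)) \<partial>PiM I (\<lambda>_. P))"
    proof (rule nn_integral_cong)
      fix \<omega> assume "\<omega> \<in> space (PiM I (\<lambda>_. P))"
      then have ext: "\<omega> \<in> extensional I" by (simp add: space_PiM PiE_def)
      have "(indicator (Pi\<^sub>E I A) \<omega> :: ennreal) = (\<Prod>i\<in>I. indicator (A i) (\<omega> i))"
      proof (cases "\<omega> \<in> Pi\<^sub>E I A")
        case False
        then obtain i where "i \<in> I" "\<omega> i \<notin> A i" using ext by (auto simp: PiE_def Pi_def)
        then show ?thesis using False I by (auto simp: indicator_def intro!: prod_zero[symmetric])
      qed (auto simp: indicator_def PiE_def Pi_def)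
      then show "(\<Prod>i\<in>I. f (\<omega> i)) * indicator (Pi\<^sub>E I A) \<omega> = (\<Prod>i\<in>I. f (\<omega> i) * indicator (A i) (\<omega> i))"
        by (simp add: prod.distrib)
    qed
    also have "\<dots> = (\<Prod>i\<in>I. \<integral>\<^sup>+ \<theta>. f \<theta> * indicator (A i) \<theta> \<partial>P)"
      using A I by (intro P.product_nn_integral_prod) auto
    also have "\<dots> = (\<Prod>i\<in>I. emeasure (density P f) (A i))"
      using A by (intro prod.cong refl) (simp add: emeasure_density)
    finally show "emeasure (density (PiM I (\<lambda>_. P)) (\<lambda>\<omega>. \<Prod>i\<in>I. f (\<omega> i))) (Pi\<^sub>E I A)
        = (\<Prod>i\<in>I. emeasure (density P f) (A i))" .
  qed fact
qed

section \<open>Posterior mass of a window\<close>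

text \<open>
Completing the square.
\<close>

lemma gaussian_weight_eq_normal_density:
  assumes "0 < \<sigma>"
  shows "exp (h * D - h\<^sup>2 * \<sigma>\<^sup>2 / 2)
    = exp (D\<^sup>2 / (2 * \<sigma>\<^sup>2)) * sqrt (2 * pi) / \<sigma> * normal_density (D / \<sigma>\<^sup>2) (1 / \<sigma>) h"
proof -
  have 1: "normal_density (D / \<sigma>\<^sup>2) (1 / \<sigma>) h = \<sigma> / sqrt (2 * pi) * exp (- ((h - D / \<sigma>\<^sup>2)\<^sup>2 * \<sigma>\<^sup>2 / 2))"
    using assms by (simp add: normal_density_def power_divide real_sqrt_divide)
  have 2: "h * D - h\<^sup>2 * \<sigma>\<^sup>2 / 2 = D\<^sup>2 / (2 * \<sigma>\<^sup>2) + - ((h - D / \<sigma>\<^sup>2)\<^sup>2 * \<sigma>\<^sup>2 / 2)"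
    using assms by (simp add: field_simps power2_eq_square)
  show ?thesis unfolding 1 2 exp_add using assms by simp
qed

text \<open>
A weight \<open>W\<close> pays for closeness to the true parameter. The number \<open>\<omega>\<close> bounds what any guess can
earn when the parameter is normal with standard deviation \<open>\<tau>\<close>. For combinations of windows it can be
what the centre of the law earns, an instance of Anderson's inequality.
\<close>

definition anderson_weight :: "real \<Rightarrow> (real \<Rightarrow> real) \<Rightarrow> real \<Rightarrow> bool" where
  "anderson_weight \<tau> W \<omega> \<longleftrightarrow> W \<in> borel_measurable borel \<and> (\<forall>x. 0 \<le> W x) \<and> 0 \<le> \<omega> \<and>
     (\<forall>m c. (\<integral>\<^sup>+ h. ennreal (W (c - h)) * ennreal (normal_density m \<tau> h) \<partial>lborel) \<le> ennreal \<omega>)"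

lemma anderson_weight_windows:
  assumes \<tau>: "0 < \<tau>" and K: "finite K" and w: "\<And>k. k \<in> K \<Longrightarrow> 0 \<le> w k" and A: "\<And>k. k \<in> K \<Longrightarrow> 0 \<le> A k"
  shows "anderson_weight \<tau> (\<lambda>x. \<Sum>k\<in>K. w k * indicator {- A k..A k} x) (\<Sum>k\<in>K. w k * central_mass (A k / \<tau>))"
  unfolding anderson_weight_def
proof (intro conjI allI)
  show "0 \<le> (\<Sum>k\<in>K. w k * indicator {- A k..A k} x)" for x :: real
    using w by (intro sum_nonneg) auto
  show "0 \<le> (\<Sum>k\<in>K. w k * central_mass (A k / \<tau>))"
    using w central_mass_nonneg by (intro sum_nonneg mult_nonneg_nonneg) auto
  fix m c
  let ?N = "density lborel (normal_density m \<tau>)"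
  have "(\<integral>\<^sup>+ h. ennreal (\<Sum>k\<in>K. w k * indicator {- A k..A k} (c - h)) * ennreal (normal_density m \<tau> h) \<partial>lborel)
      = (\<integral>\<^sup>+ h. (\<Sum>k\<in>K. ennreal (w k) * (ennreal (normal_density m \<tau> h) * indicator {c - A k..c + A k} h)) \<partial>lborel)"
  proof (rule nn_integral_cong)
    fix h
    have "ennreal (\<Sum>k\<in>K. w k * indicator {- A k..A k} (c - h)) = (\<Sum>k\<in>K. ennreal (w k * indicator {- A k..A k} (c - h)))"
      using w by (intro sum_ennreal[symmetric]) auto
    also have "\<dots> = (\<Sum>k\<in>K. ennreal (w k) * indicator {c - A k..c + A k} h)"
      by (intro sum.cong refl) (auto simp: indicator_def)
    finally show "ennreal (\<Sum>k\<in>K. w k * indicator {- A k..A k} (c - h)) * ennreal (normal_density m \<tau> h)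
        = (\<Sum>k\<in>K. ennreal (w k) * (ennreal (normal_density m \<tau> h) * indicator {c - A k..c + A k} h))"
      by (simp add: sum_distrib_right sum_distrib_left mult_ac)
  qed
  also have "\<dots> = (\<Sum>k\<in>K. ennreal (w k) * emeasure ?N {c - A k..c + A k})"
    by (subst nn_integral_sum) (auto simp: nn_integral_cmult emeasure_density)
  also have "\<dots> \<le> (\<Sum>k\<in>K. ennreal (w k) * ennreal (central_mass (A k / \<tau>)))"
    by (intro sum_mono mult_left_mono normal_window_le \<tau> A) auto
  also have "\<dots> = (\<Sum>k\<in>K. ennreal (w k * central_mass (A k / \<tau>)))"
    using w by (intro sum.cong refl) (simp add: ennreal_mult central_mass_nonneg)
  also have "\<dots> = ennreal (\<Sum>k\<in>K. w k * central_mass (A k / \<tau>))"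
    using w central_mass_nonneg by (intro sum_ennreal) auto
  finally show "(\<integral>\<^sup>+ h. ennreal (\<Sum>k\<in>K. w k * indicator {- A k..A k} (c - h)) * ennreal (normal_density m \<tau> h) \<partial>lborel)
      \<le> ennreal (\<Sum>k\<in>K. w k * central_mass (A k / \<tau>))" .
qed auto

text \<open>
Suppose that the likelihood \<open>l\<close> is Gaussian up to the factor \<open>exp \<rho>\<close>, with centre in \<open>[- (c + r), c + r]\<close>. Then the
posterior gain of any guess \<open>T\<close> over \<open>[- c, c]\<close> is at most that of the best guess for a normal parameter, relative to
the total mass of \<open>l\<close> on the slightly longer interval \<open>[- (c + 2 * r), c + 2 * r]\<close>. This interval contains
the window of radius \<open>r\<close> around the centre and so carries the share \<open>central_mass (r * \<sigma>)\<close> of the full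
Gaussian mass.
\<close>

lemma posterior_window_bound:
  fixes l :: "real \<Rightarrow> real"
  assumes \<sigma>: "0 < \<sigma>" and W: "anderson_weight (1 / \<sigma>) W \<omega>" and r: "0 < r" and \<rho>: "0 \<le> \<rho>" and c: "0 \<le> c"
    and l: "l \<in> borel_measurable borel" and l0: "\<And>h. \<bar>h\<bar> \<le> c + 2 * r \<Longrightarrow> 0 < l h"
    and gauss: "\<And>h. \<bar>h\<bar> \<le> c + 2 * r \<Longrightarrow> \<bar>ln (l h) - (h * D - h\<^sup>2 * \<sigma>\<^sup>2 / 2)\<bar> \<le> \<rho>"
    and D: "\<bar>D\<bar> \<le> (c + r) * \<sigma>\<^sup>2"
  shows "(\<integral>\<^sup>+ h. indicator {- c..c} h * (ennreal (W (T - h)) * ennreal (l h)) \<partial>lborel)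
    \<le> ennreal (exp (2 * \<rho>) * (\<omega> / central_mass (r * \<sigma>)))
      * (\<integral>\<^sup>+ h. indicator {- (c + 2 * r)..c + 2 * r} h * ennreal (l h) \<partial>lborel)"
proof -
  let ?N = "normal_density (D / \<sigma>\<^sup>2) (1 / \<sigma>)" and ?m = "D / \<sigma>\<^sup>2"
  define C where "C = exp (D\<^sup>2 / (2 * \<sigma>\<^sup>2)) * sqrt (2 * pi) / \<sigma>"
  have C: "0 < C" using \<sigma> by (simp add: C_def)
  have [measurable]: "W \<in> borel_measurable borel" "l \<in> borel_measurable borel"
    using W l by (auto simp: anderson_weight_def)
  have \<omega>: "0 \<le> \<omega>" and W0: "\<And>x. 0 \<le> W x"
    and WN: "\<And>m c. (\<integral>\<^sup>+ h. ennreal (W (c - h)) * ennreal (normal_density m (1 / \<sigma>) h) \<partial>lborel) \<le> ennreal \<omega>"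
    using W by (auto simp: anderson_weight_def)
  have N0: "0 \<le> ?N h" for h by simp
  have bounds: "l h \<le> exp \<rho> * (C * ?N h)" "exp (- \<rho>) * (C * ?N h) \<le> l h" if "\<bar>h\<bar> \<le> c + 2 * r" for h
  proof -
    have e: "exp (h * D - h\<^sup>2 * \<sigma>\<^sup>2 / 2) = C * ?N h"
      unfolding C_def by (rule gaussian_weight_eq_normal_density[OF \<sigma>])
    have "ln (l h) \<le> \<rho> + (h * D - h\<^sup>2 * \<sigma>\<^sup>2 / 2)" "- \<rho> + (h * D - h\<^sup>2 * \<sigma>\<^sup>2 / 2) \<le> ln (l h)"
      using gauss[OF that] by linarith+
    then have "exp (ln (l h)) \<le> exp (\<rho> + (h * D - h\<^sup>2 * \<sigma>\<^sup>2 / 2))"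
      "exp (- \<rho> + (h * D - h\<^sup>2 * \<sigma>\<^sup>2 / 2)) \<le> exp (ln (l h))" by simp_all
    then show "l h \<le> exp \<rho> * (C * ?N h)" "exp (- \<rho>) * (C * ?N h) \<le> l h"
      using l0[OF that] unfolding exp_add e by simp_all
  qed
  have cm: "0 < central_mass (r * \<sigma>)" using r \<sigma> by (intro central_mass_pos) simp
  have "(\<integral>\<^sup>+ h. indicator {- c..c} h * (ennreal (W (T - h)) * ennreal (l h)) \<partial>lborel)
      \<le> (\<integral>\<^sup>+ h. ennreal (exp \<rho> * C) * (ennreal (W (T - h)) * ennreal (?N h)) \<partial>lborel)"
  proof (rule nn_integral_mono)
    fix h
    show "indicator {- c..c} h * (ennreal (W (T - h)) * ennreal (l h))
        \<le> ennreal (exp \<rho> * C) * (ennreal (W (T - h)) * ennreal (?N h))"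
    proof (cases "h \<in> {- c..c}")
      case True
      then have "\<bar>h\<bar> \<le> c + 2 * r" using r by auto
      then have "ennreal (l h) \<le> ennreal (exp \<rho> * C) * ennreal (?N h)"
        using bounds(1)[of h] C by (simp add: ennreal_mult[symmetric] mult.assoc)
      then have "ennreal (W (T - h)) * ennreal (l h) \<le> ennreal (W (T - h)) * (ennreal (exp \<rho> * C) * ennreal (?N h))"
        by (rule mult_left_mono) simp
      then show ?thesis using True by (simp add: mult_ac)
    qed simp
  qed
  also have "\<dots> = ennreal (exp \<rho> * C) * (\<integral>\<^sup>+ h. ennreal (W (T - h)) * ennreal (?N h) \<partial>lborel)"
    by (rule nn_integral_cmult) measurable
  also have "\<dots> \<le> ennreal (exp \<rho> * C) * ennreal \<omega>" by (intro mult_left_mono WN) simp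
  also have "\<dots> = ennreal (exp (2 * \<rho>) * (\<omega> / central_mass (r * \<sigma>))) * (ennreal (exp (- \<rho>) * C) * ennreal (central_mass (r * \<sigma>)))"
  proof -
    have "exp \<rho> = exp (2 * \<rho>) * exp (- \<rho>)" by (simp add: exp_add[symmetric])
    then show ?thesis using C \<omega> cm
      by (simp add: ennreal_mult[symmetric] less_imp_le)
  qed
  also have "\<dots> \<le> ennreal (exp (2 * \<rho>) * (\<omega> / central_mass (r * \<sigma>))) * (\<integral>\<^sup>+ h. indicator {- (c + 2 * r)..c + 2 * r} h * ennreal (l h) \<partial>lborel)"
  proof (rule mult_left_mono)
    have "ennreal (central_mass (r * \<sigma>)) = emeasure (density lborel ?N) {?m - r..?m + r}"
      using normal_centered_window[of "1 / \<sigma>" ?m r] \<sigma> by simp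
    then have "ennreal (exp (- \<rho>) * C) * ennreal (central_mass (r * \<sigma>))
        = ennreal (exp (- \<rho>) * C) * (\<integral>\<^sup>+ h. ennreal (?N h) * indicator {?m - r..?m + r} h \<partial>lborel)"
      by (simp add: emeasure_density)
    also have "\<dots> = (\<integral>\<^sup>+ h. ennreal (exp (- \<rho>) * C) * (ennreal (?N h) * indicator {?m - r..?m + r} h) \<partial>lborel)"
      by (rule nn_integral_cmult[symmetric]) measurable
    also have "\<dots> \<le> (\<integral>\<^sup>+ h. indicator {- (c + 2 * r)..c + 2 * r} h * ennreal (l h) \<partial>lborel)"
    proof (rule nn_integral_mono)
      fix h
      show "ennreal (exp (- \<rho>) * C) * (ennreal (?N h) * indicator {?m - r..?m + r} h)
          \<le> indicator {- (c + 2 * r)..c + 2 * r} h * ennreal (l h)"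
      proof (cases "h \<in> {?m - r..?m + r}")
        case True
        have "\<bar>D\<bar> / \<sigma>\<^sup>2 \<le> c + r" using D \<sigma> by (subst pos_divide_le_eq) auto
        then have "\<bar>?m\<bar> \<le> c + r" by simp
        moreover have "\<bar>h - ?m\<bar> \<le> r" using True unfolding atLeastAtMost_iff by linarith
        ultimately have h: "\<bar>h\<bar> \<le> c + 2 * r" by linarith
        then have "ennreal (exp (- \<rho>) * C) * ennreal (?N h) \<le> ennreal (l h)"
          using bounds(2)[of h] C l0[OF h] by (simp add: ennreal_mult[symmetric] mult.assoc)
        moreover have "h \<in> {- (c + 2 * r)..c + 2 * r}" using h unfolding atLeastAtMost_iff by linarith
        ultimately show ?thesis using True by (simp only: indicator_simps mult_1 mult_1_right)
      qed simp
    qed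
    finally show "ennreal (exp (- \<rho>) * C) * ennreal (central_mass (r * \<sigma>))
        \<le> (\<integral>\<^sup>+ h. indicator {- (c + 2 * r)..c + 2 * r} h * ennreal (l h) \<partial>lborel)" .
  qed simp
  finally show ?thesis .
qed

section \<open>A one-parameter model with bounded score\<close>

locale score_model = prob_space P for P :: "'a measure" +
  fixes g :: "'a \<Rightarrow> real" and K \<sigma> :: real
  assumes g_measurable [measurable]: "g \<in> borel_measurable P"
    and g_le: "\<And>\<theta>. \<bar>g \<theta>\<bar> \<le> K" and K_pos: "0 < K" and \<sigma>_pos: "0 < \<sigma>"
    and g_mean: "expectation g = 0" and g_var: "expectation (\<lambda>\<theta>. (g \<theta>)\<^sup>2) = \<sigma>\<^sup>2"
begin

definition tilt :: "real \<Rightarrow> 'a measure" where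
  "tilt \<alpha> = density P (\<lambda>\<theta>. ennreal (1 + \<alpha> * g \<theta>))"

abbreviation sample :: "nat \<Rightarrow> (nat \<Rightarrow> 'a) measure" where
  "sample t \<equiv> PiM {..<t} (\<lambda>_. P)"

definition lik :: "nat \<Rightarrow> real \<Rightarrow> (nat \<Rightarrow> 'a) \<Rightarrow> real" where
  "lik t h \<omega> = (\<Prod>i<t. 1 + h / sqrt t * g (\<omega> i))"

lemma weight_pos:
  assumes "\<bar>\<alpha>\<bar> \<le> 1 / (2 * K)"
  shows "\<bar>\<alpha> * g \<theta>\<bar> \<le> 1 / 2" "0 < 1 + \<alpha> * g \<theta>"
proof -
  have "\<bar>\<alpha> * g \<theta>\<bar> \<le> 1 / (2 * K) * K"
    unfolding abs_mult by (intro mult_mono assms g_le) (use K_pos in auto)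
  then show "\<bar>\<alpha> * g \<theta>\<bar> \<le> 1 / 2" using K_pos by simp
  then show "0 < 1 + \<alpha> * g \<theta>" by linarith
qed

lemma integrable_bounded:
  fixes f :: "'a \<Rightarrow> real"
  assumes "f \<in> borel_measurable P" "\<And>\<theta>. \<bar>f \<theta>\<bar> \<le> B" shows "integrable P f"
  by (rule integrable_const_bound[where B=B]) (use assms in auto)

lemma tilt_expectation:
  fixes f :: "'a \<Rightarrow> real"
  assumes \<alpha>: "\<bar>\<alpha>\<bar> \<le> 1 / (2 * K)" and f: "f \<in> borel_measurable P" "\<And>\<theta>. \<bar>f \<theta>\<bar> \<le> B"
  shows "(\<integral>\<theta>. f \<theta> \<partial>tilt \<alpha>) = expectation f + \<alpha> * expectation (\<lambda>\<theta>. g \<theta> * f \<theta>)"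
proof -
  have [measurable]: "f \<in> borel_measurable P" by fact
  have "(\<integral>\<theta>. f \<theta> \<partial>tilt \<alpha>) = expectation (\<lambda>\<theta>. (1 + \<alpha> * g \<theta>) * f \<theta>)"
    unfolding tilt_def using weight_pos(2)[OF \<alpha>]
    by (subst integral_density) (auto simp: less_imp_le)
  also have "\<dots> = expectation (\<lambda>\<theta>. f \<theta> + \<alpha> * (g \<theta> * f \<theta>))" by (simp add: algebra_simps)
  also have "\<dots> = expectation f + \<alpha> * expectation (\<lambda>\<theta>. g \<theta> * f \<theta>)"
  proof -
    have "integrable P (\<lambda>\<theta>. g \<theta> * f \<theta>)"
      by (rule integrable_bounded[where B="K * B"])
        (use f g_le K_pos in \<open>auto simp: abs_mult intro!: mult_mono\<close>)
    then show ?thesis using integrable_bounded[OF f] by simp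
  qed
  finally show ?thesis .
qed

lemma prob_space_tilt: assumes \<alpha>: "\<bar>\<alpha>\<bar> \<le> 1 / (2 * K)" shows "prob_space (tilt \<alpha>)"
proof
  have int: "integrable P (\<lambda>\<theta>. 1 + \<alpha> * g \<theta>)"
    by (intro Bochner_Integration.integrable_add integrable_mult_right integrable_const
        integrable_bounded[where B=K] g_le) auto
  have "emeasure (tilt \<alpha>) (space (tilt \<alpha>)) = (\<integral>\<^sup>+ \<theta>. ennreal (1 + \<alpha> * g \<theta>) \<partial>P)"
    by (simp add: tilt_def emeasure_density cong: nn_integral_cong)
  also have "\<dots> = ennreal (expectation (\<lambda>\<theta>. 1 + \<alpha> * g \<theta>))"
    using weight_pos(2)[OF \<alpha>] by (intro nn_integral_eq_integral int) (auto simp: less_imp_le)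
  also have "expectation (\<lambda>\<theta>. 1 + \<alpha> * g \<theta>) = 1"
    using integrable_bounded[OF g_measurable g_le] by (simp add: g_mean prob_space)
  finally show "emeasure (tilt \<alpha>) (space (tilt \<alpha>)) = 1" by simp
qed

lemma coordinate_score_measurable:
  assumes w: "w \<in> measurable N (sample t)" and i: "i < t"
  shows "(\<lambda>x. g (w x i)) \<in> borel_measurable N"
proof -
  have "(\<lambda>\<omega>. \<omega> i) \<in> measurable (sample t) P" using i by (intro measurable_component_singleton) auto
  from measurable_compose[OF measurable_compose[OF w this] g_measurable] show ?thesis .
qed

lemma lik_measurable [measurable (raw)]:
  assumes [measurable]: "f \<in> borel_measurable N" and w: "w \<in> measurable N (sample t)"
  shows "(\<lambda>x. lik t (f x) (w x)) \<in> borel_measurable N"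
proof -
  have "(\<lambda>x. 1 + f x / sqrt t * g (w x i)) \<in> borel_measurable N" if "i < t" for i
  proof -
    have [measurable]: "(\<lambda>x. g (w x i)) \<in> borel_measurable N"
      using w that by (rule coordinate_score_measurable)
    show ?thesis by measurable
  qed
  then show ?thesis
    unfolding lik_def by (intro borel_measurable_prod) auto
qed

lemma sample_tilt:
  assumes \<alpha>: "\<bar>h / sqrt t\<bar> \<le> 1 / (2 * K)"
  shows "PiM {..<t} (\<lambda>_. tilt (h / sqrt t)) = density (sample t) (\<lambda>\<omega>. ennreal (lik t h \<omega>))"
proof -
  have "PiM {..<t} (\<lambda>_. tilt (h / sqrt t))
      = density (sample t) (\<lambda>\<omega>. \<Prod>i<t. ennreal (1 + h / sqrt t * g (\<omega> i)))"
    unfolding tilt_def using prob_space_tilt[OF \<alpha>, unfolded tilt_def]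
    by (intro PiM_density_prod prob_space_axioms) auto
  also have "(\<lambda>\<omega>. \<Prod>i<t. ennreal (1 + h / sqrt t * g (\<omega> i))) = (\<lambda>\<omega>. ennreal (lik t h \<omega>))"
    unfolding lik_def using weight_pos(2)[OF \<alpha>] by (intro ext prod_ennreal) (auto simp: less_imp_le)
  finally show ?thesis .
qed

lemma lik_pos: "\<bar>h / sqrt t\<bar> \<le> 1 / (2 * K) \<Longrightarrow> 0 < lik t h \<omega>"
  unfolding lik_def by (intro prod_pos ballI weight_pos(2))

lemma lik_mass:
  assumes \<alpha>: "\<bar>h / sqrt t\<bar> \<le> 1 / (2 * K)"
  shows "(\<integral>\<^sup>+ \<omega>. ennreal (lik t h \<omega>) \<partial>sample t) = 1"
proof -
  interpret Q: prob_space "PiM {..<t} (\<lambda>_. tilt (h / sqrt t))"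
    by (rule prob_space_PiM) (rule prob_space_tilt[OF \<alpha>])
  have "emeasure (density (sample t) (\<lambda>\<omega>. ennreal (lik t h \<omega>))) (space (sample t)) = 1"
    using Q.emeasure_space_1 unfolding sample_tilt[OF \<alpha>] by simp
  then show ?thesis by (simp add: emeasure_density cong: nn_integral_cong)
qed

text \<open>
The two statistics that determine the log-likelihood up to a vanishing error.
\<close>

definition \<Delta> :: "nat \<Rightarrow> (nat \<Rightarrow> 'a) \<Rightarrow> real" where "\<Delta> t \<omega> = (\<Sum>i<t. g (\<omega> i)) / sqrt t"
definition V :: "nat \<Rightarrow> (nat \<Rightarrow> 'a) \<Rightarrow> real" where "V t \<omega> = (\<Sum>i<t. (g (\<omega> i))\<^sup>2) / t"

text \<open>
Summing the logarithmic expansion over the sample: the boundedness of the score makes the third-order error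
uniform and deterministic.
\<close>

lemma ln_lik_expansion:
  assumes t: "0 < t" and h: "\<bar>h\<bar> \<le> c" "c / sqrt t \<le> 1 / (2 * K)"
  shows "\<bar>ln (lik t h \<omega>) - (h * \<Delta> t \<omega> - h\<^sup>2 * V t \<omega> / 2)\<bar> \<le> c ^ 3 * K ^ 3 / sqrt t"
proof -
  define x where "x i = h / sqrt t * g (\<omega> i)" for i
  have "\<bar>h / sqrt t\<bar> \<le> c / sqrt t" using h(1) t by (simp add: divide_right_mono)
  then have \<alpha>: "\<bar>h / sqrt t\<bar> \<le> 1 / (2 * K)" using h(2) by linarith
  have xK: "\<bar>x i\<bar> \<le> c * K / sqrt t" for i
  proof -
    have "\<bar>h / sqrt t\<bar> * \<bar>g (\<omega> i)\<bar> \<le> c / sqrt t * K"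
      using \<open>\<bar>h / sqrt t\<bar> \<le> c / sqrt t\<close> g_le by (intro mult_mono) (use h in auto)
    then show ?thesis by (simp add: x_def abs_mult)
  qed
  have "0 < 1 + x i" for i unfolding x_def by (rule weight_pos(2)[OF \<alpha>])
  then have "ln (lik t h \<omega>) = (\<Sum>i<t. ln (1 + x i))"
    unfolding lik_def x_def[symmetric] by (intro ln_prod) (auto simp: less_imp_neq[symmetric])
  moreover have "h * \<Delta> t \<omega> - h\<^sup>2 * V t \<omega> / 2 = (\<Sum>i<t. x i - (x i)\<^sup>2 / 2)"
  proof -
    have "(\<Sum>i<t. x i) = h * \<Delta> t \<omega>"
      unfolding x_def \<Delta>_def sum_distrib_left[symmetric] by simp
    moreover have "(x i)\<^sup>2 = h\<^sup>2 / t * (g (\<omega> i))\<^sup>2" for i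
      by (simp add: x_def power_mult_distrib power_divide)
    then have "(\<Sum>i<t. (x i)\<^sup>2) = h\<^sup>2 * V t \<omega>"
      unfolding V_def by (simp only: sum_distrib_left[symmetric]) simp
    ultimately show ?thesis by (simp add: sum_subtractf sum_divide_distrib[symmetric])
  qed
  ultimately have "\<bar>ln (lik t h \<omega>) - (h * \<Delta> t \<omega> - h\<^sup>2 * V t \<omega> / 2)\<bar>
      = \<bar>\<Sum>i<t. ln (1 + x i) - (x i - (x i)\<^sup>2 / 2)\<bar>" by (simp add: sum_subtractf)
  also have "\<dots> \<le> (\<Sum>i<t. \<bar>ln (1 + x i) - (x i - (x i)\<^sup>2 / 2)\<bar>)" by (rule sum_abs)
  also have "\<dots> \<le> (\<Sum>i<t. (c * K / sqrt t) ^ 3)"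
  proof (rule sum_mono)
    fix i
    have "\<bar>ln (1 + x i) - (x i - (x i)\<^sup>2 / 2)\<bar> \<le> \<bar>x i\<bar> ^ 3"
      by (rule ln_cubic_bound) (use weight_pos(1)[OF \<alpha>] in \<open>simp add: x_def\<close>)
    also have "\<dots> \<le> (c * K / sqrt t) ^ 3" using xK by (intro power_mono) auto
    finally show "\<bar>ln (1 + x i) - (x i - (x i)\<^sup>2 / 2)\<bar> \<le> (c * K / sqrt t) ^ 3" .
  qed
  also have "\<dots> = c ^ 3 * K ^ 3 / sqrt t"
    using t by (simp add: power_divide power_mult_distrib power3_eq_cube)
  finally show ?thesis .
qed


lemma V_measurable [measurable]: "V t \<in> borel_measurable (sample t)"
  unfolding V_def
  by (intro borel_measurable_divide borel_measurable_sum borel_measurable_power borel_measurable_const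
      coordinate_score_measurable[where w="\<lambda>\<omega>. \<omega>"]) auto

lemma \<Delta>_measurable [measurable]: "\<Delta> t \<in> borel_measurable (sample t)"
  unfolding \<Delta>_def
  by (intro borel_measurable_divide borel_measurable_sum borel_measurable_const
      coordinate_score_measurable[where w="\<lambda>\<omega>. \<omega>"]) auto

lemma sets_sample_tilt: "sets (PiM {..<t} (\<lambda>_. tilt \<alpha>)) = sets (sample t)"
  by (rule sets_PiM_cong) (auto simp: tilt_def)

lemma space_sample_tilt: "space (PiM {..<t} (\<lambda>_. tilt \<alpha>)) = space (sample t)"
  by (rule sets_eq_imp_space_eq[OF sets_sample_tilt])

text \<open>
Under the parameter \<open>h\<close> the normalized score sum has mean \<open>h * \<sigma>\<^sup>2\<close>, and the empirical variance of the score has a mean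
within \<open>\<eta> / 2\<close> of \<open>\<sigma>\<^sup>2\<close>, so Hoeffding's inequality bounds both deviations uniformly in \<open>h\<close>.
\<close>

lemma atypical_sample_bound:
  assumes t: "0 < t" and h: "\<bar>h\<bar> \<le> c" and c: "c / sqrt t \<le> 1 / (2 * K)" and r: "0 \<le> r"
    and \<eta>: "0 \<le> \<eta>" "c * K ^ 3 / sqrt t \<le> \<eta> / 2"
  shows "measure (PiM {..<t} (\<lambda>_. tilt (h / sqrt t)))
      {\<omega> \<in> space (sample t). \<not> (\<bar>V t \<omega> - \<sigma>\<^sup>2\<bar> \<le> \<eta> \<and> \<bar>\<Delta> t \<omega>\<bar> \<le> (c + r) * \<sigma>\<^sup>2)}
    \<le> 2 * exp (- (real t * \<eta>\<^sup>2 / (8 * K ^ 4))) + 2 * exp (- (r\<^sup>2 * \<sigma> ^ 4 / (2 * K\<^sup>2)))"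
proof -
  let ?\<alpha> = "h / sqrt t"
  let ?Q = "PiM {..<t} (\<lambda>_. tilt ?\<alpha>)"
  have "\<bar>?\<alpha>\<bar> \<le> c / sqrt t" using h t by (simp add: divide_right_mono)
  then have \<alpha>: "\<bar>?\<alpha>\<bar> \<le> 1 / (2 * K)" using c by linarith
  interpret Q: prob_space ?Q by (rule prob_space_PiM) (rule prob_space_tilt[OF \<alpha>])
  have g_tilt: "g \<in> borel_measurable (tilt ?\<alpha>)" "(\<lambda>\<theta>. (g \<theta>)\<^sup>2) \<in> borel_measurable (tilt ?\<alpha>)"
    by (simp_all add: tilt_def)
  have g2: "\<bar>(g \<theta>)\<^sup>2\<bar> \<le> K\<^sup>2" for \<theta> using g_le[of \<theta>] K_pos by (simp add: abs_le_square_iff[symmetric])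
  have m1: "(\<integral>\<theta>. g \<theta> \<partial>tilt ?\<alpha>) = ?\<alpha> * \<sigma>\<^sup>2"
    using tilt_expectation[OF \<alpha> g_measurable g_le] g_mean g_var by (simp add: power2_eq_square)
  have m2: "\<bar>(\<integral>\<theta>. (g \<theta>)\<^sup>2 \<partial>tilt ?\<alpha>) - \<sigma>\<^sup>2\<bar> \<le> \<eta> / 2"
  proof -
    have "(\<integral>\<theta>. (g \<theta>)\<^sup>2 \<partial>tilt ?\<alpha>) - \<sigma>\<^sup>2 = ?\<alpha> * expectation (\<lambda>\<theta>. g \<theta> * (g \<theta>)\<^sup>2)"
      using tilt_expectation[OF \<alpha> _ g2] g_var by simp
    moreover have "\<bar>expectation (\<lambda>\<theta>. g \<theta> * (g \<theta>)\<^sup>2)\<bar> \<le> K ^ 3"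
    proof -
      have b: "\<bar>g \<theta> * (g \<theta>)\<^sup>2\<bar> \<le> K ^ 3" for \<theta>
      proof -
        have "\<bar>g \<theta> * (g \<theta>)\<^sup>2\<bar> = \<bar>g \<theta>\<bar> * \<bar>(g \<theta>)\<^sup>2\<bar>" by (rule abs_mult)
        also have "\<dots> \<le> K * K\<^sup>2" by (intro mult_mono g_le g2) (use K_pos in auto)
        finally show ?thesis by (simp add: power3_eq_cube power2_eq_square)
      qed
      have int: "integrable P (\<lambda>\<theta>. g \<theta> * (g \<theta>)\<^sup>2)" by (rule integrable_bounded[OF _ b]) simp
      have "\<bar>expectation (\<lambda>\<theta>. g \<theta> * (g \<theta>)\<^sup>2)\<bar> \<le> expectation (\<lambda>\<theta>. \<bar>g \<theta> * (g \<theta>)\<^sup>2\<bar>)"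
        by (rule integral_abs_bound)
      also have "\<dots> \<le> expectation (\<lambda>\<theta>. K ^ 3)" using int b by (intro integral_mono) auto
      finally show ?thesis by (simp add: prob_space)
    qed
    ultimately have "\<bar>(\<integral>\<theta>. (g \<theta>)\<^sup>2 \<partial>tilt ?\<alpha>) - \<sigma>\<^sup>2\<bar> \<le> c / sqrt t * K ^ 3"
      using \<open>\<bar>?\<alpha>\<bar> \<le> c / sqrt t\<close> unfolding abs_mult by (auto simp only: abs_mult intro!: mult_mono)
    also have "c / sqrt t * K ^ 3 = c * K ^ 3 / sqrt t" by simp
    finally show ?thesis using \<eta>(2) by (rule order_trans)
  qed
  let ?B1 = "{\<omega> \<in> space ?Q. real t * \<eta> / 2 \<le> \<bar>(\<Sum>i<t. (g (\<omega> i))\<^sup>2) - real t * (\<integral>\<theta>. (g \<theta>)\<^sup>2 \<partial>tilt ?\<alpha>)\<bar>}"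
  let ?B2 = "{\<omega> \<in> space ?Q. r * \<sigma>\<^sup>2 * sqrt t \<le> \<bar>(\<Sum>i<t. g (\<omega> i)) - real t * (\<integral>\<theta>. g \<theta> \<partial>tilt ?\<alpha>)\<bar>}"
  have coord: "(\<lambda>\<omega>. g (\<omega> i)) \<in> borel_measurable ?Q" if "i < t" for i
    by (rule coordinate_score_measurable[OF measurable_ident_sets[OF sets_sample_tilt] that])
  have sum1[measurable]: "(\<lambda>\<omega>. \<Sum>i<t. (g (\<omega> i))\<^sup>2) \<in> borel_measurable ?Q"
    by (intro borel_measurable_sum borel_measurable_power coord) auto
  have sum2[measurable]: "(\<lambda>\<omega>. \<Sum>i<t. g (\<omega> i)) \<in> borel_measurable ?Q"
    by (intro borel_measurable_sum coord) auto
  have B: "?B1 \<in> sets ?Q" "?B2 \<in> sets ?Q" by measurable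
  have "{\<omega> \<in> space (sample t). \<not> (\<bar>V t \<omega> - \<sigma>\<^sup>2\<bar> \<le> \<eta> \<and> \<bar>\<Delta> t \<omega>\<bar> \<le> (c + r) * \<sigma>\<^sup>2)} \<subseteq> ?B1 \<union> ?B2"
  proof
    fix \<omega> assume \<omega>: "\<omega> \<in> {\<omega> \<in> space (sample t). \<not> (\<bar>V t \<omega> - \<sigma>\<^sup>2\<bar> \<le> \<eta> \<and> \<bar>\<Delta> t \<omega>\<bar> \<le> (c + r) * \<sigma>\<^sup>2)}"
    then have sp: "\<omega> \<in> space ?Q" by (simp add: space_sample_tilt)
    from \<omega> consider "\<eta> < \<bar>V t \<omega> - \<sigma>\<^sup>2\<bar>" | "(c + r) * \<sigma>\<^sup>2 < \<bar>\<Delta> t \<omega>\<bar>" by force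
    then show "\<omega> \<in> ?B1 \<union> ?B2"
    proof cases
      case 1
      then have "\<eta> / 2 \<le> \<bar>V t \<omega> - (\<integral>\<theta>. (g \<theta>)\<^sup>2 \<partial>tilt ?\<alpha>)\<bar>" using m2 by linarith
      then have "real t * (\<eta> / 2) \<le> real t * \<bar>V t \<omega> - (\<integral>\<theta>. (g \<theta>)\<^sup>2 \<partial>tilt ?\<alpha>)\<bar>"
        by (rule mult_left_mono) simp
      also have "\<dots> = \<bar>real t * (V t \<omega> - (\<integral>\<theta>. (g \<theta>)\<^sup>2 \<partial>tilt ?\<alpha>))\<bar>" by (simp add: abs_mult)
      also have "real t * (V t \<omega> - (\<integral>\<theta>. (g \<theta>)\<^sup>2 \<partial>tilt ?\<alpha>))
          = (\<Sum>i<t. (g (\<omega> i))\<^sup>2) - real t * (\<integral>\<theta>. (g \<theta>)\<^sup>2 \<partial>tilt ?\<alpha>)"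
        using t by (simp add: V_def right_diff_distrib)
      finally show ?thesis using sp by simp
    next
      case 2
      have "\<bar>h * \<sigma>\<^sup>2\<bar> \<le> c * \<sigma>\<^sup>2" using h by (simp add: abs_mult mult_right_mono)
      then have "r * \<sigma>\<^sup>2 \<le> \<bar>\<Delta> t \<omega> - h * \<sigma>\<^sup>2\<bar>" using 2 by (simp add: distrib_right)
      then have "r * \<sigma>\<^sup>2 * sqrt t \<le> \<bar>\<Delta> t \<omega> - h * \<sigma>\<^sup>2\<bar> * sqrt t" by (rule mult_right_mono) simp
      also have "\<dots> = \<bar>(\<Delta> t \<omega> - h * \<sigma>\<^sup>2) * sqrt t\<bar>" by (simp add: abs_mult)
      also have "(\<Delta> t \<omega> - h * \<sigma>\<^sup>2) * sqrt t = (\<Sum>i<t. g (\<omega> i)) - real t * (\<integral>\<theta>. g \<theta> \<partial>tilt ?\<alpha>)"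
      proof -
        have "h * \<sigma>\<^sup>2 * sqrt t = real t * (?\<alpha> * \<sigma>\<^sup>2)"
        proof -
          have "real t * (?\<alpha> * \<sigma>\<^sup>2) = (sqrt t * sqrt t) * (h / sqrt t * \<sigma>\<^sup>2)" by simp
          also have "\<dots> = h * \<sigma>\<^sup>2 * sqrt t" using t by (simp del: real_sqrt_mult_self)
          finally show ?thesis by simp
        qed
        moreover have "\<Delta> t \<omega> * sqrt t = (\<Sum>i<t. g (\<omega> i))" using t by (simp add: \<Delta>_def)
        ultimately show ?thesis unfolding m1 left_diff_distrib by simp
      qed
      finally show ?thesis using sp by simp
    qed
  qed
  then have "Q.prob {\<omega> \<in> space (sample t). \<not> (\<bar>V t \<omega> - \<sigma>\<^sup>2\<bar> \<le> \<eta> \<and> \<bar>\<Delta> t \<omega>\<bar> \<le> (c + r) * \<sigma>\<^sup>2)} \<le> Q.prob (?B1 \<union> ?B2)"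
    using B by (intro Q.finite_measure_mono) auto
  also have "\<dots> \<le> Q.prob ?B1 + Q.prob ?B2" using B by (intro measure_Un_le) auto
  also have "Q.prob ?B1 \<le> 2 * exp (- ((real t * \<eta> / 2)\<^sup>2 / (2 * real t * (K\<^sup>2)\<^sup>2)))"
    using K_pos \<eta>(1) by (intro iid_Hoeffding prob_space_tilt \<alpha> g_tilt g2 t) auto
  also have "(real t * \<eta> / 2)\<^sup>2 / (2 * real t * (K\<^sup>2)\<^sup>2) = real t * \<eta>\<^sup>2 / (8 * K ^ 4)"
    using t K_pos by (simp add: field_simps power2_eq_square power4_eq_xxxx)
  also have "Q.prob ?B2 \<le> 2 * exp (- ((r * \<sigma>\<^sup>2 * sqrt t)\<^sup>2 / (2 * real t * K\<^sup>2)))"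
    using K_pos r by (intro iid_Hoeffding prob_space_tilt \<alpha> g_tilt g_le t) auto
  also have "(r * \<sigma>\<^sup>2 * sqrt t)\<^sup>2 / (2 * real t * K\<^sup>2) = r\<^sup>2 * \<sigma> ^ 4 / (2 * K\<^sup>2)"
    using t by (simp add: power_mult_distrib)
  finally show ?thesis by simp
qed

text \<open>
The factor in the window bound tends to 1 and the tail bound tends to 0 as the margin \<open>r\<close> grows.
\<close>

lemma window_tuning:
  assumes \<omega>: "0 \<le> \<omega>" and \<epsilon>: "0 < \<epsilon>"
  obtains r where "0 < r"
    "exp (2 * (1 / r)) * (\<omega> / central_mass (r * \<sigma>)) * (1 + 2 / r) < \<omega> + \<epsilon>"
    "Wm * (2 * exp (- (r\<^sup>2 * \<sigma> ^ 4 / (2 * K\<^sup>2)))) < \<epsilon>"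
proof -
  have "((\<lambda>n. exp (2 * (1 / real n)) * (\<omega> / central_mass (real n * \<sigma>)) * (1 + 2 / real n)) \<longlongrightarrow> exp 0 * (\<omega> / 1) * (1 + 0)) sequentially"
  proof (intro tendsto_mult tendsto_divide tendsto_add tendsto_const central_mass_tendsto_1 \<sigma>_pos)
    show "(\<lambda>n. exp (2 * (1 / real n))) \<longlonglongrightarrow> exp 0" by real_asymp
    show "(\<lambda>n. 2 / real n) \<longlonglongrightarrow> 0" by real_asymp
  qed simp
  then have 1: "\<forall>\<^sub>F n in sequentially. exp (2 * (1 / real n)) * (\<omega> / central_mass (real n * \<sigma>)) * (1 + 2 / real n) < \<omega> + \<epsilon>"
    using \<epsilon> by (intro order_tendstoD(2)[of _ "\<omega>"]) auto
  define a where "a = \<sigma> ^ 4 / (2 * K\<^sup>2)"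
  have "0 < a" using \<sigma>_pos K_pos by (simp add: a_def)
  then have "(\<lambda>n. Wm * (2 * exp (- ((real n)\<^sup>2 * a)))) \<longlonglongrightarrow> Wm * (2 * 0)"
    by (intro tendsto_mult tendsto_const) real_asymp
  then have 2: "\<forall>\<^sub>F n in sequentially. Wm * (2 * exp (- ((real n)\<^sup>2 * a))) < \<epsilon>"
    using \<epsilon> by (intro order_tendstoD(2)[of _ "0"]) auto
  have "\<forall>\<^sub>F n in sequentially. 0 < n" by (rule eventually_gt_at_top)
  then have "\<forall>\<^sub>F n in sequentially. 0 < n \<and> exp (2 * (1 / real n)) * (\<omega> / central_mass (real n * \<sigma>)) * (1 + 2 / real n) < \<omega> + \<epsilon>
      \<and> Wm * (2 * exp (- ((real n)\<^sup>2 * a))) < \<epsilon>"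
    using 1 2 by eventually_elim auto
  then obtain n :: nat where "0 < n" "exp (2 * (1 / real n)) * (\<omega> / central_mass (real n * \<sigma>)) * (1 + 2 / real n) < \<omega> + \<epsilon>"
      "Wm * (2 * exp (- ((real n)\<^sup>2 * a))) < \<epsilon>"
    using eventually_happens'[OF sequentially_bot] by blast
  then show ?thesis by (intro that[of "real n"]) (auto simp: a_def)
qed

text \<open>
Put the uniform prior on \<open>[- c, c]\<close> and exchange the order of integration. For typical samples the window bound
compares the posterior gain with the mass of the likelihood on the longer interval \<open>[- c', c']\<close>. The average
of this mass over samples is the length of that interval, exactly, because every likelihood integrates to 1. With \<open>c = r\<^sup>2\<close> the ratio \<open>c' / c = 1 + 2 / r\<close> tends to 1, while the
centre of the posterior leaves \<open>[- (c + r), c + r]\<close> with small probability.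

Average gain at most \<open>\<omega> + \<epsilon>\<close> means that some parameter in the prior's support has at most this gain.
\<close>

theorem average_window_risk:
  assumes W: "anderson_weight (1 / \<sigma>) W \<omega>" and Wm: "\<And>x. W x \<le> Wm" and \<epsilon>: "0 < \<epsilon>"
  obtains c where "0 < c"
    "\<forall>\<^sub>F t in sequentially. \<forall>T \<in> borel_measurable (sample t). \<exists>h \<in> {- c..c}.
       (\<integral>\<omega>'. W (T \<omega>' - h) \<partial>PiM {..<t} (\<lambda>_. tilt (h / sqrt t))) \<le> \<omega> + \<epsilon>"
proof -
  have \<omega>: "0 \<le> \<omega>" and W0: "\<And>x. 0 \<le> W x" and [measurable]: "W \<in> borel_measurable borel"
    using W by (auto simp: anderson_weight_def)
  have Wm0: "0 \<le> Wm" using W0[of 0] Wm[of 0] by linarith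
  have "0 < \<epsilon> / 4" using \<epsilon> by simp
  then obtain r where r: "0 < r"
    "exp (2 * (1 / r)) * (\<omega> / central_mass (r * \<sigma>)) * (1 + 2 / r) < \<omega> + \<epsilon> / 4"
    "Wm * (2 * exp (- (r\<^sup>2 * \<sigma> ^ 4 / (2 * K\<^sup>2)))) < \<epsilon> / 4"
    using window_tuning[OF \<omega>] by blast
  define c where "c = r\<^sup>2"
  define c' where "c' = c + 2 * r"
  define \<rho> where "\<rho> = 1 / r"
  \<comment> \<open>Half of the error budget \<rho> goes to the fluctuation of the empirical variance, half to the cubic remainder.\<close>
  define \<eta> where "\<eta> = \<rho> / c'\<^sup>2"
  define \<kappa> where "\<kappa> = exp (2 * \<rho>) * (\<omega> / central_mass (r * \<sigma>))"
  have c: "0 < c" "0 < c'" "c \<le> c'" using r(1) by (auto simp: c_def c'_def intro!: add_pos_pos)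
  have c_ratio: "c' = c * (1 + 2 / r)" using r(1) by (simp add: c_def c'_def power2_eq_square field_simps)
  have \<rho>: "0 < \<rho>" using r(1) by (simp add: \<rho>_def)
  have \<eta>: "0 < \<eta>" using \<rho> c(2) unfolding \<eta>_def by simp
  have \<kappa>0: "0 \<le> \<kappa>" using \<omega> central_mass_nonneg by (simp add: \<kappa>_def)
  have sq: "\<forall>\<^sub>F t in sequentially. X / sqrt (real t) < y" if "0 < y" for X y :: real
  proof -
    have "(\<lambda>t::nat. X / sqrt (real t)) \<longlonglongrightarrow> 0" by real_asymp
    then show ?thesis using that by (rule order_tendstoD(2))
  qed
  have ex: "\<forall>\<^sub>F t in sequentially. Wm * (2 * exp (- (real t * \<eta>\<^sup>2 / (8 * K ^ 4)))) < \<epsilon> / 4"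
  proof -
    define a where "a = \<eta>\<^sup>2 / (8 * K ^ 4)"
    have "0 < a" using \<eta> K_pos by (simp add: a_def)
    then have "(\<lambda>t::nat. Wm * (2 * exp (- (real t * a)))) \<longlonglongrightarrow> Wm * (2 * 0)"
      by (intro tendsto_mult tendsto_const) real_asymp
    then have "\<forall>\<^sub>F t::nat in sequentially. Wm * (2 * exp (- (real t * a))) < \<epsilon> / 4"
      using \<epsilon> by (intro order_tendstoD(2)[of _ "0"]) auto
    then show ?thesis by (simp add: a_def)
  qed
  have "\<forall>\<^sub>F t in sequentially. (0::nat) < t" by (rule eventually_gt_at_top)
  moreover have "\<forall>\<^sub>F t in sequentially. c' / sqrt (real t) < 1 / (2 * K)" using K_pos by (intro sq) simp
  moreover have "\<forall>\<^sub>F t in sequentially. c' ^ 3 * K ^ 3 / sqrt (real t) < \<rho> / 2" using \<rho> by (intro sq) simp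
  moreover have "\<forall>\<^sub>F t in sequentially. c * K ^ 3 / sqrt (real t) < \<eta> / 2" using \<eta> by (intro sq) simp
  ultimately have "\<forall>\<^sub>F t in sequentially. \<forall>T \<in> borel_measurable (sample t). \<exists>h \<in> {- c..c}.
       (\<integral>\<omega>'. W (T \<omega>' - h) \<partial>PiM {..<t} (\<lambda>_. tilt (h / sqrt t))) \<le> \<omega> + \<epsilon>"
    using ex
  proof eventually_elim
    case (elim t)
    interpret S: prob_space "sample t" by (rule prob_space_PiM) (rule prob_space_axioms)
    interpret F: pair_sigma_finite lborel "sample t" by standard
    have \<alpha>: "\<bar>h / sqrt t\<bar> \<le> 1 / (2 * K)" if "\<bar>h\<bar> \<le> c'" for h
    proof -
      have "\<bar>h / sqrt t\<bar> \<le> c' / sqrt t" using that by (simp add: divide_right_mono)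
      then show ?thesis using elim(2) by linarith
    qed
    have inc: "\<bar>h\<bar> \<le> c'" if "h \<in> {- c..c}" for h using that c by auto
    define bad where "bad = {w \<in> space (sample t). \<not> (\<bar>V t w - \<sigma>\<^sup>2\<bar> \<le> \<eta> \<and> \<bar>\<Delta> t w\<bar> \<le> (c + r) * \<sigma>\<^sup>2)}"
    have bad_sets[measurable]: "bad \<in> sets (sample t)" unfolding bad_def by measurable
    define pb where "pb = 2 * exp (- (real t * \<eta>\<^sup>2 / (8 * K ^ 4))) + 2 * exp (- (r\<^sup>2 * \<sigma> ^ 4 / (2 * K\<^sup>2)))"
    have pb: "0 \<le> pb" "Wm * pb < \<epsilon> / 2" using elim(5) r(3) by (auto simp: pb_def algebra_simps)
    have bad_mass: "(\<integral>\<^sup>+ w. indicator bad w * ennreal (lik t h w) \<partial>sample t) \<le> ennreal pb" if h: "h \<in> {- c..c}" for h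
    proof -
      let ?Q = "PiM {..<t} (\<lambda>_. tilt (h / sqrt t))"
      interpret Q: prob_space ?Q by (rule prob_space_PiM) (rule prob_space_tilt[OF \<alpha>[OF inc[OF h]]])
      have "(\<integral>\<^sup>+ w. indicator bad w * ennreal (lik t h w) \<partial>sample t) = emeasure ?Q bad"
        unfolding sample_tilt[OF \<alpha>[OF inc[OF h]]] by (simp add: emeasure_density mult.commute)
      also have "\<dots> = ennreal (Q.prob bad)" by (rule Q.emeasure_eq_measure)
      also have "Q.prob bad \<le> pb"
        unfolding bad_def pb_def
      proof (rule atypical_sample_bound[OF elim(1)])
        show "\<bar>h\<bar> \<le> c" using h by auto
        have "c / sqrt t \<le> c' / sqrt t" using c by (intro divide_right_mono) auto
        then show "c / sqrt t \<le> 1 / (2 * K)" using elim(2) by linarith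
      qed (use r \<eta> elim(4) in auto)
      finally show ?thesis by (simp add: ennreal_leI)
    qed
    show ?case
    proof (rule ballI, rule ccontr)
      fix T :: "(nat \<Rightarrow> 'a) \<Rightarrow> real" assume T[measurable]: "T \<in> borel_measurable (sample t)"
      assume "\<not> (\<exists>h\<in>{- c..c}. (\<integral>\<omega>'. W (T \<omega>' - h) \<partial>PiM {..<t} (\<lambda>_. tilt (h / sqrt t))) \<le> \<omega> + \<epsilon>)"
      then have contra: "\<omega> + \<epsilon> < (\<integral>\<omega>'. W (T \<omega>' - h) \<partial>PiM {..<t} (\<lambda>_. tilt (h / sqrt t)))"
        if "h \<in> {- c..c}" for h using that by force
      \<comment> \<open>The gain of T, the mass on the longer interval, and a bound for the gain on atypical samples, as functions of parameter and sample.\<close>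
      define f where "f h w = indicator {- c..c} h * (ennreal (W (T w - h)) * ennreal (lik t h w))" for h w
      define u where "u h w = indicator {- c'..c'} h * ennreal (lik t h w)" for h w
      define e where "e h w = indicator {- c..c} h * (indicator bad w * (ennreal Wm * ennreal (lik t h w)))" for h w
      have fm: "(\<lambda>(h, w). f h w) \<in> borel_measurable (lborel \<Otimes>\<^sub>M sample t)" unfolding f_def by measurable
      have um: "(\<lambda>(h, w). u h w) \<in> borel_measurable (lborel \<Otimes>\<^sub>M sample t)" unfolding u_def by measurable
      have em: "(\<lambda>(h, w). e h w) \<in> borel_measurable (lborel \<Otimes>\<^sub>M sample t)" unfolding e_def by measurable
      have um2: "(\<lambda>w. \<integral>\<^sup>+ h. u h w \<partial>lborel) \<in> borel_measurable (sample t)"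
        unfolding u_def by measurable
      have em2: "(\<lambda>w. \<integral>\<^sup>+ h. e h w \<partial>lborel) \<in> borel_measurable (sample t)"
        unfolding e_def by measurable

      have lower: "ennreal ((\<omega> + \<epsilon>) * (2 * c)) \<le> (\<integral>\<^sup>+ h. \<integral>\<^sup>+ w. f h w \<partial>sample t \<partial>lborel)"
      proof -
        have "ennreal ((\<omega> + \<epsilon>) * (2 * c)) = ennreal (\<omega> + \<epsilon>) * emeasure lborel {- c..c}"
          using \<omega> \<epsilon> c by (simp add: ennreal_mult del: ennreal_plus)
        also have "\<dots> = (\<integral>\<^sup>+ h. ennreal (\<omega> + \<epsilon>) * indicator {- c..c} h \<partial>lborel)"
          by (simp add: nn_integral_cmult_indicator)
        also have "\<dots> \<le> (\<integral>\<^sup>+ h. \<integral>\<^sup>+ w. f h w \<partial>sample t \<partial>lborel)"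
        proof (rule nn_integral_mono)
          fix h
          show "ennreal (\<omega> + \<epsilon>) * indicator {- c..c} h \<le> (\<integral>\<^sup>+ w. f h w \<partial>sample t)"
          proof (cases "h \<in> {- c..c}")
            case True
            let ?Q = "PiM {..<t} (\<lambda>_. tilt (h / sqrt t))"
            note \<alpha>h = \<alpha>[OF inc[OF True]]
            interpret Q: prob_space ?Q by (rule prob_space_PiM) (rule prob_space_tilt[OF \<alpha>h])
            have Tq: "T \<in> borel_measurable ?Q" using T by (simp add: measurable_cong_sets[OF sets_sample_tilt refl])
            have int: "integrable ?Q (\<lambda>w. W (T w - h))"
              by (rule Q.integrable_const_bound[where B=Wm]) (use W0 Wm Tq in auto)
            have "ennreal (\<omega> + \<epsilon>) \<le> ennreal (\<integral>w. W (T w - h) \<partial>?Q)"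
              using contra[OF True] by (intro ennreal_leI) simp
            also have "\<dots> = (\<integral>\<^sup>+ w. ennreal (W (T w - h)) \<partial>?Q)"
              using int W0 by (intro nn_integral_eq_integral[symmetric]) auto
            also have "\<dots> = (\<integral>\<^sup>+ w. f h w \<partial>sample t)"
              unfolding sample_tilt[OF \<alpha>h] f_def using True
              by (subst nn_integral_density) (auto simp: mult.commute)
            finally show ?thesis using True by simp
          qed simp
        qed
        finally show ?thesis .
      qed

      have pointwise: "(\<integral>\<^sup>+ h. f h w \<partial>lborel) \<le> ennreal \<kappa> * (\<integral>\<^sup>+ h. u h w \<partial>lborel) + (\<integral>\<^sup>+ h. e h w \<partial>lborel)"
        if w: "w \<in> space (sample t)" for w
      proof (cases "w \<in> bad")
        case True
        have "(\<integral>\<^sup>+ h. f h w \<partial>lborel) \<le> (\<integral>\<^sup>+ h. e h w \<partial>lborel)"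
          unfolding f_def e_def using True Wm
          by (intro nn_integral_mono mult_left_mono mult_right_mono) (auto intro!: mult_right_mono ennreal_leI)
        then show ?thesis by (simp add: add_increasing)
      next
        case False
        then have good: "\<bar>V t w - \<sigma>\<^sup>2\<bar> \<le> \<eta>" "\<bar>\<Delta> t w\<bar> \<le> (c + r) * \<sigma>\<^sup>2" using w by (auto simp: bad_def)
        have "(\<integral>\<^sup>+ h. f h w \<partial>lborel) \<le> ennreal \<kappa> * (\<integral>\<^sup>+ h. u h w \<partial>lborel)"
          unfolding f_def u_def \<kappa>_def c'_def
        proof (rule posterior_window_bound[OF \<sigma>_pos W r(1) _ _ _ _ _ good(2)])
          have [measurable]: "(\<lambda>h. w) \<in> measurable borel (sample t)" using w by simp
          show "(\<lambda>h. lik t h w) \<in> borel_measurable borel" by measurable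
          fix h assume h: "\<bar>h\<bar> \<le> c + 2 * r"
          then have h': "\<bar>h\<bar> \<le> c'" by (simp add: c'_def)
          show "0 < lik t h w" by (rule lik_pos[OF \<alpha>[OF h']])
          have "\<bar>ln (lik t h w) - (h * \<Delta> t w - h\<^sup>2 * V t w / 2)\<bar> \<le> c' ^ 3 * K ^ 3 / sqrt t"
            using elim(1,2) h' by (intro ln_lik_expansion) auto
          moreover have "\<bar>h\<^sup>2 * V t w / 2 - h\<^sup>2 * \<sigma>\<^sup>2 / 2\<bar> \<le> \<rho> / 2"
          proof -
            have "\<bar>h\<^sup>2 * V t w / 2 - h\<^sup>2 * \<sigma>\<^sup>2 / 2\<bar> = h\<^sup>2 * \<bar>V t w - \<sigma>\<^sup>2\<bar> / 2"
              by (simp add: abs_mult diff_divide_distrib[symmetric] right_diff_distrib[symmetric])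
            also have "\<dots> \<le> c'\<^sup>2 * \<eta> / 2"
              using h' good(1) c by (intro divide_right_mono mult_mono) (auto simp: abs_le_square_iff[symmetric])
            also have "\<dots> = \<rho> / 2" using c by (simp add: \<eta>_def)
            finally show ?thesis .
          qed
          ultimately show "\<bar>ln (lik t h w) - (h * \<Delta> t w - h\<^sup>2 * \<sigma>\<^sup>2 / 2)\<bar> \<le> \<rho>" using elim(3) by linarith
        qed (use \<rho> c in auto)
        then show ?thesis by (simp add: add_increasing2)
      qed
      have "(\<integral>\<^sup>+ h. \<integral>\<^sup>+ w. f h w \<partial>sample t \<partial>lborel) = (\<integral>\<^sup>+ w. \<integral>\<^sup>+ h. f h w \<partial>lborel \<partial>sample t)"
        by (rule F.Fubini'[OF fm, symmetric])
      also have "\<dots> \<le> (\<integral>\<^sup>+ w. ennreal \<kappa> * (\<integral>\<^sup>+ h. u h w \<partial>lborel) + (\<integral>\<^sup>+ h. e h w \<partial>lborel) \<partial>sample t)"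
        by (rule nn_integral_mono) (rule pointwise)
      also have "\<dots> = ennreal \<kappa> * (\<integral>\<^sup>+ w. \<integral>\<^sup>+ h. u h w \<partial>lborel \<partial>sample t) + (\<integral>\<^sup>+ w. \<integral>\<^sup>+ h. e h w \<partial>lborel \<partial>sample t)"
        using um2 em2 by (simp add: nn_integral_add nn_integral_cmult)
      also have "(\<integral>\<^sup>+ w. \<integral>\<^sup>+ h. u h w \<partial>lborel \<partial>sample t) = (\<integral>\<^sup>+ h. \<integral>\<^sup>+ w. u h w \<partial>sample t \<partial>lborel)"
        by (rule F.Fubini'[OF um])
      also have "\<dots> = (\<integral>\<^sup>+ h. indicator {- c'..c'} h \<partial>lborel)"
      proof (rule nn_integral_cong)
        fix h
        show "(\<integral>\<^sup>+ w. u h w \<partial>sample t) = indicator {- c'..c'} h"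
        proof (cases "h \<in> {- c'..c'}")
          case True
          then have "\<bar>h\<bar> \<le> c'" by auto
          from lik_mass[OF \<alpha>[OF this]] show ?thesis using True by (simp add: u_def)
        qed (simp add: u_def)
      qed
      also have "\<dots> = ennreal (2 * c')" using c by simp
      also have "(\<integral>\<^sup>+ w. \<integral>\<^sup>+ h. e h w \<partial>lborel \<partial>sample t) = (\<integral>\<^sup>+ h. \<integral>\<^sup>+ w. e h w \<partial>sample t \<partial>lborel)"
        by (rule F.Fubini'[OF em])
      also have "\<dots> \<le> (\<integral>\<^sup>+ h. ennreal (Wm * pb) * indicator {- c..c} h \<partial>lborel)"
      proof (rule nn_integral_mono)
        fix h
        show "(\<integral>\<^sup>+ w. e h w \<partial>sample t) \<le> ennreal (Wm * pb) * indicator {- c..c} h"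
        proof (cases "h \<in> {- c..c}")
          case True
          have "(\<integral>\<^sup>+ w. e h w \<partial>sample t) = (\<integral>\<^sup>+ w. ennreal Wm * (indicator bad w * ennreal (lik t h w)) \<partial>sample t)"
            using True by (simp add: e_def mult_ac)
          also have "\<dots> = ennreal Wm * (\<integral>\<^sup>+ w. indicator bad w * ennreal (lik t h w) \<partial>sample t)"
            by (rule nn_integral_cmult) measurable
          also have "\<dots> \<le> ennreal Wm * ennreal pb" by (intro mult_left_mono bad_mass True) simp
          finally show ?thesis using True Wm0 pb by (simp add: ennreal_mult)
        qed (simp add: e_def)
      qed
      also have "\<dots> = ennreal (Wm * pb) * ennreal (2 * c)"
        using c by (simp add: nn_integral_cmult_indicator)
      finally have "(\<integral>\<^sup>+ h. \<integral>\<^sup>+ w. f h w \<partial>sample t \<partial>lborel) \<le> ennreal \<kappa> * ennreal (2 * c') + ennreal (Wm * pb) * ennreal (2 * c)"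
        by (simp add: add_left_mono)
      with lower have "ennreal ((\<omega> + \<epsilon>) * (2 * c)) \<le> ennreal \<kappa> * ennreal (2 * c') + ennreal (Wm * pb) * ennreal (2 * c)"
        by (rule order_trans)
      also have "\<dots> = ennreal (\<kappa> * (2 * c') + Wm * pb * (2 * c))"
        using \<kappa>0 c Wm0 pb by (simp add: ennreal_mult[symmetric] ennreal_plus[symmetric] del: ennreal_plus)
      finally have "(\<omega> + \<epsilon>) * (2 * c) \<le> \<kappa> * (2 * c') + Wm * pb * (2 * c)"
        by (rule ennreal_le_iff[THEN iffD1, rotated]) (use \<kappa>0 c Wm0 pb in auto)
      also have "\<dots> = (\<kappa> * (1 + 2 / r) + Wm * pb) * (2 * c)" unfolding c_ratio by (simp add: algebra_simps)
      also have "\<dots> < (\<omega> + \<epsilon>) * (2 * c)"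
        using r(2) pb(2) c \<epsilon> by (intro mult_strict_right_mono) (auto simp: \<kappa>_def \<rho>_def)
      finally show False by simp
    qed
  qed
  then show ?thesis using c(1) by (rule that[rotated])
qed

end

section \<open>Symmetric quasi-convex losses\<close>

text \<open>
Subtracting a lower bound turns the extended expectation into an integral of a nonnegative function, to which
monotone arguments and Fatou's lemma apply.
\<close>

lemma ext_exp_shift:
  assumes N: "prob_space N" and f[measurable]: "f \<in> borel_measurable N" and ge: "\<And>x. a \<le> f x"
  shows "ext_exp N f = ereal a + enn2ereal (\<integral>\<^sup>+ x. ennreal (f x - a) \<partial>N)"
proof -
  interpret prob_space N by (rule N)
  let ?I = "\<integral>\<^sup>+ x. ennreal (f x - a) \<partial>N" and ?p = "\<integral>\<^sup>+ x. ennreal (f x) \<partial>N" and ?n = "\<integral>\<^sup>+ x. ennreal (- f x) \<partial>N"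
  have pt: "ennreal (f x - a) + ennreal (- f x) + ennreal a = ennreal (f x) + ennreal (- a)" for x
  proof (cases "0 \<le> a")
    case True
    then show ?thesis using ge[of x] by (simp add: ennreal_neg ennreal_plus[symmetric] del: ennreal_plus)
  next
    case False
    then show ?thesis using ge[of x]
      by (cases "0 \<le> f x") (simp_all add: ennreal_neg ennreal_plus[symmetric] del: ennreal_plus)
  qed
  have "?I + ?n + ennreal a = (\<integral>\<^sup>+ x. ennreal (f x - a) + ennreal (- f x) + ennreal a \<partial>N)"
    by (simp add: nn_integral_add emeasure_space_1)
  also have "\<dots> = ?p + ennreal (- a)"
    unfolding pt by (simp add: nn_integral_add emeasure_space_1)
  finally have bal: "?I + ?n + ennreal a = ?p + ennreal (- a)" .
  have "?n \<le> (\<integral>\<^sup>+ x. ennreal (- a) \<partial>N)" using ge by (intro nn_integral_mono ennreal_leI) simp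
  then have n: "?n \<le> ennreal (- a)" by (simp add: emeasure_space_1)
  then have "?n < top" by (rule le_less_trans) simp
  then obtain n where n': "?n = ennreal n" "0 \<le> n" by (cases ?n) auto
  show ?thesis
  proof (cases "0 \<le> a")
    case True
    then have "?n = 0" using n by (simp add: ennreal_neg)
    then have "?p = ?I + ennreal a" using bal True by (simp add: ennreal_neg)
    then have "enn2ereal ?p = enn2ereal ?I + ereal a" using True by (simp add: plus_ennreal.rep_eq)
    then show ?thesis using \<open>?n = 0\<close> by (simp add: ext_exp_def add.commute zero_ennreal.rep_eq)
  next
    case False
    then have "?I + ennreal n = ?p + ennreal (- a)" using bal n' by (simp add: ennreal_neg)
    then have "enn2ereal ?I + ereal n = enn2ereal ?p + ereal (- a)"
      using n' False by (metis enn2ereal_ennreal plus_ennreal.rep_eq less_eq_real_def neg_0_le_iff_le not_le)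
    then show ?thesis
      unfolding ext_exp_def n'(1) using n'(2)
      by (cases "enn2ereal ?p"; cases "enn2ereal ?I") (auto simp: algebra_simps)
  qed
qed

locale loss =
  fixes L :: "real \<Rightarrow> real"
  assumes sym: "symmetric_loss L" and qc: "quasi_convex L"
begin

text \<open>
A sublevel set that contains \<open>y\<close> contains \<open>- y\<close>, and therefore the interval between them.
\<close>

lemma mono_abs: assumes "\<bar>x\<bar> \<le> \<bar>y\<bar>" shows "L x \<le> L y"
proof -
  have "convex {z. L z \<le> L y}" using qc by (simp add: quasi_convex_def)
  moreover have "- \<bar>y\<bar> \<in> {z. L z \<le> L y}" "\<bar>y\<bar> \<in> {z. L z \<le> L y}"
    using sym by (auto simp: symmetric_loss_def abs_if)
  ultimately have "closed_segment (- \<bar>y\<bar>) \<bar>y\<bar> \<subseteq> {z. L z \<le> L y}" by (simp add: closed_segment_subset)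
  moreover have "x \<in> closed_segment (- \<bar>y\<bar>) \<bar>y\<bar>"
    using assms by (auto simp: closed_segment_eq_real_ivl abs_le_iff)
  ultimately show ?thesis by blast
qed

lemma ge_0: "L 0 \<le> L x"
  by (rule mono_abs) simp

text \<open>
The loss as a monotone function on the whole line, to which the countability of the discontinuities
of monotone functions applies.
\<close>

definition profile :: "real \<Rightarrow> real" where "profile y = L (max y 0)"

lemma profile_mono: "mono profile"
  unfolding profile_def by (intro monoI mono_abs) auto

lemma eq_profile: "L x = profile \<bar>x\<bar>"
  unfolding profile_def by (intro antisym mono_abs) auto

lemma measurable_L [measurable]: "L \<in> borel_measurable borel"
proof -
  have [measurable]: "profile \<in> borel_measurable borel" by (rule borel_measurable_mono[OF profile_mono])
  have "(\<lambda>x. profile \<bar>x\<bar>) \<in> borel_measurable borel" by measurable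
  then show ?thesis by (rule measurable_cong[THEN iffD2, rotated]) (rule eq_profile)
qed

text \<open>
Increments of the loss over the grid of mesh \<open>1 / n\<close>: the step heights of a staircase below the loss.
\<close>

definition jump :: "nat \<Rightarrow> nat \<Rightarrow> real" where
  "jump n k = L (real k / real n) - L (real (k - 1) / real n)"

lemma jump_nonneg: "0 \<le> jump n k"
proof -
  have "real (k - 1) / real n \<le> real k / real n" by (intro divide_right_mono) auto
  then have "L (real (k - 1) / real n) \<le> L (real k / real n)" by (intro mono_abs) auto
  then show ?thesis by (simp add: jump_def)
qed

lemma sum_jump: "(\<Sum>k=1..m. jump n k) = L (real m / real n) - L 0"
  by (induction m) (auto simp: jump_def)

lemma staircase_le:
  "(\<Sum>k=1..m. jump n k * of_bool (real k / real n < \<bar>x\<bar>)) \<le> L x - L 0"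
proof (induction m)
  case 0
  then show ?case using ge_0[of x] by simp
next
  case (Suc m)
  show ?case
  proof (cases "real (Suc m) / real n < \<bar>x\<bar>")
    case True
    have "(\<Sum>k=1..Suc m. jump n k * of_bool (real k / real n < \<bar>x\<bar>)) \<le> (\<Sum>k=1..Suc m. jump n k)"
      using jump_nonneg by (intro sum_mono) auto
    also have "\<dots> = L (real (Suc m) / real n) - L 0" by (rule sum_jump)
    also have "\<dots> \<le> L x - L 0" using True by (intro diff_right_mono mono_abs) auto
    finally show ?thesis .
  next
    case False
    then show ?thesis using Suc.IH by simp
  qed
qed

lemma staircase_ge:
  assumes "j \<le> m" and "real (j + 1) / real n < \<bar>x\<bar>"
  shows "L (real j / real n) - L 0 \<le> (\<Sum>k=1..m. jump n k * of_bool (real (k + 1) / real n < \<bar>x\<bar>))"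
proof -
  have "L (real j / real n) - L 0 = (\<Sum>k=1..j. jump n k)" by (rule sum_jump[symmetric])
  also have "\<dots> = (\<Sum>k=1..j. jump n k * of_bool (real (k + 1) / real n < \<bar>x\<bar>))"
  proof (rule sum.cong[OF refl])
    fix k assume "k \<in> {1..j}"
    then have "real (k + 1) / real n \<le> real (j + 1) / real n" by (intro divide_right_mono) auto
    then have "real (k + 1) / real n < \<bar>x\<bar>" using assms(2) by linarith
    then show "jump n k = jump n k * of_bool (real (k + 1) / real n < \<bar>x\<bar>)" by simp
  qed
  also have "\<dots> \<le> (\<Sum>k=1..m. jump n k * of_bool (real (k + 1) / real n < \<bar>x\<bar>))"
    using assms(1) jump_nonneg by (intro sum_mono2) auto
  finally show ?thesis .
qed

text \<open>
The largest step that lies below \<open>\<bar>x\<bar>\<close> after moving outwards by one grid cell is at \<open>j n / n\<close>, which converges to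
\<open>\<bar>x\<bar>\<close> from below.
\<close>

lemma staircase_liminf:
  assumes cont: "isCont profile \<bar>x\<bar>"
  shows "ennreal (L x - L 0) \<le> liminf (\<lambda>n. ennreal (\<Sum>k=1..n\<^sup>2. jump n k * of_bool (real (k + 1) / real n < \<bar>x\<bar>)))"
proof (cases "x = 0")
  case False
  define j where "j n = nat (\<lceil>real n * \<bar>x\<bar>\<rceil> - 2)" for n
  have big: "\<forall>\<^sub>F n in sequentially. max (2 / \<bar>x\<bar>) (\<bar>x\<bar> + 1) < real n"
    by (rule eventually_compose_filterlim[OF eventually_gt_at_top filterlim_real_sequentially])
  have j: "j n \<le> n\<^sup>2 \<and> real (j n + 1) / real n < \<bar>x\<bar> \<and> \<bar>x\<bar> - 2 / real n \<le> real (j n) / real n"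
    if n: "max (2 / \<bar>x\<bar>) (\<bar>x\<bar> + 1) < real n" for n
  proof -
    have n0: "0 < real n" and "\<bar>x\<bar> \<le> real n" using n abs_ge_zero[of x] by linarith+
    have "2 < real n * \<bar>x\<bar>" using n False n0 by (simp add: field_simps)
    then have eq: "real (j n) = of_int \<lceil>real n * \<bar>x\<bar>\<rceil> - 2" unfolding j_def by (subst of_nat_nat) auto
    have up: "real (j n) + 1 < real n * \<bar>x\<bar>" unfolding eq by linarith
    have lo: "real n * \<bar>x\<bar> - 2 \<le> real (j n)" unfolding eq by linarith
    have "real (j n) \<le> real n * real n"
      using up \<open>\<bar>x\<bar> \<le> real n\<close> n0 mult_left_mono[of "\<bar>x\<bar>" "real n" "real n"] by linarith
    then have "real (j n) \<le> real (n\<^sup>2)" by (simp add: power2_eq_square)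
    then have "j n \<le> n\<^sup>2" by (simp only: of_nat_le_iff)
    moreover have "real (j n + 1) / real n < \<bar>x\<bar>" using up n0 by (simp add: field_simps)
    moreover have "\<bar>x\<bar> - 2 / real n \<le> real (j n) / real n"
    proof -
      have "(real n * \<bar>x\<bar> - 2) / real n \<le> real (j n) / real n" using lo by (rule divide_right_mono) simp
      then show ?thesis using n0 by (simp add: diff_divide_distrib)
    qed
    ultimately show ?thesis by blast
  qed
  have "(\<lambda>n. real (j n) / real n) \<longlonglongrightarrow> \<bar>x\<bar>"
  proof (rule tendsto_sandwich)
    show "\<forall>\<^sub>F n in sequentially. \<bar>x\<bar> - 2 / real n \<le> real (j n) / real n"
      using big by eventually_elim (use j in auto)
    show "\<forall>\<^sub>F n in sequentially. real (j n) / real n \<le> \<bar>x\<bar>"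
      using big
    proof eventually_elim
      case (elim n)
      have "real (j n) / real n \<le> real (j n + 1) / real n" by (intro divide_right_mono) auto
      then show ?case using j[OF elim] by linarith
    qed
    show "(\<lambda>n. \<bar>x\<bar> - 2 / real n) \<longlonglongrightarrow> \<bar>x\<bar>" by real_asymp
  qed simp
  then have "(\<lambda>n. profile (real (j n) / real n)) \<longlonglongrightarrow> profile \<bar>x\<bar>"
    by (rule isCont_tendsto_compose[OF cont])
  moreover have "profile (real (j n) / real n) = L (real (j n) / real n)" for n by (simp add: profile_def)
  ultimately have "(\<lambda>n. ennreal (L (real (j n) / real n) - L 0)) \<longlonglongrightarrow> ennreal (L x - L 0)"
    unfolding eq_profile[of x] by (intro tendsto_ennrealI tendsto_diff tendsto_const) simp
  then have "ennreal (L x - L 0) = liminf (\<lambda>n. ennreal (L (real (j n) / real n) - L 0))"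
    by (intro lim_imp_Liminf[symmetric]) auto
  also have "\<dots> \<le> liminf (\<lambda>n. ennreal (\<Sum>k=1..n\<^sup>2. jump n k * of_bool (real (k + 1) / real n < \<bar>x\<bar>)))"
  proof (rule Liminf_mono)
    show "\<forall>\<^sub>F n in sequentially. ennreal (L (real (j n) / real n) - L 0)
        \<le> ennreal (\<Sum>k=1..n\<^sup>2. jump n k * of_bool (real (k + 1) / real n < \<bar>x\<bar>))"
      using big
    proof eventually_elim
      case (elim n)
      show ?case using j[OF elim] by (intro ennreal_leI staircase_ge) blast+
    qed
  qed
  finally show ?thesis .
qed simp

text \<open>
Normal risk of the staircase whose steps are moved outwards by one further grid cell. The extra cell
absorbs the error made when the revenue is replaced by its linearization.
\<close>

definition staircase_risk :: "real \<Rightarrow> nat \<Rightarrow> real" where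
  "staircase_risk \<sigma> n = (\<Sum>k=1..n\<^sup>2. jump n k * (1 - central_mass (real (k + 1) / real n / \<sigma>)))"

lemma central_mass_le_1: "central_mass z \<le> 1"
proof -
  interpret prob_space "density lborel std_normal_density" by (rule prob_space_normal_density) simp
  show ?thesis by (simp add: central_mass_def)
qed

lemma staircase_risk_nonneg: "0 \<le> staircase_risk \<sigma> n"
  unfolding staircase_risk_def using jump_nonneg central_mass_le_1
  by (intro sum_nonneg mult_nonneg_nonneg) auto

lemma normal_staircase:
  assumes \<sigma>: "0 < \<sigma>"
  shows "(\<integral>\<^sup>+ z. ennreal (\<Sum>k=1..n\<^sup>2. jump n k * of_bool (real (k + 1) / real n < \<bar>\<sigma> * z\<bar>)) \<partial>density lborel std_normal_density)
    = ennreal (staircase_risk \<sigma> n)"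
proof -
  let ?N = "density lborel std_normal_density"
  interpret prob_space ?N by (rule prob_space_normal_density) simp
  let ?a = "\<lambda>k. real (k + 1) / real n / \<sigma>"
  have "(\<integral>\<^sup>+ z. ennreal (\<Sum>k=1..n\<^sup>2. jump n k * of_bool (real (k + 1) / real n < \<bar>\<sigma> * z\<bar>)) \<partial>?N)
      = (\<integral>\<^sup>+ z. (\<Sum>k=1..n\<^sup>2. ennreal (jump n k) * indicator (UNIV - {- ?a k..?a k}) z) \<partial>?N)"
  proof (rule nn_integral_cong)
    fix z
    have "ennreal (\<Sum>k=1..n\<^sup>2. jump n k * of_bool (real (k + 1) / real n < \<bar>\<sigma> * z\<bar>))
        = (\<Sum>k=1..n\<^sup>2. ennreal (jump n k * of_bool (real (k + 1) / real n < \<bar>\<sigma> * z\<bar>)))"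
      using jump_nonneg by (intro sum_ennreal[symmetric]) auto
    also have "\<dots> = (\<Sum>k=1..n\<^sup>2. ennreal (jump n k) * indicator (UNIV - {- ?a k..?a k}) z)"
    proof (rule sum.cong[OF refl])
      fix k
      have "real (k + 1) / real n < \<bar>\<sigma> * z\<bar> \<longleftrightarrow> ?a k < \<bar>z\<bar>"
        using \<sigma> by (simp only: abs_mult abs_of_pos pos_divide_less_eq mult.commute)
      also have "\<dots> \<longleftrightarrow> z \<in> UNIV - {- ?a k..?a k}"
        unfolding Diff_iff atLeastAtMost_iff by (simp only: UNIV_I simp_thms) linarith
      finally show "ennreal (jump n k * of_bool (real (k + 1) / real n < \<bar>\<sigma> * z\<bar>))
          = ennreal (jump n k) * indicator (UNIV - {- ?a k..?a k}) z"
        by (simp only: indicator_def) (simp add: of_bool_def)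
    qed
    finally show "ennreal (\<Sum>k=1..n\<^sup>2. jump n k * of_bool (real (k + 1) / real n < \<bar>\<sigma> * z\<bar>))
        = (\<Sum>k=1..n\<^sup>2. ennreal (jump n k) * indicator (UNIV - {- ?a k..?a k}) z)" .
  qed
  also have "\<dots> = (\<Sum>k=1..n\<^sup>2. ennreal (jump n k) * emeasure ?N (UNIV - {- ?a k..?a k}))"
    by (subst nn_integral_sum) (auto simp: nn_integral_cmult_indicator)
  also have "\<dots> = (\<Sum>k=1..n\<^sup>2. ennreal (jump n k * (1 - central_mass (?a k))))"
  proof (rule sum.cong[OF refl])
    fix k
    have "prob (UNIV - {- ?a k..?a k}) = 1 - central_mass (?a k)"
      using prob_compl[of "{- ?a k..?a k}"] by (simp add: central_mass_def)
    then show "ennreal (jump n k) * emeasure ?N (UNIV - {- ?a k..?a k}) = ennreal (jump n k * (1 - central_mass (?a k)))"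
      using jump_nonneg central_mass_le_1 by (simp only: emeasure_eq_measure) (simp add: ennreal_mult)
  qed
  also have "\<dots> = ennreal (staircase_risk \<sigma> n)"
    unfolding staircase_risk_def using jump_nonneg central_mass_le_1
    by (intro sum_ennreal mult_nonneg_nonneg) auto
  finally show ?thesis .
qed

text \<open>
The staircases recover the loss at its points of continuity, which are almost all points. Fatou's lemma passes to
the integrals.
\<close>

lemma normal_risk_le_liminf:
  assumes \<sigma>: "0 < \<sigma>"
  shows "(\<integral>\<^sup>+ z. ennreal (L (\<sigma> * z) - L 0) \<partial>density lborel std_normal_density)
    \<le> liminf (\<lambda>n. ennreal (staircase_risk \<sigma> n))"
proof -
  let ?N = "density lborel std_normal_density"
  let ?J = "\<lambda>n z. ennreal (\<Sum>k=1..n\<^sup>2. jump n k * of_bool (real (k + 1) / real n < \<bar>\<sigma> * z\<bar>))"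
  define D where "D = {y. \<not> isCont profile y}"
  have "countable D" unfolding D_def by (rule mono_ctble_discont[OF profile_mono])
  then have "countable ((\<lambda>y. y / \<sigma>) ` D \<union> (\<lambda>y. - y / \<sigma>) ` D)" by simp
  then have "AE z in lborel. z \<notin> (\<lambda>y. y / \<sigma>) ` D \<union> (\<lambda>y. - y / \<sigma>) ` D"
    by (intro AE_not_in countable_imp_null_set_lborel)
  then have "AE z in lborel. isCont profile \<bar>\<sigma> * z\<bar>"
  proof eventually_elim
    case (elim z)
    show ?case
    proof (rule ccontr)
      assume "\<not> isCont profile \<bar>\<sigma> * z\<bar>"
      then have "\<bar>\<sigma> * z\<bar> \<in> D" by (simp add: D_def)
      moreover have "z = \<bar>\<sigma> * z\<bar> / \<sigma> \<or> z = - \<bar>\<sigma> * z\<bar> / \<sigma>" using \<sigma> by (auto simp: abs_mult abs_if)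
      ultimately show False using elim by blast
    qed
  qed
  then have ae: "AE z in ?N. isCont profile \<bar>\<sigma> * z\<bar>" by (subst AE_density) (auto elim: eventually_mono)
  have "(\<integral>\<^sup>+ z. ennreal (L (\<sigma> * z) - L 0) \<partial>?N) \<le> (\<integral>\<^sup>+ z. liminf (\<lambda>n. ?J n z) \<partial>?N)"
  proof (rule nn_integral_mono_AE)
    show "AE z in ?N. ennreal (L (\<sigma> * z) - L 0) \<le> liminf (\<lambda>n. ?J n z)"
      using ae by eventually_elim (rule staircase_liminf)
  qed
  also have "\<dots> \<le> liminf (\<lambda>n. \<integral>\<^sup>+ z. ?J n z \<partial>?N)"
    by (rule nn_integral_liminf) measurable
  also have "\<dots> = liminf (\<lambda>n. ennreal (staircase_risk \<sigma> n))"
    by (simp only: normal_staircase[OF \<sigma>])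
  finally show ?thesis .
qed

end

section \<open>The local asymptotic risk\<close>

text \<open>
A monotone function has a limit at infinity, namely its supremum.
\<close>

lemma Lim_at_top_mono_ge:
  fixes R :: "real \<Rightarrow> ereal"
  assumes mono: "\<And>a c. a \<le> c \<Longrightarrow> R a \<le> R c"
  shows "R c0 \<le> Lim at_top R"
proof -
  have "(R \<longlongrightarrow> (SUP c. R c)) at_top"
  proof (rule increasing_tendsto)
    show "\<forall>\<^sub>F c in at_top. R c \<le> (SUP c. R c)" by (intro always_eventually allI SUP_upper) auto
    fix y assume "y < (SUP c. R c)"
    then obtain c1 where "y < R c1" by (auto simp: less_SUP_iff)
    then show "\<forall>\<^sub>F c in at_top. y < R c"
      using eventually_ge_at_top[of c1] mono by (metis (mono_tags, lifting) eventually_mono less_le_trans)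
  qed
  then have "Lim at_top R = (SUP c. R c)" by (intro tendsto_Lim) auto
  then show ?thesis by (simp add: SUP_upper)
qed

text \<open>
Separates the limit in the radius \<open>c\<close> of \<open>LAR_REV\<close> from the lower limit in the sample size.
\<close>

definition local_risk ::
  "'a measure \<Rightarrow> real ^ 'n::finite \<Rightarrow> ('n \<Rightarrow> 'a \<Rightarrow> real) \<Rightarrow> ('a \<Rightarrow> real) \<Rightarrow> (real \<Rightarrow> real) \<Rightarrow>
   (nat \<Rightarrow> (nat \<Rightarrow> 'a) \<Rightarrow> real) \<Rightarrow> nat \<Rightarrow> (nat \<Rightarrow> 'a \<Rightarrow> real) \<Rightarrow> real \<Rightarrow> ereal" where
  "local_risk M b v s L r d g c = liminf (\<lambda>t. SUP \<alpha> \<in> local_params M s d g (c / sqrt (real t)).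
      risk M b v L r t (perturbed_supply M s d g \<alpha>))"

lemma local_risk_mono:
  assumes "a \<le> c" shows "local_risk M b v s L r d g a \<le> local_risk M b v s L r d g c"
  unfolding local_risk_def
proof (intro Liminf_mono always_eventually allI SUP_subset_mono order_refl)
  fix t
  have "a / sqrt (real t) \<le> c / sqrt (real t)" using assms by (intro divide_right_mono) auto
  then show "local_params M s d g (a / sqrt (real t)) \<subseteq> local_params M s d g (c / sqrt (real t))"
    by (auto simp: local_params_def)
qed

lemma local_risk_le_LAR:
  assumes "g \<in> G_dirs M s d"
  shows "local_risk M b v s L r d g c \<le> LAR_REV M b v s L r"
proof -
  have "local_risk M b v s L r d g c \<le> Lim at_top (local_risk M b v s L r d g)"
    by (rule Lim_at_top_mono_ge) (rule local_risk_mono)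
  also have "\<dots> \<le> LAR_REV M b v s L r"
    unfolding LAR_REV_def local_risk_def[abs_def]
    by (rule SUP_upper2[of "(d, g)"]) (use assms in auto)
  finally show ?thesis .
qed

locale tilted_loss = tilted_market M b v s g K + loss L
  for M :: "'a measure" and b :: "real ^ 'n::finite" and v s g K L +
  fixes r :: "nat \<Rightarrow> (nat \<Rightarrow> 'a) \<Rightarrow> real"
  assumes r: "r \<in> estimators M"
begin

definition P :: "'a measure" where "P = density M (\<lambda>\<theta>. ennreal (s \<theta>))"

lemma prob_space_P: "prob_space P"
proof
  have "emeasure P (space P) = (\<integral>\<^sup>+ \<theta>. ennreal (s \<theta>) \<partial>M)"
    by (simp add: P_def emeasure_density cong: nn_integral_cong)
  also have "\<dots> = ennreal (\<integral>\<theta>. s \<theta> \<partial>M)" by (rule nn_integral_eq_integral[OF s_integrable s_nonneg])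
  finally show "emeasure P (space P) = 1" using market by (simp add: market_def)
qed

lemma expectation_P: "f \<in> borel_measurable M \<Longrightarrow> (\<integral>\<theta>. f \<theta> \<partial>P) = E f"
  unfolding P_def supply_exp_def using s_nonneg by (subst integral_density) (auto simp: mult.commute)

lemma perturbed_supply_tilted: "perturbed_supply M s 1 (\<lambda>_. g) \<alpha> = T (\<alpha> 0)"
proof -
  have sd: "score_dot 1 \<alpha> (\<lambda>_. g) = (\<lambda>\<theta>. \<alpha> 0 * g \<theta>)" by (simp add: score_dot_def fun_eq_iff)
  show ?thesis
    unfolding perturbed_supply_def[abs_def] tilted_supply_def[abs_def] sd E_cmult g_mean by simp
qed

lemma g_in_G_dirs: "(\<lambda>_. g) \<in> G_dirs M s 1"
  using E_integrable[OF ess_bounded_mult[OF g_bounded g_bounded]] g_mean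
  by (simp add: G_dirs_def power2_eq_square)

lemma tilted_in_local_params:
  assumes "\<bar>a\<bar> \<le> 1 / (2 * K)" "\<bar>a\<bar> \<le> \<rho>"
  shows "(\<lambda>_. a) \<in> local_params M s 1 (\<lambda>_. g) \<rho>"
  using assms tilted_supply_Linf[of a] unfolding local_params_def perturbed_supply_tilted
  by (simp add: L2_set_def)

lemma estimator_measurable:
  assumes "sets Q = sets M"
  shows "r t \<in> borel_measurable (PiM {..<t} (\<lambda>_. Q))"
proof -
  have "sets (PiM {..<t} (\<lambda>_. Q)) = sets (PiM {..<t} (\<lambda>_. M))"
    using assms by (intro sets_PiM_cong) auto
  moreover have "r t \<in> borel_measurable (PiM {..<t} (\<lambda>_. M))" using r by (simp add: estimators_def)
  ultimately show ?thesis by (simp cong: measurable_cong_sets)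
qed

lemma risk_tilted:
  assumes a: "\<bar>a\<bar> \<le> 1 / (2 * K)"
  shows "risk M b v L r t (T a) = ereal (L 0) + enn2ereal (\<integral>\<^sup>+ w.
      ennreal (L (sqrt t * (r t w - FPPE_revenue M b v (T a))) - L 0)
      \<partial>PiM {..<t} (\<lambda>_. density P (\<lambda>\<theta>. ennreal (1 + a * g \<theta>))))"
proof -
  let ?Q = "density P (\<lambda>\<theta>. ennreal (1 + a * g \<theta>))"
  have [measurable]: "(\<lambda>\<theta>. ennreal (1 + a * g \<theta>)) \<in> borel_measurable M" by measurable
  have Q: "density M (\<lambda>\<theta>. ennreal (T a \<theta>)) = ?Q"
  proof -
    have "?Q = density M (\<lambda>\<theta>. ennreal (s \<theta>) * ennreal (1 + a * g \<theta>))"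
      unfolding P_def by (rule density_density_eq) measurable
    also have "\<dots> = density M (\<lambda>\<theta>. ennreal (T a \<theta>))"
    proof (rule density_cong)
      have "0 \<le> 1 + a * g \<theta>" for \<theta> using tilt_weight(1)[OF a, of \<theta>] by linarith
      then show "AE \<theta> in M. ennreal (s \<theta>) * ennreal (1 + a * g \<theta>) = ennreal (T a \<theta>)"
        using s_nonneg by (auto simp: tilted_supply_def ennreal_mult[symmetric] mult.commute elim!: eventually_mono)
      show "(\<lambda>\<theta>. ennreal (T a \<theta>)) \<in> borel_measurable M" unfolding tilted_supply_def by measurable
    qed measurable
    finally show ?thesis by simp
  qed
  interpret t: market_env M b v "T a" by unfold_locales (rule market_tilted[OF a])
  have pQ: "prob_space ?Q"
    unfolding Q[symmetric]
  proof
    have "emeasure (density M (\<lambda>\<theta>. ennreal (T a \<theta>))) (space (density M (\<lambda>\<theta>. ennreal (T a \<theta>))))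
        = (\<integral>\<^sup>+ \<theta>. ennreal (T a \<theta>) \<partial>M)"
      by (simp add: emeasure_density cong: nn_integral_cong)
    also have "\<dots> = ennreal (\<integral>\<theta>. T a \<theta> \<partial>M)" by (rule nn_integral_eq_integral[OF t.s_integrable t.s_nonneg])
    finally show "emeasure (density M (\<lambda>\<theta>. ennreal (T a \<theta>))) (space (density M (\<lambda>\<theta>. ennreal (T a \<theta>)))) = 1"
      using t.market by (simp add: market_def)
  qed
  have [measurable]: "r t \<in> borel_measurable (PiM {..<t} (\<lambda>_. ?Q))"
    by (rule estimator_measurable) (simp add: P_def)
  show "risk M b v L r t (T a) = ereal (L 0) + enn2ereal (\<integral>\<^sup>+ w.
      ennreal (L (sqrt t * (r t w - FPPE_revenue M b v (T a))) - L 0) \<partial>PiM {..<t} (\<lambda>_. ?Q))"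
    unfolding risk_def iid_law_def Q
  proof (rule ext_exp_shift)
    show "prob_space (PiM {..<t} (\<lambda>_. ?Q))" by (rule prob_space_PiM) (rule pQ)
    show "(\<lambda>w. L (sqrt t * (r t w - FPPE_revenue M b v (T a)))) \<in> borel_measurable (PiM {..<t} (\<lambda>_. ?Q))"
      by measurable
  qed (rule ge_0)
qed

lemma local_risk_ge_L0: "ereal (L 0) \<le> local_risk M b v s L r 1 (\<lambda>_. g) 0"
  unfolding local_risk_def
proof (intro Liminf_bounded always_eventually allI)
  fix t
  have K: "\<bar>0::real\<bar> \<le> 1 / (2 * K)" using K_pos by simp
  show "ereal (L 0) \<le> (SUP \<alpha> \<in> local_params M s 1 (\<lambda>_. g) (0 / sqrt (real t)).
      risk M b v L r t (perturbed_supply M s 1 (\<lambda>_. g) \<alpha>))"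
  proof (rule SUP_upper2)
    show "(\<lambda>_. 0) \<in> local_params M s 1 (\<lambda>_. g) (0 / sqrt (real t))"
      by (rule tilted_in_local_params[OF K]) simp
    show "ereal (L 0) \<le> risk M b v L r t (perturbed_supply M s 1 (\<lambda>_. g) (\<lambda>_. 0))"
      unfolding perturbed_supply_tilted risk_tilted[OF K] by (simp add: add_increasing2)
  qed
qed

text \<open>
Rescale the estimator to the estimator \<open>X\<close> of the local parameter \<open>h\<close>. If the loss argument is at most \<open>k / n\<close>, then \<open>X\<close>
lies within \<open>A k\<close> of \<open>h\<close>: the linearization error of the revenue is at most \<open>1 / n\<close>, which is the reason for
\<open>k + 1\<close> in \<open>A k\<close>. So the loss is at least the total step height minus the gain \<open>W\<close>, and some \<open>h\<close> makes the expected gain small.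
\<close>

lemma local_risk_ge_staircase:
  assumes \<sigma>: "0 < \<sigma>" and var: "E (\<lambda>\<theta>. (g \<theta>)\<^sup>2) = \<sigma>\<^sup>2"
    and deriv: "((\<lambda>a. FPPE_revenue M b v (T a)) has_real_derivative \<sigma>\<^sup>2) (at 0)"
    and n: "0 < n" and \<epsilon>: "0 < \<epsilon>"
  shows "\<exists>c. ereal (L 0 + staircase_risk \<sigma> n - \<epsilon>) \<le> local_risk M b v s L r 1 (\<lambda>_. g) c"
proof -
  interpret S: score_model P g K \<sigma>
  proof (intro score_model.intro score_model_axioms.intro)
    show "prob_space P" by (rule prob_space_P)
    show "g \<in> borel_measurable P" by (simp add: P_def)
    show "prob_space.expectation P g = 0" by (simp add: expectation_P g_mean)
    show "prob_space.expectation P (\<lambda>\<theta>. (g \<theta>)\<^sup>2) = \<sigma>\<^sup>2" by (simp add: expectation_P var)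
    show "\<bar>g \<theta>\<bar> \<le> K" for \<theta> by (rule g_le)
  qed (rule K_pos \<sigma>)+
  define \<psi> where "\<psi> a = FPPE_revenue M b v (T a)" for a
  define A where "A k = real (k + 1) / real n / \<sigma>\<^sup>2" for k
  define W where "W y = (\<Sum>k=1..n\<^sup>2. jump n k * indicator {- A k..A k} y)" for y :: real
  define J where "J = (\<Sum>k=1..n\<^sup>2. jump n k)"
  define \<omega> where "\<omega> = (\<Sum>k=1..n\<^sup>2. jump n k * central_mass (A k / (1 / \<sigma>)))"
  have AW: "anderson_weight (1 / \<sigma>) W \<omega>"
    unfolding W_def \<omega>_def by (rule anderson_weight_windows) (use \<sigma> jump_nonneg in \<open>auto simp: A_def\<close>)
  have W_le: "W y \<le> J" for y
    unfolding W_def J_def using jump_nonneg by (intro sum_mono) (auto simp: indicator_def)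
  have J\<omega>: "staircase_risk \<sigma> n = J - \<omega>"
  proof -
    have "A k / (1 / \<sigma>) = real (k + 1) / real n / \<sigma>" for k
      using \<sigma> by (simp add: A_def power2_eq_square)
    then show ?thesis unfolding staircase_risk_def J_def \<omega>_def by (simp add: right_diff_distrib sum_subtractf)
  qed
  obtain c where c: "0 < c"
    "\<forall>\<^sub>F t in sequentially. \<forall>X \<in> borel_measurable (S.sample t). \<exists>h \<in> {- c..c}.
       (\<integral>w. W (X w - h) \<partial>PiM {..<t} (\<lambda>_. S.tilt (h / sqrt t))) \<le> \<omega> + \<epsilon>"
    using S.average_window_risk[OF AW W_le \<epsilon>] by blast
  \<comment> \<open>With this accuracy the linearization error, scaled by sqrt t, is at most 1 / n for all local parameters up to c.\<close>
  have "0 < 1 / (real n * c)" using n c by simp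
  moreover have "(\<psi> has_derivative (\<lambda>u. \<sigma>\<^sup>2 * u)) (at 0)"
    using deriv unfolding \<psi>_def[abs_def] has_field_derivative_def .
  ultimately obtain d where d: "0 < d"
    "\<And>a. \<bar>a\<bar> < d \<Longrightarrow> \<bar>\<psi> a - \<psi> 0 - \<sigma>\<^sup>2 * a\<bar> \<le> 1 / (real n * c) * \<bar>a\<bar>"
    unfolding has_derivative_at_alt real_norm_def diff_0_right by blast
  have small: "\<forall>\<^sub>F t in sequentially. c / sqrt (real t) < y" if "0 < y" for y
  proof -
    have "(\<lambda>t::nat. c / sqrt (real t)) \<longlonglongrightarrow> 0" by real_asymp
    then show ?thesis using that by (rule order_tendstoD(2))
  qed
  have "\<forall>\<^sub>F t in sequentially. (0::nat) < t" by (rule eventually_gt_at_top)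
  moreover have "\<forall>\<^sub>F t in sequentially. c / sqrt (real t) < d" using d(1) by (rule small)
  moreover have "\<forall>\<^sub>F t in sequentially. c / sqrt (real t) < 1 / (2 * K)" using K_pos by (intro small) simp
  ultimately have "\<forall>\<^sub>F t in sequentially. ereal (L 0 + staircase_risk \<sigma> n - \<epsilon>)
      \<le> (SUP \<alpha> \<in> local_params M s 1 (\<lambda>_. g) (c / sqrt (real t)).
          risk M b v L r t (perturbed_supply M s 1 (\<lambda>_. g) \<alpha>))"
    using c(2)
  proof eventually_elim
    case (elim t)
    define X where "X w = sqrt t * (r t w - \<psi> 0) / \<sigma>\<^sup>2" for w
    have "r t \<in> borel_measurable (S.sample t)" by (rule estimator_measurable) (simp add: P_def)
    then have "X \<in> borel_measurable (S.sample t)" unfolding X_def by measurable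
    with elim(4) obtain h where h: "h \<in> {- c..c}"
      "(\<integral>w. W (X w - h) \<partial>PiM {..<t} (\<lambda>_. S.tilt (h / sqrt t))) \<le> \<omega> + \<epsilon>" by blast
    let ?a = "h / sqrt t"
    let ?Q = "PiM {..<t} (\<lambda>_. S.tilt ?a)"
    have habs: "\<bar>h\<bar> \<le> c" using h(1) by auto
    then have ac: "\<bar>?a\<bar> \<le> c / sqrt t" by (simp add: divide_right_mono)
    then have aK: "\<bar>?a\<bar> \<le> 1 / (2 * K)" and ad: "\<bar>?a\<bar> < d" using elim(2,3) by linarith+
    have tilt: "density P (\<lambda>\<theta>. ennreal (1 + ?a * g \<theta>)) = S.tilt ?a" by (simp add: S.tilt_def)
    interpret Q: prob_space ?Q by (rule prob_space_PiM) (rule S.prob_space_tilt[OF aK])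
    have [measurable]: "r t \<in> borel_measurable ?Q"
      by (rule estimator_measurable) (simp only: S.tilt_def sets_density, simp add: P_def)
    have [measurable]: "W \<in> borel_measurable borel" using AW by (simp add: anderson_weight_def)
    have W0: "0 \<le> W y" for y using AW by (simp add: anderson_weight_def)
    have [measurable]: "X \<in> borel_measurable ?Q" unfolding X_def by measurable
    have int: "integrable ?Q (\<lambda>w. W (X w - h))"
      by (rule Q.integrable_const_bound[where B=J]) (use W0 W_le in auto)
    have shift: "\<bar>sqrt t * (\<psi> ?a - \<psi> 0) - \<sigma>\<^sup>2 * h\<bar> \<le> 1 / real n"
    proof -
      have "sqrt t * (\<psi> ?a - \<psi> 0) - \<sigma>\<^sup>2 * h = sqrt t * (\<psi> ?a - \<psi> 0 - \<sigma>\<^sup>2 * ?a)"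
        using elim(1) by (simp add: algebra_simps)
      also have "\<bar>\<dots>\<bar> = sqrt t * \<bar>\<psi> ?a - \<psi> 0 - \<sigma>\<^sup>2 * ?a\<bar>" by (simp add: abs_mult)
      also have "\<dots> \<le> sqrt t * (1 / (real n * c) * (c / sqrt t))"
      proof (rule mult_left_mono)
        have "1 / (real n * c) * \<bar>?a\<bar> \<le> 1 / (real n * c) * (c / sqrt t)"
          using ac c by (intro mult_left_mono) auto
        then show "\<bar>\<psi> ?a - \<psi> 0 - \<sigma>\<^sup>2 * ?a\<bar> \<le> 1 / (real n * c) * (c / sqrt t)" using d(2)[OF ad] by linarith
      qed simp
      also have "\<dots> = 1 / real n" using elim(1) c by simp
      finally show ?thesis .
    qed
    have pointwise: "J - W (X w - h) \<le> L (sqrt t * (r t w - \<psi> ?a)) - L 0" for w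
    proof -
      let ?x = "sqrt t * (r t w - \<psi> ?a)"
      have "J - W (X w - h) = (\<Sum>k=1..n\<^sup>2. jump n k * (1 - indicator {- A k..A k} (X w - h)))"
        unfolding J_def W_def by (simp add: right_diff_distrib sum_subtractf)
      also have "\<dots> \<le> (\<Sum>k=1..n\<^sup>2. jump n k * of_bool (real k / real n < \<bar>?x\<bar>))"
      proof (intro sum_mono mult_left_mono jump_nonneg)
        fix k
        show "1 - indicator {- A k..A k} (X w - h) \<le> (of_bool (real k / real n < \<bar>?x\<bar>) :: real)"
        proof (cases "real k / real n < \<bar>?x\<bar>")
          case False
          have "\<sigma>\<^sup>2 * X w = sqrt t * (r t w - \<psi> 0)" using \<sigma> by (simp add: X_def)
          then have "\<sigma>\<^sup>2 * (X w - h) = ?x + (sqrt t * (\<psi> ?a - \<psi> 0) - \<sigma>\<^sup>2 * h)"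
            by (simp add: algebra_simps)
          then have "\<bar>\<sigma>\<^sup>2 * (X w - h)\<bar> \<le> real k / real n + 1 / real n" using False shift by linarith
          then have "\<bar>X w - h\<bar> * \<sigma>\<^sup>2 \<le> real (k + 1) / real n"
            by (simp add: abs_mult add_divide_distrib mult.commute)
          then have "\<bar>X w - h\<bar> \<le> A k" using \<sigma> unfolding A_def by (subst pos_le_divide_eq) auto
          then have "X w - h \<in> {- A k..A k}" by (simp add: abs_le_iff)
          then show ?thesis by simp
        qed simp
      qed
      also have "\<dots> \<le> L ?x - L 0" by (rule staircase_le)
      finally show ?thesis .
    qed
    have "ereal (L 0 + staircase_risk \<sigma> n - \<epsilon>) \<le> ereal (L 0) + ereal (J - (\<integral>w. W (X w - h) \<partial>?Q))"
      using h(2) J\<omega> by simp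
    also have "ereal (J - (\<integral>w. W (X w - h) \<partial>?Q)) = enn2ereal (\<integral>\<^sup>+ w. ennreal (J - W (X w - h)) \<partial>?Q)"
    proof -
      have "(\<integral>\<^sup>+ w. ennreal (J - W (X w - h)) \<partial>?Q) = ennreal (\<integral>w. J - W (X w - h) \<partial>?Q)"
        using int W_le by (intro nn_integral_eq_integral) auto
      also have "(\<integral>w. J - W (X w - h) \<partial>?Q) = J - (\<integral>w. W (X w - h) \<partial>?Q)"
        using int by (simp add: Q.prob_space)
      finally have "(\<integral>\<^sup>+ w. ennreal (J - W (X w - h)) \<partial>?Q) = ennreal (J - (\<integral>w. W (X w - h) \<partial>?Q))" .
      moreover have "(\<integral>w. W (X w - h) \<partial>?Q) \<le> J" by (rule Q.integral_le_const[OF int]) (simp add: W_le)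
      ultimately show ?thesis by (simp add: enn2ereal_ennreal)
    qed
    also have "enn2ereal (\<integral>\<^sup>+ w. ennreal (J - W (X w - h)) \<partial>?Q)
        \<le> enn2ereal (\<integral>\<^sup>+ w. ennreal (L (sqrt t * (r t w - \<psi> ?a)) - L 0) \<partial>?Q)"
      by (simp only: less_eq_ennreal.rep_eq[symmetric]) (intro nn_integral_mono ennreal_leI pointwise)
    finally have "ereal (L 0 + staircase_risk \<sigma> n - \<epsilon>) \<le> risk M b v L r t (T ?a)"
      unfolding risk_tilted[OF aK] tilt \<psi>_def by (simp add: add_left_mono)
    moreover have "(\<lambda>_. ?a) \<in> local_params M s 1 (\<lambda>_. g) (c / sqrt t)"
      by (rule tilted_in_local_params[OF aK ac])
    ultimately show ?case
      by (intro SUP_upper2[of "\<lambda>_. ?a"]) (simp_all only: perturbed_supply_tilted)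
  qed
  then have "ereal (L 0 + staircase_risk \<sigma> n - \<epsilon>) \<le> local_risk M b v s L r 1 (\<lambda>_. g) c"
    unfolding local_risk_def by (rule Liminf_bounded)
  then show ?thesis by blast
qed

text \<open>
The staircase bounds hold for every \<open>n\<close>, and their lower limit is at least the normal risk. A degenerate normal law is a separate, trivial
case, in which the minimal loss \<open>L 0\<close> is a lower bound for any risk.
\<close>

lemma LAR_ge_normal_risk:
  assumes \<sigma>: "0 \<le> \<sigma>" and var: "E (\<lambda>\<theta>. (g \<theta>)\<^sup>2) = \<sigma>\<^sup>2"
    and deriv: "((\<lambda>a. FPPE_revenue M b v (T a)) has_real_derivative \<sigma>\<^sup>2) (at 0)"
  shows "ext_exp (normal_law 0 (\<sigma>\<^sup>2)) L \<le> LAR_REV M b v s L r"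
proof -
  let ?N = "density lborel std_normal_density"
  let ?I = "\<integral>\<^sup>+ z. ennreal (L (\<sigma> * z) - L 0) \<partial>?N"
  let ?X = "LAR_REV M b v s L r"
  interpret N: prob_space ?N by (rule prob_space_normal_density) simp
  have law: "normal_law 0 (\<sigma>\<^sup>2) = distr ?N borel (\<lambda>z. \<sigma> * z)"
    using \<sigma> by (simp add: normal_law_def)
  have "ext_exp (normal_law 0 (\<sigma>\<^sup>2)) L = ereal (L 0) + enn2ereal (\<integral>\<^sup>+ x. ennreal (L x - L 0) \<partial>distr ?N borel (\<lambda>z. \<sigma> * z))"
    unfolding law by (rule ext_exp_shift) (auto intro: N.prob_space_distr ge_0)
  also have "(\<integral>\<^sup>+ x. ennreal (L x - L 0) \<partial>distr ?N borel (\<lambda>z. \<sigma> * z)) = ?I"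
    by (rule nn_integral_distr) measurable
  finally have target: "ext_exp (normal_law 0 (\<sigma>\<^sup>2)) L = ereal (L 0) + enn2ereal ?I" .
  note lower = local_risk_le_LAR[OF g_in_G_dirs]
  have L0: "ereal (L 0) \<le> ?X" using local_risk_ge_L0 lower by (rule order_trans)
  show ?thesis
  proof (cases "\<sigma> = 0")
    case True
    then show ?thesis unfolding target using L0 by (simp add: zero_ennreal.rep_eq)
  next
    case False
    then have \<sigma>: "0 < \<sigma>" using \<sigma> by simp
    have stair: "ereal (L 0 + staircase_risk \<sigma> n) \<le> ?X" for n
    proof (cases "n = 0")
      case False
      show ?thesis
      proof (rule ereal_le_epsilon2)
        fix \<epsilon> :: real assume "0 < \<epsilon>"
        then obtain c where "ereal (L 0 + staircase_risk \<sigma> n - \<epsilon>) \<le> local_risk M b v s L r 1 (\<lambda>_. g) c"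
          using local_risk_ge_staircase[OF \<sigma> var deriv, of n \<epsilon>] False by blast
        also note lower
        finally show "ereal (L 0 + staircase_risk \<sigma> n) \<le> ?X + ereal \<epsilon>" by (cases ?X) auto
      qed
    qed (use L0 in \<open>simp add: staircase_risk_def\<close>)
    define Y where "Y = ?X - ereal (L 0)"
    have XY: "?X = ereal (L 0) + Y" unfolding Y_def by (cases ?X) auto
    have "0 \<le> Y" using L0 unfolding Y_def by (cases ?X) auto
    have "ennreal (staircase_risk \<sigma> n) \<le> e2ennreal Y" for n
    proof -
      have "ereal (staircase_risk \<sigma> n) \<le> Y" using stair[of n] unfolding Y_def by (cases ?X) auto
      then have "e2ennreal (ereal (staircase_risk \<sigma> n)) \<le> e2ennreal Y" by (rule e2ennreal_mono)
      then show ?thesis by simp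
    qed
    then have "liminf (\<lambda>n. ennreal (staircase_risk \<sigma> n)) \<le> liminf (\<lambda>n. e2ennreal Y)"
      by (intro Liminf_mono always_eventually) auto
    also have "\<dots> = e2ennreal Y" by (rule Liminf_const) simp
    finally have "?I \<le> e2ennreal Y" using normal_risk_le_liminf[OF \<sigma>] by (rule order_trans[rotated])
    then have "enn2ereal ?I \<le> Y"
      using \<open>0 \<le> Y\<close> by (metis enn2ereal_e2ennreal less_eq_ennreal.rep_eq)
    then show ?thesis unfolding target XY by (rule add_left_mono)
  qed
qed

end

theorem theorem2:
  fixes M :: "'a measure"
    and b \<beta> :: "real ^ 'n::finite"
    and v x :: "'n \<Rightarrow> 'a \<Rightarrow> real"
    and s p :: "'a \<Rightarrow> real"
    and L :: "real \<Rightarrow> real"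
  assumes "market M b v s"
    and "is_FPPE M b v s \<beta> p x"
    and "SMO M v s \<beta>"
    and "SCS M b s \<beta> p x"
    and "symmetric_loss L"
    and "quasi_convex L"
  shows "(INF r \<in> estimators M. LAR_REV M b v s L r)
           \<ge> ext_exp (normal_law 0 (sigma2_REV M b v s \<beta> p x)) L"
proof (rule INF_greatest)
  fix r assume r: "r \<in> estimators M"
  interpret market_env M b v s by unfold_locales fact
  note eq = assms(2)
  let ?D = "D_REV M b v s \<beta> p x"
  have Db: "ess_bounded M ?D" by (rule D_REV_bounded_and_pairing(1)[OF eq ess_bounded_const])
  obtain K0 where K0: "AE \<theta> in M. \<bar>?D \<theta>\<bar> \<le> K0" "0 \<le> K0" using Db by (rule ess_boundedE)
  define K where "K = K0 + 1"
  \<comment> \<open>The least favourable direction. Clamping changes it on a null set only and makes it bounded everywhere.\<close>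
  define g where "g \<theta> = max (- K) (min K (?D \<theta>))" for \<theta>
  have gD: "AE \<theta> in M. g \<theta> = ?D \<theta>"
    using K0(1) by eventually_elim (auto simp: g_def K_def)
  have Dm[measurable]: "?D \<in> borel_measurable M" using Db by (rule ess_bounded_measurable)
  have gm[measurable]: "g \<in> borel_measurable M" unfolding g_def by measurable
  have Eg: "E g = 0" using E_cong[OF gD gm Dm] D_REV_mean_zero[OF eq] by simp
  have var: "E (\<lambda>\<theta>. (g \<theta>)\<^sup>2) = sigma2_REV M b v s \<beta> p x"
    unfolding sigma2_REV_def by (rule E_cong) (use gD in \<open>auto elim!: eventually_mono\<close>)
  have cov: "E (\<lambda>\<theta>. g \<theta> * ?D \<theta>) = sigma2_REV M b v s \<beta> p x"
    unfolding sigma2_REV_def by (rule E_cong) (use gD in \<open>auto simp: power2_eq_square elim!: eventually_mono\<close>)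
  interpret tilted_loss M b v s g K L r
    by unfold_locales (use K0 Eg assms r in \<open>auto simp: g_def K_def\<close>)
  define \<sigma> where "\<sigma> = sqrt (sigma2_REV M b v s \<beta> p x)"
  have "0 \<le> sigma2_REV M b v s \<beta> p x"
    unfolding var[symmetric] supply_exp_def
    by (rule integral_nonneg_AE) (use s_nonneg in \<open>auto elim!: eventually_mono\<close>)
  then have \<sigma>: "0 \<le> \<sigma>" "\<sigma>\<^sup>2 = sigma2_REV M b v s \<beta> p x" by (simp_all add: \<sigma>_def)
  show "ext_exp (normal_law 0 (sigma2_REV M b v s \<beta> p x)) L \<le> LAR_REV M b v s L r"
    using LAR_ge_normal_risk[of \<sigma>] \<sigma> var cov revenue_pathwise_derivative[OF eq assms(3,4)] by simp
qed

end
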